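(* Let $E/\mathbb{Q}$ be an elliptic curve of conductor $N$ and let $f$ be the corresponding newform, with Fourier coefficients $a(n)$. Let $r\in\{3,5\}$ and suppose that $2r$ divides $|E_{\mathrm{tor}}(\mathbb{Q})|$. Let $p$ be a prime with $\gcd(p,2\cdot r\cdot N)=1$ and let $d\geq 1$ be an integer. If $a(p^{d-1})=r^v$ for some integer $v\geq 1$, then $d=r$.
   Context: $E_{\mathrm{tor}}(\mathbb{Q})$ is the torsion subgroup of $E(\mathbb{Q})$. The newform corresponding to an elliptic curve $E/\mathbb{Q}$ of conductor $N$ is the normalized newform $f(z)=q+\sum_{n\geq 2}a(n)q^n\in S_2^{new}(\Gamma_0(N))\cap\mathbb{Z}[[q]]$, $q=e^{2\pi i z}$, such that $a(p)=p+1-\#E(\mathbb{F}_p)$ for all primes $p\nmid N$. *)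

theory Defs
  imports
    "HOL-Analysis.Analysis"
    "HOL-Number_Theory.Cong"
    "HOL-Algebra.Ideal_Product"
    "HOL-Algebra.Generated_Fields"
begin

section \<open>Elliptic curves in Weierstrass form\<close>

text \<open>\<open>Weierstrass a\<^sub>1 a\<^sub>2 a\<^sub>3 a\<^sub>4 a\<^sub>6\<close> is the curve
  \<open>y\<^sup>2 + a\<^sub>1xy + a\<^sub>3y = x\<^sup>3 + a\<^sub>2x\<^sup>2 + a\<^sub>4x + a\<^sub>6\<close>. The generated \<open>map_weierstrass\<close>
  is base change along a ring homomorphism, and \<open>map_ec_point\<close> is the coordinatewise action.\<close>

datatype 'a weierstrass =
  Weierstrass (a\<^sub>1: 'a) (a\<^sub>2: 'a) (a\<^sub>3: 'a) (a\<^sub>4: 'a) (a\<^sub>6: 'a)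

datatype 'a ec_point = Infinity | Affine 'a 'a

definition weierstrass_poly :: "'a::comm_ring_1 weierstrass \<Rightarrow> 'a \<Rightarrow> 'a \<Rightarrow> 'a" where
  "weierstrass_poly E x y =
     y^2 + a\<^sub>1 E * x * y + a\<^sub>3 E * y - (x^3 + a\<^sub>2 E * x^2 + a\<^sub>4 E * x + a\<^sub>6 E)"

definition b\<^sub>2 :: "'a::comm_ring_1 weierstrass \<Rightarrow> 'a" where
  "b\<^sub>2 E = (a\<^sub>1 E)^2 + 4 * a\<^sub>2 E"

definition b\<^sub>4 :: "'a::comm_ring_1 weierstrass \<Rightarrow> 'a" where
  "b\<^sub>4 E = 2 * a\<^sub>4 E + a\<^sub>1 E * a\<^sub>3 E"

definition b\<^sub>6 :: "'a::comm_ring_1 weierstrass \<Rightarrow> 'a" where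
  "b\<^sub>6 E = (a\<^sub>3 E)^2 + 4 * a\<^sub>6 E"

definition b\<^sub>8 :: "'a::comm_ring_1 weierstrass \<Rightarrow> 'a" where
  "b\<^sub>8 E = (a\<^sub>1 E)^2 * a\<^sub>6 E + 4 * a\<^sub>2 E * a\<^sub>6 E - a\<^sub>1 E * a\<^sub>3 E * a\<^sub>4 E
           + a\<^sub>2 E * (a\<^sub>3 E)^2 - (a\<^sub>4 E)^2"

definition c\<^sub>4 :: "'a::comm_ring_1 weierstrass \<Rightarrow> 'a" where
  "c\<^sub>4 E = (b\<^sub>2 E)^2 - 24 * b\<^sub>4 E"

definition discriminant :: "'a::comm_ring_1 weierstrass \<Rightarrow> 'a" where
  "discriminant E =
     - ((b\<^sub>2 E)^2 * b\<^sub>8 E) - 8 * (b\<^sub>4 E)^3 - 27 * (b\<^sub>6 E)^2 + 9 * b\<^sub>2 E * b\<^sub>4 E * b\<^sub>6 E"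

definition elliptic_curve :: "'a::field weierstrass \<Rightarrow> bool" where
  "elliptic_curve E \<longleftrightarrow> discriminant E \<noteq> 0"

definition ec_points :: "'a::field weierstrass \<Rightarrow> 'a ec_point set" where
  "ec_points E = insert Infinity {Affine x y | x y. weierstrass_poly E x y = 0}"

fun ec_add :: "'a::field weierstrass \<Rightarrow> 'a ec_point \<Rightarrow> 'a ec_point \<Rightarrow> 'a ec_point" where
  "ec_add E Infinity Q = Q"
| "ec_add E P Infinity = P"
| "ec_add E (Affine x\<^sub>1 y\<^sub>1) (Affine x\<^sub>2 y\<^sub>2) =
     (if x\<^sub>1 = x\<^sub>2 \<and> y\<^sub>1 + y\<^sub>2 + a\<^sub>1 E * x\<^sub>2 + a\<^sub>3 E = 0 then Infinity
      else
        let l = (if x\<^sub>1 = x\<^sub>2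
                 then (3 * x\<^sub>1^2 + 2 * a\<^sub>2 E * x\<^sub>1 + a\<^sub>4 E - a\<^sub>1 E * y\<^sub>1)
                        / (2 * y\<^sub>1 + a\<^sub>1 E * x\<^sub>1 + a\<^sub>3 E)
                 else (y\<^sub>2 - y\<^sub>1) / (x\<^sub>2 - x\<^sub>1));
            m = y\<^sub>1 - l * x\<^sub>1;
            x\<^sub>3 = l^2 + a\<^sub>1 E * l - a\<^sub>2 E - x\<^sub>1 - x\<^sub>2
        in Affine x\<^sub>3 (- (l + a\<^sub>1 E) * x\<^sub>3 - m - a\<^sub>3 E))"

definition ec_group :: "'a::field weierstrass \<Rightarrow> 'a ec_point monoid" where
  "ec_group E = \<lparr>carrier = ec_points E, monoid.mult = ec_add E, one = Infinity\<rparr>"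

text \<open>Over \<open>\<rat>\<close> the torsion subgroup is finite, so its \<open>card\<close> is its order.\<close>

definition ec_torsion :: "'a::field weierstrass \<Rightarrow> 'a ec_point set" where
  "ec_torsion E =
     {P \<in> carrier (ec_group E).
        \<exists>n::nat. 0 < n \<and> P [^]\<^bsub>ec_group E\<^esub> n = \<one>\<^bsub>ec_group E\<^esub>}"

definition ec_torsion_of :: "'a::field weierstrass \<Rightarrow> nat \<Rightarrow> 'a ec_point set" where
  "ec_torsion_of E n =
     {P \<in> carrier (ec_group E). P [^]\<^bsub>ec_group E\<^esub> n = \<one>\<^bsub>ec_group E\<^esub>}"


section \<open>Minimal models and reduction\<close>

text \<open>The substitution \<open>x = u\<^sup>2x' + r\<close>, \<open>y = u\<^sup>3y' + u\<^sup>2sx' + t\<close> turns \<open>E\<close> into \<open>E'\<close>.\<close>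

definition ec_isomorphic :: "'a::field weierstrass \<Rightarrow> 'a weierstrass \<Rightarrow> bool" where
  "ec_isomorphic E E' \<longleftrightarrow> (\<exists>u r s t. u \<noteq> 0 \<and>
     u * a\<^sub>1 E' = a\<^sub>1 E + 2 * s \<and>
     u^2 * a\<^sub>2 E' = a\<^sub>2 E - s * a\<^sub>1 E + 3 * r - s^2 \<and>
     u^3 * a\<^sub>3 E' = a\<^sub>3 E + r * a\<^sub>1 E + 2 * t \<and>
     u^4 * a\<^sub>4 E' = a\<^sub>4 E - s * a\<^sub>3 E + 2 * r * a\<^sub>2 E - (t + r * s) * a\<^sub>1 E + 3 * r^2 - 2 * s * t \<and>
     u^6 * a\<^sub>6 E' = a\<^sub>6 E + r * a\<^sub>4 E + r^2 * a\<^sub>2 E + r^3 - t * a\<^sub>3 E - t^2 - r * t * a\<^sub>1 E)"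

definition integral_model :: "rat weierstrass \<Rightarrow> int weierstrass \<Rightarrow> bool" where
  "integral_model E W \<longleftrightarrow> ec_isomorphic E (map_weierstrass of_int W)"

text \<open>A Weierstrass equation minimal at \<open>p\<close>. Requiring the coefficients to be integral at every
  prime, not only at \<open>p\<close>, loses nothing: a scaling by a \<open>u\<close> prime to \<open>p\<close> clears the other
  denominators without changing the valuation of the discriminant at \<open>p\<close>.\<close>

definition minimal_model :: "nat \<Rightarrow> rat weierstrass \<Rightarrow> int weierstrass" where
  "minimal_model p E =
     (ARG_MIN (\<lambda>W. multiplicity (int p) (discriminant W)) W. integral_model E W)"

definition bad_reduction :: "rat weierstrass \<Rightarrow> nat \<Rightarrow> bool" where
  "bad_reduction E p \<longleftrightarrow> int p dvd discriminant (minimal_model p E)"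

text \<open>The singular point of the reduced curve is a node iff \<open>c\<^sub>4\<close> is a unit at \<open>p\<close>, and a cusp
  otherwise.\<close>

definition multiplicative_reduction :: "rat weierstrass \<Rightarrow> nat \<Rightarrow> bool" where
  "multiplicative_reduction E p \<longleftrightarrow>
     bad_reduction E p \<and> \<not> int p dvd c\<^sub>4 (minimal_model p E)"

text \<open>\<open>#E(\<bbbF>\<^sub>p)\<close>, with \<open>\<bbbF>\<^sub>p\<close> represented by the residues \<open>0, \<dots>, p - 1\<close>; the summand 1 is the
  point at infinity.\<close>

definition num_points_mod :: "rat weierstrass \<Rightarrow> nat \<Rightarrow> nat" where
  "num_points_mod E p =
     1 + card {(x, y). x \<in> {0..<int p} \<and> y \<in> {0..<int p} \<and>
                       [weierstrass_poly (minimal_model p E) x y = 0] (mod int p)}"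


section \<open>The conductor\<close>

text \<open>The conductor is the product of \<open>p\<^sup>f\<close> over the primes \<open>p\<close> of bad reduction, where \<open>f\<close>
  is 1 if the reduction is multiplicative and \<open>2 + \<delta>\<close> if it is additive. For any prime \<open>l \<noteq> p\<close>,
  the wild part is
  \<open>\<delta> = (\<Sum>i\<ge>1. |G\<^sub>i| / |G\<^sub>0| \<cdot> dim (E[l] / E[l]\<^bsup>G\<^sub>i\<^esup>))\<close>,
  with dimensions over the field of \<open>l\<close> elements and \<open>G\<^sub>i\<close> the lower ramification groups at \<open>p\<close> of
  the \<open>l\<close>-division field \<open>L = \<rat>(E[l])\<close>
  (Silverman, Advanced Topics in the Arithmetic of Elliptic Curves, IV.10). We realise \<open>L\<close> inside
  \<open>\<complex>\<close> and compute the \<open>G\<^sub>i\<close> in \<open>Gal(L/\<rat>)\<close> with respect to a prime ideal \<open>P\<close> above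
  \<open>p\<close>; restriction to the decomposition group of \<open>P\<close> is automatic from the definition of \<open>G\<^sub>i\<close>, and
  these are the ramification groups of the completion of \<open>L\<close> at \<open>P\<close>.\<close>

definition complex_ring :: "complex ring" where
  "complex_ring = \<lparr>carrier = UNIV, monoid.mult = (*), one = 1, ring.zero = 0, add = (+)\<rparr>"

definition division_field :: "rat weierstrass \<Rightarrow> nat \<Rightarrow> complex ring" where
  "division_field E l =
     complex_ring\<lparr>carrier := generate_field complex_ring
        (\<Union>P \<in> ec_torsion_of (map_weierstrass of_rat E) l. set_ec_point P)\<rparr>"

definition integer_ring :: "complex ring \<Rightarrow> complex ring" where
  "integer_ring L = L\<lparr>carrier := {x \<in> carrier L. algebraic_int x}\<rparr>"

text \<open>Automorphisms are taken to be undefined outside the field, so that each is counted once.\<close>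

definition galois_group :: "complex ring \<Rightarrow> (complex \<Rightarrow> complex) set" where
  "galois_group L = ring_iso L L \<inter> extensional (carrier L)"

definition prime_above :: "complex ring \<Rightarrow> nat \<Rightarrow> complex set" where
  "prime_above L p = (SOME P. primeideal P (integer_ring L) \<and> of_nat p \<in> P)"

definition ideal_power :: "complex ring \<Rightarrow> complex set \<Rightarrow> nat \<Rightarrow> complex set" where
  "ideal_power R P n = (ideal_prod R P ^^ n) (carrier R)"

definition ramification_group ::
    "complex ring \<Rightarrow> nat \<Rightarrow> nat \<Rightarrow> (complex \<Rightarrow> complex) set" where
  "ramification_group L p i =
     {\<sigma> \<in> galois_group L. \<forall>x \<in> carrier (integer_ring L).
        \<sigma> x - x \<in> ideal_power (integer_ring L) (prime_above L p) (Suc i)}"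

definition fixed_points :: "(complex \<Rightarrow> complex) set \<Rightarrow> complex ec_point set \<Rightarrow> complex ec_point set"
  where "fixed_points G T = {P \<in> T. \<forall>\<sigma> \<in> G. map_ec_point \<sigma> P = P}"

text \<open>The logarithm below is the dimension of \<open>E[l] / E[l]\<^bsup>G\<^sub>i\<^esup>\<close>. Almost all terms of the series
  vanish.\<close>

definition wild_conductor_sum :: "rat weierstrass \<Rightarrow> nat \<Rightarrow> nat \<Rightarrow> real" where
  "wild_conductor_sum E p l =
     (let T = ec_torsion_of (map_weierstrass of_rat E) l;
          G = ramification_group (division_field E l) p
      in \<Sum>i. real (card (G (Suc i))) / real (card (G 0)) *
              log (real l) (real (card T) / real (card (fixed_points (G (Suc i)) T))))"

text \<open>The value of the sum is a nonnegative integer and is independent of the prime \<open>l \<noteq> p\<close>, so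
  rounding down only changes its type.\<close>

definition wild_conductor_exponent :: "rat weierstrass \<Rightarrow> nat \<Rightarrow> nat" where
  "wild_conductor_exponent E p = nat \<lfloor>wild_conductor_sum E p (if p = 2 then 3 else 2)\<rfloor>"

definition conductor_exponent :: "rat weierstrass \<Rightarrow> nat \<Rightarrow> nat" where
  "conductor_exponent E p =
     (if \<not> bad_reduction E p then 0
      else if multiplicative_reduction E p then 1
      else 2 + wild_conductor_exponent E p)"

definition conductor :: "rat weierstrass \<Rightarrow> nat" where
  "conductor E = (\<Prod>p \<in> {p. prime p \<and> bad_reduction E p}. p ^ conductor_exponent E p)"


section \<open>Newforms of weight 2\<close>

definition SL2Z :: "(int^2^2) set" where
  "SL2Z = {A. det A = 1}"

definition Gamma0 :: "nat \<Rightarrow> (int^2^2) set" where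
  "Gamma0 N = {A \<in> SL2Z. int N dvd A $ 2 $ 1}"

definition upper_half_plane :: "complex set" where
  "upper_half_plane = {z. 0 < Im z}"

definition automorphy_factor :: "int^2^2 \<Rightarrow> complex \<Rightarrow> complex" where
  "automorphy_factor A z = of_int (A $ 2 $ 1) * z + of_int (A $ 2 $ 2)"

text \<open>The weight 2 action of the modular group on functions on the upper half plane.\<close>

definition slash :: "(complex \<Rightarrow> complex) \<Rightarrow> int^2^2 \<Rightarrow> complex \<Rightarrow> complex" where
  "slash f A z =
     f ((of_int (A $ 1 $ 1) * z + of_int (A $ 1 $ 2)) / automorphy_factor A z)
       / (automorphy_factor A z)^2"

text \<open>The space \<open>S\<^sub>2(\<Gamma>\<^sub>0(N))\<close>. As \<open>f|A\<close> is invariant under some translation, vanishing of \<open>f\<close> at the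
  cusp \<open>A\<infinity>\<close> (only positive powers of \<open>q\<close> in the expansion of \<open>f|A\<close>) means that \<open>f|A\<close> tends
  to 0 as the imaginary part tends to infinity. Only values on the upper half plane matter.\<close>

definition cusp_forms :: "nat \<Rightarrow> (complex \<Rightarrow> complex) set" where
  "cusp_forms N = {f.
     f holomorphic_on upper_half_plane \<and>
     (\<forall>A \<in> Gamma0 N. \<forall>z \<in> upper_half_plane. slash f A z = f z) \<and>
     (\<forall>A \<in> SL2Z. (slash f A \<longlongrightarrow> 0) (filtercomap Im at_top))}"

definition has_q_expansion :: "(complex \<Rightarrow> complex) \<Rightarrow> (nat \<Rightarrow> complex) \<Rightarrow> bool" where
  "has_q_expansion f c \<longleftrightarrow>
     (\<forall>z \<in> upper_half_plane. (\<lambda>n. c n * exp (2 * of_real pi * \<i> * z) ^ n) sums f z)"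

text \<open>For primes \<open>p\<close> dividing \<open>N\<close> this is the operator often written \<open>U\<^sub>p\<close>.\<close>

definition hecke :: "nat \<Rightarrow> nat \<Rightarrow> (complex \<Rightarrow> complex) \<Rightarrow> complex \<Rightarrow> complex" where
  "hecke N p f z =
     (\<Sum>j<p. f ((z + of_nat j) / of_nat p)) / of_nat p
     + (if p dvd N then 0 else of_nat p * f (of_nat p * z))"

definition hecke_eigenform :: "nat \<Rightarrow> (complex \<Rightarrow> complex) \<Rightarrow> bool" where
  "hecke_eigenform N f \<longleftrightarrow>
     (\<forall>p. prime p \<longrightarrow> (\<exists>c. \<forall>z \<in> upper_half_plane. hecke N p f z = c * f z))"

definition modular_fundamental_domain :: "complex set" where
  "modular_fundamental_domain = {z. 0 < Im z \<and> \<bar>Re z\<bar> \<le> 1/2 \<and> 1 \<le> norm z}"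

definition Gamma0_cosets :: "nat \<Rightarrow> (int^2^2) set set" where
  "Gamma0_cosets N = (\<lambda>A. (\<lambda>B. B ** A) ` Gamma0 N) ` SL2Z"

text \<open>The (unnormalised) Petersson product, with the integral over a fundamental domain of
  \<open>\<Gamma>\<^sub>0(N)\<close> written as a sum over coset representatives. In weight 2 the factor \<open>y\<^sup>2\<close>
  cancels against the invariant measure \<open>dx dy / y\<^sup>2\<close>.\<close>

definition petersson ::
    "nat \<Rightarrow> (complex \<Rightarrow> complex) \<Rightarrow> (complex \<Rightarrow> complex) \<Rightarrow> complex" where
  "petersson N f g =
     (\<Sum>C \<in> Gamma0_cosets N. let A = (SOME A. A \<in> C) in
        set_lebesgue_integral lborel modular_fundamental_domain
          (\<lambda>z. slash f A z * cnj (slash g A z)))"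

text \<open>The new subspace is the orthogonal complement of the old subspace, which is spanned by the
  functions \<open>g(ez)\<close> for \<open>g\<close> a cusp form of level a proper divisor \<open>M\<close> of \<open>N\<close> and \<open>e\<close> a
  divisor of \<open>N / M\<close>.\<close>

definition new_subspace :: "nat \<Rightarrow> (complex \<Rightarrow> complex) set" where
  "new_subspace N = {f \<in> cusp_forms N.
     \<forall>M e g. M \<noteq> N \<longrightarrow> M * e dvd N \<longrightarrow> g \<in> cusp_forms M \<longrightarrow>
       petersson N f (\<lambda>z. g (of_nat e * z)) = 0}"

definition normalized_newform :: "nat \<Rightarrow> (complex \<Rightarrow> complex) \<Rightarrow> bool" where
  "normalized_newform N f \<longleftrightarrow>
     f \<in> new_subspace N \<and> hecke_eigenform N f \<and>
     (\<exists>c. has_q_expansion f c \<and> c 1 = 1)"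

text \<open>\<open>f\<close> is the newform corresponding to \<open>E\<close>, and its Fourier coefficients are the
  integers \<open>a n\<close>.\<close>

definition corresponding_newform ::
    "rat weierstrass \<Rightarrow> (complex \<Rightarrow> complex) \<Rightarrow> (nat \<Rightarrow> int) \<Rightarrow> bool" where
  "corresponding_newform E f a \<longleftrightarrow>
     normalized_newform (conductor E) f \<and>
     has_q_expansion f (\<lambda>n. of_int (a n)) \<and>
     (\<forall>p. prime p \<longrightarrow> \<not> p dvd conductor E \<longrightarrow> a p = int p + 1 - int (num_points_mod E p))"

end

theory Submission
  imports Defs "HOL-Computational_Algebra.Formal_Laurent_Series" "HOL-Library.Set_Algebras"
    "HOL-Algebra.Sylow"
begin

text \<open>
  The coefficients \<open>a(p\<^sup>n)\<close> form the Lucas sequence with parameters \<open>a(p)\<close> and \<open>p\<close>, and the torsion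
  subgroup forces \<open>a(p) \<equiv> p + 1\<close> modulo \<open>2r\<close>. If \<open>u\<^sub>d = a(p\<^sup>d\<^sup>-\<^sup>1)\<close> is a power of \<open>r\<close>, then \<open>d\<close> is odd,
  \<open>p \<equiv> 1\<close> modulo \<open>r\<close> and \<open>d = rm\<close>. No primitive divisor theorem is needed. If \<open>r\<close> does not divide
  \<open>m\<close>, then \<open>u\<^sub>m\<close> and \<open>u\<^sub>d / u\<^sub>r\<close> are \<open>\<plusminus>1\<close>, so \<open>u\<^sub>r\<close> takes the same value, up to sign, at \<open>(D, p)\<close> and
  \<open>(D, p\<^sup>m)\<close>, where \<open>D = a(p)\<^sup>2 - 4p\<close> is the discriminant and \<open>u\<^sub>r\<close> is viewed as a quadratic or linear
  form in \<open>D\<close> and \<open>p\<close>; for reasons of size this forces \<open>m = 1\<close>. If \<open>r\<close> divides \<open>m\<close>, then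
  \<open>u\<close> with index \<open>r\<^sup>2\<close> divided by \<open>u\<^sub>r\<close> is exactly \<open>r\<close>, again impossible for reasons of size.

  For the congruence, torsion points have \<open>p\<close>-integral coordinates (the kernel of reduction has no
  torsion) and reduction is injective on them, so the torsion subgroup is finite and contains points
  of order \<open>2\<close> and \<open>r\<close>. Their reductions act freely by translation on the points modulo \<open>p\<close>.
  These translations are written out as explicit maps, which avoids the group law modulo \<open>p\<close>.
  Over \<open>\<rat>\<close> the group law is obtained from the multiplication of ideals of the coordinate ring,
  embedded into Laurent series at infinity.
\<close>

section \<open>Prime powers in Lucas sequences\<close>

text \<open>That \<open>r\<close> is 3 or 5 enters first through the units modulo \<open>r\<close>:
  their group has order 2 or 4, a power of two. The factor 2 in \<open>2r\<close> makes
  \<open>a(p)\<close> even for odd \<open>p\<close>, so terms of even index are even and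
  \<open>d\<close> must be odd; then \<open>p^d = 1\<close> modulo \<open>r\<close> already gives
  \<open>p = 1\<close>, hence \<open>a(p) = 2\<close>. Both roots of \<open>x^2 - a(p) x + p\<close>
  are then 1 modulo \<open>r\<close>, and the term of index \<open>d\<close> is congruent to
  \<open>d\<close>. The size arguments work because \<open>D \<ge> -4p\<close>, which is just
  \<open>a(p)^2 \<ge> 0\<close>, while replacing \<open>p\<close> by \<open>p^m\<close> makes the
  second argument of the form dominate. On the side of the curve, a rational torsion point helps
  modulo \<open>p\<close> only through identities that survive reduction. A point of order
  \<open>r\<close> is moved to the origin with horizontal tangent, and its order becomes one
  polynomial relation between the remaining coefficients. Translation by it is described away from
  its multiples, where slopes serve as coordinates; these multiples, including the point at
  infinity, contribute exactly \<open>r\<close> more points.\<close>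

fun lucas :: "int \<Rightarrow> int \<Rightarrow> nat \<Rightarrow> int" where
  "lucas P Q 0 = 0"
| "lucas P Q (Suc 0) = 1"
| "lucas P Q (Suc (Suc n)) = P * lucas P Q (Suc n) - Q * lucas P Q n"

text \<open>The sequence \<open>\<alpha>^n + \<beta>^n\<close> for the roots of
  \<open>x^2 - P x + Q\<close>, written so that no roots are needed.\<close>

definition lucas_companion :: "int \<Rightarrow> int \<Rightarrow> nat \<Rightarrow> int" where
  "lucas_companion P Q n = 2 * lucas P Q (Suc n) - P * lucas P Q n"

lemma lucas_companion_rec:
  "lucas_companion P Q (Suc (Suc n)) =
     P * lucas_companion P Q (Suc n) - Q * lucas_companion P Q n"
  by (simp add: lucas_companion_def algebra_simps)

text \<open>The left side is the norm of \<open>u(n+1) - \<beta> u(n)\<close>, which equals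
  \<open>\<alpha>^n\<close>; here \<open>\<alpha>\<close> and \<open>\<beta>\<close> are the roots
  of \<open>x^2 - P x + Q\<close>.\<close>

lemma lucas_norm:
  "lucas P Q (Suc n) ^ 2 - P * lucas P Q (Suc n) * lucas P Q n + Q * lucas P Q n ^ 2 = Q ^ n"
proof (induction n)
  case (Suc n)
  have "lucas P Q (Suc (Suc n)) ^ 2 - P * lucas P Q (Suc (Suc n)) * lucas P Q (Suc n)
          + Q * lucas P Q (Suc n) ^ 2
        = Q * (lucas P Q (Suc n) ^ 2 - P * lucas P Q (Suc n) * lucas P Q n + Q * lucas P Q n ^ 2)"
    by (simp add: algebra_simps power2_eq_square)
  then show ?case
    using Suc.IH by simp
qed simp

text \<open>\<open>\<alpha>^n - \<beta>^n\<close> is \<open>u(n)\<close> times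
  \<open>\<alpha> - \<beta>\<close>, so passing to the \<open>n\<close>-th powers of the roots
  multiplies the discriminant by \<open>u(n)^2\<close>.\<close>

lemma lucas_companion_discriminant:
  "lucas_companion P Q n ^ 2 - 4 * Q ^ n = (P ^ 2 - 4 * Q) * lucas P Q n ^ 2"
  unfolding lucas_companion_def lucas_norm[of P Q n, symmetric]
  by (simp add: algebra_simps power2_eq_square)

text \<open>This is the recurrence for \<open>\<alpha>^m\<close> and \<open>\<beta>^m\<close>, with
  steps of length \<open>m\<close>. Calling the lowest index \<open>k\<close> avoids subtraction on
  \<open>nat\<close>.\<close>

lemma lucas_skip:
  "lucas P Q (k + 2 * m) = lucas_companion P Q m * lucas P Q (k + m) - Q ^ m * lucas P Q k"
proof (induction m arbitrary: k rule: induct_nat_012)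
  case 0
  then show ?case by (simp add: lucas_companion_def)
next
  case 1
  then show ?case by (simp add: lucas_companion_def)
next
  case (ge2 m)
  have 1: "lucas_companion P Q (Suc m) * lucas P Q (k + m + 2)
      = lucas P Q (k + 2 * m + 3) + Q ^ Suc m * lucas P Q (Suc k)"
    using ge2(2)[of "Suc k"] by (simp add: numeral_eq_Suc)
  have 2: "lucas_companion P Q m * lucas P Q (k + m + 2)
      = lucas P Q (k + 2 * m + 2) + Q ^ m * lucas P Q (Suc (Suc k))"
    using ge2(1)[of "Suc (Suc k)"] by (simp add: numeral_eq_Suc)
  have 3: "lucas P Q (k + 2 * Suc (Suc m))
      = P * lucas P Q (k + 2 * m + 3) - Q * lucas P Q (k + 2 * m + 2)"
    by (simp add: numeral_eq_Suc)
  have "lucas_companion P Q (Suc (Suc m)) * lucas P Q (k + m + 2)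
     = P * (lucas_companion P Q (Suc m) * lucas P Q (k + m + 2))
        - Q * (lucas_companion P Q m * lucas P Q (k + m + 2))"
    unfolding lucas_companion_rec by (simp add: algebra_simps)
  also have "\<dots> = P * (lucas P Q (k + 2 * m + 3) + Q ^ Suc m * lucas P Q (Suc k))
       - Q * (lucas P Q (k + 2 * m + 2) + Q ^ m * (P * lucas P Q (Suc k) - Q * lucas P Q k))"
    unfolding 1 2 by simp
  also have "\<dots> = lucas P Q (k + 2 * Suc (Suc m)) + Q ^ Suc (Suc m) * lucas P Q k"
    unfolding 3 by (simp add: algebra_simps)
  finally show ?case
    by simp
qed

text \<open>By \<open>lucas_skip\<close> every \<open>m\<close>-th term obeys the recurrence of the
  \<open>m\<close>-th powers of the roots, so these terms are \<open>u(m)\<close> times another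
  Lucas sequence.\<close>

lemma lucas_mult:
  "lucas P Q (m * n) = lucas P Q m * lucas (lucas_companion P Q m) (Q ^ m) n"
proof (induction n rule: induct_nat_012)
  case (ge2 n)
  have "m * Suc (Suc n) = m * n + 2 * m"
    by simp
  then have "lucas P Q (m * Suc (Suc n)) = lucas P Q (m * n + 2 * m)"
    by (rule arg_cong)
  also have "\<dots> = lucas_companion P Q m * lucas P Q (m * Suc n) - Q ^ m * lucas P Q (m * n)"
    unfolding lucas_skip by (simp add: algebra_simps)
  finally show ?case
    using ge2 by (simp add: algebra_simps)
qed simp_all

section \<open>Congruences for Lucas sequences\<close>

lemma lucas_cong_index:
  assumes "[P = 2] (mod r)" "[Q = 1] (mod r)"
  shows "[lucas P Q n = int n] (mod r)"
proof (induction n rule: induct_nat_012)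
  case (ge2 n)
  have "[P * lucas P Q (Suc n) - Q * lucas P Q n = 2 * int (Suc n) - 1 * int n] (mod r)"
    by (intro cong_diff cong_mult assms ge2)
  then show ?case
    by (simp add: algebra_simps)
qed simp_all

lemma lucas_companion_cong:
  assumes "[P = 2] (mod r)" "[Q = 1] (mod r)"
  shows "[lucas_companion P Q n = 2] (mod r)"
proof -
  have "[lucas_companion P Q n = 2 * int (Suc n) - 2 * int n] (mod r)"
    unfolding lucas_companion_def
    by (intro cong_diff cong_mult cong_refl assms(1) lucas_cong_index[OF assms])
  then show ?thesis
    by (simp add: algebra_simps)
qed

text \<open>Modulo \<open>r\<close> the roots of \<open>x^2 - P x + Q\<close> are 1 and
  \<open>Q\<close>; multiplying by \<open>Q - 1\<close> sums the geometric series without a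
  division.\<close>

lemma lucas_cong_geometric:
  assumes "[P = Q + 1] (mod r)"
  shows "[(Q - 1) * lucas P Q n = Q ^ n - 1] (mod r)"
proof (induction n rule: induct_nat_012)
  case (ge2 n)
  have "[P * ((Q - 1) * lucas P Q (Suc n)) - Q * ((Q - 1) * lucas P Q n)
        = (Q + 1) * (Q ^ Suc n - 1) - Q * (Q ^ n - 1)] (mod r)"
    by (intro cong_diff cong_mult cong_refl assms ge2)
  then show ?case
    by (simp add: algebra_simps)
qed simp_all

lemma even_lucas_even:
  assumes "even P"
  shows "even (lucas P Q (2 * n))"
  using assms unfolding lucas_mult by (simp add: numeral_2_eq_2)

text \<open>The term of index \<open>r\<close> after eliminating \<open>P^2 = D + 4 Q\<close>. All
  coefficients except that of the pure power of \<open>D\<close> are divisible by \<open>r\<close>,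
  which gives control modulo \<open>r^2\<close> once \<open>r\<close> divides
  \<open>D\<close>.\<close>

definition lucas_form :: "nat \<Rightarrow> int \<Rightarrow> int \<Rightarrow> int" where
  "lucas_form r D Q = (if r = 3 then D + 3 * Q else D ^ 2 + 5 * D * Q + 5 * Q ^ 2)"

lemma lucas_eq_form:
  assumes "r \<in> {3, 5}"
  shows "lucas P Q r = lucas_form r (P ^ 2 - 4 * Q) Q"
proof -
  have "lucas P Q 3 = lucas_form 3 (P ^ 2 - 4 * Q) Q"
    by (simp add: lucas_form_def numeral_3_eq_3 power2_eq_square)
  moreover have "lucas P Q 5 = lucas_form 5 (P ^ 2 - 4 * Q) Q"
  proof -
    have "lucas P Q (Suc (Suc (Suc (Suc (Suc 0))))) = lucas_form 5 (P ^ 2 - 4 * Q) Q"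
      by (simp add: lucas_form_def power2_eq_square algebra_simps)
    then show ?thesis by (simp add: eval_nat_numeral)
  qed
  ultimately show ?thesis
    using assms by auto
qed

lemma lucas_mult_form:
  assumes "r \<in> {3, 5}"
  shows "lucas P Q (m * r) =
    lucas P Q m * lucas_form r ((P ^ 2 - 4 * Q) * lucas P Q m ^ 2) (Q ^ m)"
  unfolding lucas_mult lucas_eq_form[OF assms] lucas_companion_discriminant ..

text \<open>A divisor of \<open>r^v\<close> is a signed power of \<open>r\<close>. Modulo
  \<open>r^2\<close> the only one congruent to \<open>r\<close> is \<open>r\<close> itself;
  \<open>- r\<close> is excluded because \<open>r\<close> does not divide 2.\<close>

lemma dvd_prime_power_cong_imp_eq:
  fixes r :: nat and s :: int
  assumes "prime r" "2 < r" "s dvd int r ^ v" "[s = int r] (mod int r ^ 2)"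
  shows "s = int r"
proof -
  have "nat \<bar>s\<bar> dvd r ^ v"
    using assms(3) by (simp add: nat_abs_dvd_iff)
  then obtain j where j: "nat \<bar>s\<bar> = r ^ j"
    using divides_primepow_nat[OF assms(1)] by blast
  have s: "s = int r ^ j \<or> s = - (int r ^ j)"
  proof -
    have "\<bar>s\<bar> = int r ^ j"
      using j by (metis abs_ge_zero int_nat_eq of_nat_power)
    then show ?thesis by linarith
  qed
  have d: "int r ^ 2 dvd s - int r"
    using assms(4) by (simp add: cong_iff_dvd_diff)
  have rs: "int r dvd s"
    using d by (metis dvd_add_right_iff dvd_power dvd_refl dvd_trans pos2 diff_add_cancel add.commute)
  have "j \<noteq> 0"
  proof
    assume "j = 0"
    then have "is_unit (int r)"
      using rs s by auto
    then show False using assms(2) by simp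
  qed
  moreover have "\<not> 2 \<le> j"
  proof
    assume "2 \<le> j"
    then have "int r ^ 2 dvd s"
      using s by (auto simp: le_imp_power_dvd)
    then have "int r ^ 2 dvd int r"
      using d by (metis dvd_diff_commute dvd_diff_right_iff)
    then show False
      using assms(2) zdvd_imp_le[of "int r ^ 2" "int r"] by (simp add: power2_eq_square)
  qed
  ultimately have "j = 1" by linarith
  moreover have "s \<noteq> - int r"
  proof
    assume "s = - int r"
    then have "int r * int r dvd int r * 2"
      using d dvd_minus_iff[of "int r ^ 2" "int r * 2"] by (simp add: power2_eq_square)
    then have "int r dvd 2"
      using assms(2) by (subst (asm) dvd_mult_cancel_left) auto
    then show False
      using assms(2) zdvd_imp_le[of "int r" 2] by simp
  qed
  ultimately show ?thesis
    using s by auto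
qed

lemma dvd_prime_power_not_dvd_imp_unit:
  fixes r :: nat and s :: int
  assumes "prime r" "s dvd int r ^ v" "\<not> int r dvd s"
  shows "\<bar>s\<bar> = 1"
proof -
  have "coprime s (int r)"
    using assms(1,3) prime_imp_coprime[of "int r" s] by (simp add: coprime_commute)
  then have "coprime s (int r ^ v)"
    by simp
  then have "is_unit s"
    using assms(2) coprime_absorb_left by blast
  then show ?thesis
    by simp
qed

text \<open>The lower bound on \<open>D\<close> limits the negative terms, and \<open>x\<close> is
  large enough to outweigh them. The factor 49 is \<open>7^2\<close>: the use is with
  \<open>x = Q^m\<close>, \<open>m \<ge> 3\<close> and \<open>Q \<ge> 7\<close>.\<close>

lemma lucas_form_growth:
  fixes D Q x :: int
  assumes "r \<in> {3, 5}" "7 \<le> Q" "- (4 * Q) \<le> D" "49 * Q \<le> x"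
  shows "\<bar>lucas_form r D x\<bar> \<noteq> \<bar>lucas_form r D Q\<bar>"
proof
  assume "\<bar>lucas_form r D x\<bar> = \<bar>lucas_form r D Q\<bar>"
  then have eq: "lucas_form r D x = lucas_form r D Q \<or> lucas_form r D x = - lucas_form r D Q"
    by (simp add: abs_eq_iff)
  show False
  proof (cases "r = 3")
    case True
    then show ?thesis
      using eq assms(2-4) by (auto simp: lucas_form_def)
  next
    case False
    \<comment> \<open>With equal signs the difference of the two values factors; with opposite signs
      their sum is a form that is positive for these sizes.\<close>
    with eq have "5 * (x - Q) * (D + x + Q) = 0 \<or>
        2 * D ^ 2 + 5 * D * (x + Q) + 5 * (x ^ 2 + Q ^ 2) = 0"
      by (simp add: lucas_form_def power2_eq_square algebra_simps)
    then show ?thesis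
    proof
      assume "5 * (x - Q) * (D + x + Q) = 0"
      then show False
        using assms(2-4) by auto
    next
      assume *: "2 * D ^ 2 + 5 * D * (x + Q) + 5 * (x ^ 2 + Q ^ 2) = 0"
      have "- (4 * Q) * (x + Q) \<le> D * (x + Q)"
        using assms(2-4) by (intro mult_right_mono) auto
      moreover have "49 * Q * x \<le> x * x"
        using assms(2-4) by (intro mult_right_mono) auto
      moreover have "0 < Q * x"
        using assms(2-4) by simp
      moreover have "Q * Q \<le> Q * x"
        using assms(2-4) by (intro mult_left_mono) auto
      moreover have "0 \<le> D * D" "0 \<le> Q * Q" by simp_all
      ultimately show False
        using * assms(2) unfolding power2_eq_square distrib_left distrib_right by auto
    qed
  qed
qed

text \<open>For \<open>t\<close> the term of index 3, the equation says that the term of index 9 is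
  \<open>3 t\<close>, with \<open>D = t - 3 Q\<close> inserted. Putting \<open>t = 3 w\<close> and
  \<open>Q = 1 + 3 k\<close> turns it into \<open>k (1 + 3 k + 3 k^2) = w^2 (Q - w)\<close>. As
  \<open>w\<close> is a signed power of 3, \<open>w^2\<close> divides \<open>k\<close>, and
  \<open>w^2 \<le> k\<close> makes the right side too small.\<close>

lemma no_solution_three:
  fixes Q t :: int
  assumes "7 \<le> Q" "[Q = 1] (mod 3)" "t dvd 3 ^ v" "(t - 3 * Q) * t ^ 2 + 3 * Q ^ 3 = 3"
  shows False
proof -
  have "3 dvd t ^ 3"
  proof -
    have "t ^ 3 = 3 * (1 + Q * t ^ 2 - Q ^ 3)"
      using assms(4) by (simp add: algebra_simps power2_eq_square power3_eq_cube)
    then show ?thesis by simp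
  qed
  then have "3 dvd t"
    using prime_dvd_power[of "3 :: int" t 3] by simp
  then obtain w where w: "t = 3 * w" by blast
  obtain k where k: "Q = 1 + 3 * k"
    using assms(2) by (metis cong_iff_lin cong_sym)
  have eq: "Q ^ 3 - 1 = 9 * w ^ 2 * (Q - w)"
    using assms(4) unfolding w by (simp add: algebra_simps power2_eq_square power3_eq_cube)
  have "3 * k * (1 + 3 * k + 3 * k ^ 2) = 3 * w ^ 2 * (Q - w)"
    using eq unfolding k by (simp add: algebra_simps power2_eq_square power3_eq_cube)
  then have "k * (1 + 3 * k + 3 * k ^ 2) = w ^ 2 * (Q - w)"
    by simp
  then have "w ^ 2 dvd k * (1 + 3 * k + 3 * k ^ 2)"
    by (rule dvdI)
  moreover have "coprime (w ^ 2) (1 + 3 * k + 3 * k ^ 2)"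
  proof -
    have "coprime (3 :: int) (1 + 3 * (k + k ^ 2))"
    proof (rule coprimeI)
      fix c :: int
      assume "c dvd 3" "c dvd 1 + 3 * (k + k ^ 2)"
      then show "is_unit c"
        using dvd_add_left_iff[of c "3 * (k + k ^ 2)" 1] dvd_mult2[of c 3 "k + k ^ 2"] by blast
    qed
    then have "coprime (3 ^ v :: int) (1 + 3 * (k + k ^ 2))"
      by simp
    moreover have "w dvd 3 ^ v"
      using assms(3) w by (metis dvd_mult_right)
    ultimately have "coprime w (1 + 3 * (k + k ^ 2))"
      by (meson coprime_divisors dvd_refl)
    then show ?thesis
      by (simp add: algebra_simps)
  qed
  ultimately have "w ^ 2 dvd k"
    by (simp add: coprime_dvd_mult_left_iff)
  then have le: "w ^ 2 \<le> k"
    using assms(1) k zdvd_imp_le by force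
  have "\<bar>w\<bar> \<le> w ^ 2"
  proof (cases "w = 0")
    case False
    then have "\<bar>w\<bar> * 1 \<le> \<bar>w\<bar> * \<bar>w\<bar>"
      by (intro mult_left_mono) auto
    then show ?thesis by (simp add: power2_eq_square)
  qed simp
  then have "Q - w \<le> Q + k"
    using le by linarith
  then have "9 * w ^ 2 * (Q - w) \<le> 9 * w ^ 2 * (Q + k)"
    by (intro mult_left_mono) auto
  also have "\<dots> \<le> 9 * k * (Q + k)"
    using le assms(1) k by (intro mult_right_mono) auto
  finally have "Q ^ 3 - 1 \<le> 9 * k * (Q + k)"
    using eq by simp
  then have "9 * k + 27 * k ^ 2 + 27 * k ^ 3 \<le> 9 * k + 36 * k ^ 2"
    unfolding k by (simp add: algebra_simps power2_eq_square power3_eq_cube)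
  moreover have "2 * k ^ 2 \<le> k ^ 3"
    using assms(1) k by (simp add: power2_eq_square power3_eq_cube mult_right_mono)
  moreover have "0 < k ^ 2"
    using assms(1) k by simp
  ultimately show False by linarith
qed

text \<open>The equation says that the term of index 25 is 5 times the term of index 5, when the
  latter is 5. Since \<open>D \<ge> - 4 Q\<close>, the mixed term is at least
  \<open>- 500 Q^6\<close>, too small to offset \<open>5 Q^10\<close>.\<close>

lemma no_solution_five:
  fixes D Q :: int
  assumes "7 \<le> Q" "- (4 * Q) \<le> D" "625 * D ^ 2 + 125 * D * Q ^ 5 + 5 * Q ^ 10 = 5"
  shows False
proof -
  have "- (4 * Q) * Q ^ 5 \<le> D * Q ^ 5"
    using assms(1,2) by (intro mult_right_mono) auto
  moreover have "- (4 * Q) * Q ^ 5 = - 4 * Q ^ 6"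
    by (simp add: eval_nat_numeral)
  moreover have "7 ^ 4 * Q ^ 6 \<le> Q ^ 4 * Q ^ 6"
    using assms(1) by (intro mult_right_mono power_mono) auto
  moreover have "Q ^ 4 * Q ^ 6 = Q ^ 10"
    by (simp flip: power_add)
  moreover have "1 \<le> Q ^ 6"
    using assms(1) by (simp add: one_le_power)
  moreover have "0 \<le> D ^ 2" by simp
  ultimately show False
    using assms(3) by (simp add: mult.assoc)
qed

theorem lucas_prime_power_index:
  fixes P :: int and p r d v :: nat
  assumes r: "r \<in> {3, 5}" and p: "prime p" "p \<noteq> 2" "p \<noteq> r"
    and P: "[P = int p + 1] (mod int (2 * r))"
    and U: "lucas P (int p) d = int r ^ v" and v: "1 \<le> v"
  shows "d = r"
proof -
  define Q where "Q = int p"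
  define D where "D = P ^ 2 - 4 * Q"
  have pr: "prime r" "2 < r" using r by auto
  have oddQ: "odd Q"
    using p unfolding Q_def by (simp add: prime_odd_nat prime_ge_2_nat order.not_eq_order_implies_strict)
  have P2: "[P = Q + 1] (mod 2)" and Pr: "[P = Q + 1] (mod int r)"
    using P unfolding Q_def by (auto intro: cong_dvd_modulus)
  have "even P"
    using P2 oddQ by (metis cong_dvd_iff dvd_refl odd_even_add odd_one)
  \<comment> \<open>For even \<open>P\<close> the terms of even index are even, whereas
    \<open>r^v\<close> is odd.\<close>
  then have oddd: "odd d"
    using U r even_lucas_even[of P "int p"] by (metis evenE even_power insertE odd_numeral of_nat_numeral singletonD)
  have rU: "int r dvd lucas P Q d"
    using U v unfolding Q_def by simp
  have Qd: "[Q ^ d = 1] (mod int r)"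
    using lucas_cong_geometric[OF Pr, of d] rU
    by (metis cong_0_iff cong_diff_iff_cong_0 cong_sym cong_trans dvd_mult)
  have Q1: "[Q = 1] (mod int r)"
  proof -
    have ndvd: "\<not> int r dvd Q"
      using p(1,3) pr(1) unfolding Q_def by (simp add: primes_dvd_imp_eq) (metis primes_dvd_imp_eq)
    obtain k where k: "d = 2 * k + 1"
      using oddd by (elim oddE)
    \<comment> \<open>As \<open>d\<close> is odd, \<open>Q^2 = 1\<close> turns
      \<open>Q^d = 1\<close> into \<open>Q = 1\<close>; so it is enough to show that
      \<open>Q^2 = 1\<close> modulo \<open>r\<close>.\<close>
    have pw: "[Q ^ 2 = 1] (mod int r) \<Longrightarrow> ?thesis"
    proof -
      assume "[Q ^ 2 = 1] (mod int r)"
      then have "[(Q ^ 2) ^ k * Q = 1 ^ k * Q] (mod int r)"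
        by (intro cong_mult cong_pow cong_refl)
      moreover have "Q ^ d = (Q ^ 2) ^ k * Q"
        unfolding k by (simp add: power_mult)
      ultimately have "[Q ^ d = Q] (mod int r)"
        by simp
      then show ?thesis
        using Qd by (metis cong_sym cong_trans)
    qed
    show ?thesis
    proof (cases "r = 3")
      case True
      then have "Q mod 3 = 1 \<or> Q mod 3 = 2"
        using ndvd by (auto simp: dvd_eq_mod_eq_0) 
      then have "(Q mod 3) ^ 2 mod 3 = 1"
        by auto
      then have "Q ^ 2 mod 3 = 1"
        by (simp add: power_mod)
      then show ?thesis
        using pw True by (simp add: cong_def)
    next
      case False
      then have r5: "r = 5" using r by simp
      have m: "Q mod 5 = 1 \<or> Q mod 5 = 2 \<or> Q mod 5 = 3 \<or> Q mod 5 = 4"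
        using ndvd r5 by (auto simp: dvd_eq_mod_eq_0)
      then have "(Q mod 5) ^ 2 mod 5 = 1 \<or> (Q mod 5) ^ 2 mod 5 = 4"
        by auto
      then have Q2: "Q ^ 2 mod 5 = 1 \<or> Q ^ 2 mod 5 = 4"
        by (simp add: power_mod)
      show ?thesis
      proof (cases "Q ^ 2 mod 5 = 1")
        case True
        then show ?thesis using pw r5 by (simp add: cong_def)
      next
        case f: False
        \<comment> \<open>If the square were -1, then \<open>Q^d\<close> would be \<open>Q\<close>
          or \<open>- Q\<close>, so \<open>Q\<close> would be 1 or -1 and its square 1 after
          all.\<close>
        then have "[Q ^ 2 = -1] (mod 5)"
          using Q2 by (auto simp: cong_def)
        then have "[(Q ^ 2) ^ k * Q = (-1) ^ k * Q] (mod 5)"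
          by (intro cong_mult cong_pow cong_refl)
        then have "[(-1) ^ k * Q = 1] (mod 5)"
          using Qd r5 by (metis cong_sym cong_trans k power_add power_mult power_one_right of_nat_numeral)
        then have "[Q = 1] (mod 5) \<or> [Q = -1] (mod 5)"
          by (cases "even k") (auto dest: cong_minus_minus_iff[THEN iffD2])
        then have "Q mod 5 = 1 \<or> Q mod 5 = 4"
          by (auto simp: cong_def)
        then have "(Q mod 5) ^ 2 mod 5 = 1"
          by auto
        then have "Q ^ 2 mod 5 = 1"
          by (simp add: power_mod)
        with f show ?thesis by simp
      qed
    qed
  qed
  have P2r: "[P = 2] (mod int r)"
    using Pr Q1 by (metis cong_add_rcancel cong_trans one_add_one)
  \<comment> \<open>The only numbers from 2 to 6 that are 1 modulo 3 or modulo 5 are 4 and 6, and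
    \<open>Q\<close> is odd.\<close>
  have Q7: "7 \<le> Q"
  proof (rule ccontr)
    assume "\<not> 7 \<le> Q"
    then have "Q \<in> {2,3,4,5,6}"
      using prime_ge_2_nat[OF p(1)] unfolding Q_def by auto
    moreover have "Q mod int r = 1"
      using Q1 r by (auto simp: cong_def)
    ultimately show False
      using r oddQ by auto
  qed
  have D4: "- (4 * Q) \<le> D"
    unfolding D_def by simp
  have "[lucas P Q d = int d] (mod int r)"
    by (rule lucas_cong_index[OF P2r Q1])
  then have "r dvd d"
    using rU by (metis cong_dvd_iff int_dvd_int_iff)
  then obtain m where m: "d = m * r"
    by (metis dvd_def mult.commute)
  have U': "lucas P Q d dvd int r ^ v" using U Q_def by simp
  have odm: "odd m" using m oddd by simp
  show ?thesis
  proof (cases "r dvd m")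
    case False
    \<comment> \<open>Of the two factorizations of \<open>u(mr)\<close>, one contains
      \<open>u(m)\<close> and the other the term of index \<open>m\<close> for the
      \<open>r\<close>-th powers of the roots. Both are congruent to \<open>m\<close> modulo
      \<open>r\<close>, so both are units.\<close>
    have m1: "\<bar>lucas P Q m\<bar> = 1"
    proof (rule dvd_prime_power_not_dvd_imp_unit[OF pr(1)])
      show "lucas P Q m dvd int r ^ v"
        using U' unfolding m lucas_mult[of P Q m] by (rule dvd_mult_left)
      show "\<not> int r dvd lucas P Q m"
        using lucas_cong_index[OF P2r Q1, of m] False by (metis cong_dvd_iff int_dvd_int_iff)
    qed
    have *: "[lucas_companion P Q r = 2] (mod int r)" "[Q ^ r = 1] (mod int r)"
      using lucas_companion_cong[OF P2r Q1] cong_pow[OF Q1, of r] by auto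
    have m2: "\<bar>lucas (lucas_companion P Q r) (Q ^ r) m\<bar> = 1"
    proof (rule dvd_prime_power_not_dvd_imp_unit[OF pr(1)])
      show "lucas (lucas_companion P Q r) (Q ^ r) m dvd int r ^ v"
        using U' unfolding m mult.commute[of m r] lucas_mult[of P Q r] by (rule dvd_mult_right)
      show "\<not> int r dvd lucas (lucas_companion P Q r) (Q ^ r) m"
        using lucas_cong_index[OF *, of m] False by (metis cong_dvd_iff int_dvd_int_iff)
    qed
    have "\<bar>lucas P Q d\<bar> = \<bar>lucas_form r D (Q ^ m)\<bar>"
    proof -
      have "lucas P Q m ^ 2 = 1"
        using m1 by (metis power2_abs one_power2)
      then show ?thesis
        unfolding m lucas_mult_form[OF r] D_def abs_mult m1 by simp
    qed
    moreover have "\<bar>lucas P Q d\<bar> = \<bar>lucas_form r D Q\<bar>"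
      unfolding m mult.commute[of m r] lucas_mult[of P Q r] abs_mult m2 lucas_eq_form[OF r] D_def
      by simp
    moreover have "49 * Q \<le> Q ^ m" if "m \<noteq> 1"
    proof -
      have "3 \<le> m" using odm that by (cases m; cases "m - 1"; cases "m - 2") auto
      then have "Q ^ 3 \<le> Q ^ m"
        using Q7 by (intro power_increasing) auto
      moreover have "49 * Q \<le> Q ^ 2 * Q"
        using Q7 power_mono[of 7 Q 2] by (intro mult_right_mono) auto
      ultimately show ?thesis by (simp add: eval_nat_numeral)
    qed
    ultimately have "m = 1"
      using lucas_form_growth[OF r Q7 D4, of "Q ^ m"] by auto
    then show ?thesis using m by simp
  next
    case True
    then obtain k where k: "m = r * k" by blast
    define t where "t = lucas P Q r"
    have "d = r * r * k"
      using m k by simp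
    then have "lucas P Q (r * r) dvd lucas P Q d"
      using lucas_mult[of P Q "r * r" k] by (metis dvd_triv_left)
    \<comment> \<open>The term of index \<open>r^2\<close> divides that of index \<open>d\<close>;
      hence \<open>t\<close> and the cofactor of \<open>t\<close> in it are both signed powers of
      \<open>r\<close>.\<close>
    then have tt: "t * lucas_form r (D * t ^ 2) (Q ^ r) dvd int r ^ v"
      using U' unfolding lucas_mult_form[OF r] t_def D_def by (rule dvd_trans)
    have tv: "t dvd int r ^ v" and fv: "lucas_form r (D * t ^ 2) (Q ^ r) dvd int r ^ v"
      using tt by (auto dest: dvd_mult_left dvd_mult_right)
    have rD: "int r dvd D"
    proof -
      have "[D = 2 ^ 2 - 4 * 1] (mod int r)"
        unfolding D_def by (intro cong_diff cong_pow cong_mult cong_refl P2r Q1)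
      then show ?thesis by (simp add: cong_0_iff)
    qed
    have t: "t = lucas_form r D Q"
      unfolding t_def D_def lucas_eq_form[OF r] ..
    have rt: "int r dvd t"
      using rD r unfolding t lucas_form_def by auto
    obtain a where a: "D = int r * a" using rD by blast
    obtain b where b: "t = int r * b" using rt by blast
    obtain q where q: "Q = 1 + int r * q"
      using Q1 by (metis cong_iff_lin cong_sym)
    show ?thesis
    proof (cases "r = 3")
      case True
      have "[lucas_form r (D * t ^ 2) (Q ^ r) = int r] (mod int r ^ 2)"
      proof -
        have "lucas_form r (D * t ^ 2) (Q ^ r) - int r =
            int r ^ 2 * (3 * a * b ^ 2 + 3 * q * (1 + 3 * q + 3 * q ^ 2))"
          unfolding lucas_form_def a b q True
          by (simp add: eval_nat_numeral algebra_simps)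
        then show ?thesis
          by (simp add: cong_iff_dvd_diff)
      qed
      from dvd_prime_power_cong_imp_eq[OF pr fv this]
      have "D * t ^ 2 + 3 * Q ^ 3 = 3"
        using True by (simp add: lucas_form_def)
      moreover have "D = t - 3 * Q"
        using t True by (simp add: lucas_form_def)
      ultimately show ?thesis
        using no_solution_three[OF Q7 _ _, of t v] Q1 tv True by simp
    next
      case False
      then have r5: "r = 5" using r by simp
      \<comment> \<open>For 5 the form starts with \<open>D^2\<close>, so \<open>t\<close> is
        determined modulo 25. For 3 it starts with \<open>D\<close>, only known to be divisible by
        3, which is why \<open>t\<close> had to stay a variable there.\<close>
      have "[t = int r] (mod int r ^ 2)"
      proof -
        have "t - int r = int r ^ 2 * (a ^ 2 + a * Q + 2 * q + 5 * q ^ 2)"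
          unfolding t lucas_form_def a q r5
          by (simp add: eval_nat_numeral algebra_simps)
        then show ?thesis
          by (simp add: cong_iff_dvd_diff)
      qed
      from dvd_prime_power_cong_imp_eq[OF pr tv this] have t5: "t = 5"
        using r5 by simp
      have "[lucas_form r (D * t ^ 2) (Q ^ r) = int r] (mod int r ^ 2)"
      proof -
        have "[Q ^ 10 = 1 ^ 10] (mod 5)"
          using Q1 r5 by (intro cong_pow) simp
        then obtain c where c: "Q ^ 10 = 1 + 5 * c"
          by (metis cong_iff_lin cong_sym power_one)
        have "lucas_form r (D * t ^ 2) (Q ^ r) - int r =
            int r ^ 2 * (25 * D ^ 2 + 5 * D * Q ^ 5) + 5 * (Q ^ 10 - 1)"
          unfolding lucas_form_def t5 r5
          by (simp add: algebra_simps flip: power_mult)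
        also have "\<dots> = int r ^ 2 * (25 * D ^ 2 + 5 * D * Q ^ 5 + c)"
          unfolding c r5 by (simp add: algebra_simps)
        finally show ?thesis
          by (simp add: cong_iff_dvd_diff)
      qed
      from dvd_prime_power_cong_imp_eq[OF pr fv this]
      have "625 * D ^ 2 + 125 * D * Q ^ 5 + 5 * Q ^ 10 = 5"
        using r5 t5 by (simp add: lucas_form_def algebra_simps flip: power_mult)
      then show ?thesis
        using no_solution_five[OF Q7 D4] by simp
    qed
  qed
qed

section \<open>Fourier coefficients of Hecke eigenforms\<close>

text \<open>Dividing by \<open>x^n\<close> removes the coefficients already known to vanish, and the
  limit of the remaining series at 0 is \<open>d n\<close>. The point \<open>x = 0\<close> is left
  out because the parameter \<open>q\<close> never takes that value.\<close>

lemma power_series_zero_imp_coeff_zero: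
  fixes d :: "nat \<Rightarrow> complex"
  assumes "\<And>x. x \<noteq> 0 \<Longrightarrow> norm x < 1 \<Longrightarrow> (\<lambda>n. d n * x ^ n) sums 0"
  shows "d n = 0"
proof (induction n rule: less_induct)
  case (less n)
  have "(\<lambda>k. d (k + n) * x ^ k) sums 0" if x: "x \<noteq> 0" "norm x < 1" for x
  proof -
    have "(\<lambda>k. d (k + n) * x ^ (k + n)) sums (0 - (\<Sum>k<n. d k * x ^ k))"
      by (rule sums_split_initial_segment[OF assms[OF x]])
    then have "(\<lambda>k. d (k + n) * x ^ (k + n)) sums 0"
      using less by simp
    then have "(\<lambda>k. d (k + n) * x ^ (k + n) / x ^ n) sums (0 / x ^ n)"
      by (rule sums_divide)
    then show ?thesis
      using x(1) by (simp add: power_add)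
  qed
  then have "((\<lambda>_. 0) \<longlongrightarrow> d (0 + n)) (at (0 :: complex))"
    by (intro powser_limit_0_strong[of 1]) auto
  then show ?case
    using tendsto_unique[OF at_neq_bot _ tendsto_const] by fastforce
qed

section \<open>Expansions in q and Hecke operators\<close>

definition q_param :: "complex \<Rightarrow> complex" where
  "q_param z = exp (2 * of_real pi * \<i> * z)"

lemma q_param_add: "q_param (z + w) = q_param z * q_param w"
  by (simp add: q_param_def distrib_left exp_add)

lemma q_param_power: "q_param z ^ n = q_param (of_nat n * z)"
  by (simp add: q_param_def exp_of_nat_mult[symmetric] mult_ac)

lemma ex_q_param:
  assumes "x \<noteq> 0" "norm x < 1"
  shows "\<exists>z \<in> upper_half_plane. q_param z = x"
proof -
  define z where "z = Ln x / (2 * of_real pi * \<i>)"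
  have "z = - (\<i> * Ln x) / of_real (2 * pi)"
    by (simp add: z_def field_simps)
  then have "Im z = - ln (norm x) / (2 * pi)"
    using assms(1) by (simp only: Im_divide_of_real) simp
  moreover have "ln (norm x) < 0"
    using assms by simp
  ultimately have "z \<in> upper_half_plane"
    by (simp add: upper_half_plane_def divide_neg_pos)
  moreover have "q_param z = x"
    using assms(1) by (simp add: q_param_def z_def)
  ultimately show ?thesis by blast
qed

lemma q_expansion_unique:
  assumes "has_q_expansion f a" "has_q_expansion f b"
  shows "a n = b n"
proof -
  have "a n - b n = 0"
  proof (rule power_series_zero_imp_coeff_zero)
    fix x :: complex assume "x \<noteq> 0" "norm x < 1"
    then obtain z where z: "z \<in> upper_half_plane" "q_param z = x"
      using ex_q_param by blast
    then have "(\<lambda>n. a n * x ^ n) sums f z" "(\<lambda>n. b n * x ^ n) sums f z"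
      using assms unfolding has_q_expansion_def q_param_def[symmetric] by blast+
    from sums_diff[OF this] show "(\<lambda>n. (a n - b n) * x ^ n) sums 0"
      by (simp add: algebra_simps)
  qed
  then show ?thesis by simp
qed

lemma sum_roots_of_unity:
  assumes "0 < p"
  shows "(\<Sum>j<p. q_param (of_nat j / of_nat p) ^ n) = (if p dvd n then of_nat p else 0)"
proof -
  let ?\<zeta> = "q_param (1 / of_nat p)"
  have z: "q_param (of_nat j / of_nat p) ^ n = (?\<zeta> ^ n) ^ j" for j
    by (simp add: q_param_power mult.commute)
  have zn: "?\<zeta> ^ k = exp (2 * of_real pi * \<i> * of_nat k / of_nat p)" for k
    unfolding q_param_power by (simp add: q_param_def)
  have one: "?\<zeta> ^ n = 1 \<longleftrightarrow> p dvd n"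
    unfolding zn using complex_root_unity_eq_1[of p n] assms by simp
  have "?\<zeta> ^ (p * n) = 1"
    unfolding zn using assms complex_root_unity_eq_1[of p "p * n"] by simp
  then have "(?\<zeta> ^ n) ^ p = 1"
    by (simp add: mult.commute flip: power_mult)
  then show ?thesis
    using one unfolding z by (cases "p dvd n") (simp_all add: geometric_sum)
qed

text \<open>Averaging over the points \<open>(z + j) / p\<close> keeps exactly the exponents
  divisible by \<open>p\<close>, by the sum over roots of unity; the term \<open>f(pz)\<close> moves
  the coefficient of index \<open>n\<close> to index \<open>p n\<close>.\<close>

lemma hecke_q_expansion:
  assumes f: "has_q_expansion f a" and p: "0 < p"
  shows "has_q_expansion (hecke N p f)
    (\<lambda>n. a (p * n) + (if p dvd N \<or> \<not> p dvd n then 0 else of_nat p * a (n div p)))"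
  unfolding has_q_expansion_def q_param_def[symmetric]
proof
  fix z assume z: "z \<in> upper_half_plane"
  have f: "(\<lambda>n. a n * q_param z ^ n) sums f z" if "z \<in> upper_half_plane" for z
    using f that unfolding has_q_expansion_def q_param_def[symmetric] by blast
  have mono: "strict_mono (\<lambda>n. p * n)"
    using p by (intro strict_monoI) simp
  have rangeI: "n \<notin> range (\<lambda>n. p * n) \<longleftrightarrow> \<not> p dvd n" for n
    by (auto simp: dvd_def)
  let ?w = "q_param (z / of_nat p)"
  have wp: "?w ^ p = q_param z"
    using p by (simp add: q_param_power)
  have "(\<lambda>n. (\<Sum>j<p. a n * q_param ((z + of_nat j) / of_nat p) ^ n) / of_nat p)
      sums ((\<Sum>j<p. f ((z + of_nat j) / of_nat p)) / of_nat p)"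
  proof (intro sums_divide sums_sum f)
    fix j
    show "(z + of_nat j) / of_nat p \<in> upper_half_plane"
      using z p by (simp add: upper_half_plane_def Im_divide_of_nat)
  qed
  also have "(\<lambda>n. (\<Sum>j<p. a n * q_param ((z + of_nat j) / of_nat p) ^ n) / of_nat p)
      = (\<lambda>n. if p dvd n then a n * ?w ^ n else 0)"
  proof
    fix n
    have "(\<Sum>j<p. a n * q_param ((z + of_nat j) / of_nat p) ^ n)
        = a n * ?w ^ n * (\<Sum>j<p. q_param (of_nat j / of_nat p) ^ n)"
      by (simp add: add_divide_distrib q_param_add power_mult_distrib sum_distrib_left mult.assoc)
    then show "(\<Sum>j<p. a n * q_param ((z + of_nat j) / of_nat p) ^ n) / of_nat p
        = (if p dvd n then a n * ?w ^ n else 0)"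
      using p by (simp add: sum_roots_of_unity)
  qed
  \<comment> \<open>The series is reindexed along \<open>n \<mapsto> p * n\<close>; the terms
    outside the range of this map are zero.\<close>
  finally have "(\<lambda>n. if p dvd p * n then a (p * n) * ?w ^ (p * n) else 0)
      sums ((\<Sum>j<p. f ((z + of_nat j) / of_nat p)) / of_nat p)"
    by (subst sums_mono_reindex[OF mono, of "\<lambda>n. if p dvd n then a n * ?w ^ n else 0"])
      (auto simp: rangeI)
  then have 1: "(\<lambda>n. a (p * n) * q_param z ^ n)
      sums ((\<Sum>j<p. f ((z + of_nat j) / of_nat p)) / of_nat p)"
    by (simp add: power_mult wp)
  have "(\<lambda>n. a n * q_param (of_nat p * z) ^ n) sums f (of_nat p * z)"
    using z p by (intro f) (simp add: upper_half_plane_def)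
  then have "(\<lambda>n. if p dvd p * n then a (p * n div p) * q_param z ^ (p * n) else 0)
      sums f (of_nat p * z)"
    using p by (simp add: power_mult q_param_power[of z p])
  then have 2: "(\<lambda>n. if p dvd n then a (n div p) * q_param z ^ n else 0) sums f (of_nat p * z)"
    by (subst (asm) sums_mono_reindex[OF mono,
          of "\<lambda>n. if p dvd n then a (n div p) * q_param z ^ n else 0"]) (auto simp: rangeI)
  show "(\<lambda>n. (a (p * n) + (if p dvd N \<or> \<not> p dvd n then 0 else of_nat p * a (n div p)))
      * q_param z ^ n) sums hecke N p f z"
  proof (cases "p dvd N")
    case True
    then show ?thesis using 1 by (simp add: hecke_def)
  next
    case False
    have "(\<lambda>n. a (p * n) * q_param z ^ n
          + of_nat p * (if p dvd n then a (n div p) * q_param z ^ n else 0))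
        sums ((\<Sum>j<p. f ((z + of_nat j) / of_nat p)) / of_nat p + of_nat p * f (of_nat p * z))"
      by (intro sums_add 1 sums_mult 2)
    moreover have "a (p * n) * q_param z ^ n
          + of_nat p * (if p dvd n then a (n div p) * q_param z ^ n else 0)
        = (a (p * n) + (if p dvd N \<or> \<not> p dvd n then 0 else of_nat p * a (n div p)))
            * q_param z ^ n" for n
      using False by (simp add: distrib_right)
    ultimately show ?thesis
      using False by (simp add: hecke_def)
  qed
qed

text \<open>The coefficients of index \<open>p^(m+1)\<close> in the eigenvalue equation give the
  Lucas recurrence, since the eigenvalue is \<open>a(p)\<close>. The index is shifted by one:
  \<open>a(1)\<close> is the term of index 1.\<close>

theorem newform_coeff_prime_power:
  assumes "corresponding_newform E f a" "prime p" "\<not> p dvd conductor E"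
  shows "a (p ^ n) = lucas (a p) (int p) (Suc n)"
proof -
  let ?N = "conductor E"
  have q: "has_q_expansion f (\<lambda>n. of_int (a n))" and nf: "normalized_newform ?N f"
    using assms(1) by (simp_all add: corresponding_newform_def)
  have "a 1 = 1"
  proof -
    obtain c where "has_q_expansion f c" "c 1 = 1"
      using nf by (auto simp: normalized_newform_def)
    then have "complex_of_int (a 1) = 1"
      using q_expansion_unique[OF q, of c 1] by simp
    then show ?thesis by simp
  qed
  obtain c where c: "\<And>z. z \<in> upper_half_plane \<Longrightarrow> hecke ?N p f z = c * f z"
  proof -
    have "\<exists>c. \<forall>z \<in> upper_half_plane. hecke ?N p f z = c * f z"
      using nf assms(2) by (simp add: normalized_newform_def hecke_eigenform_def)
    then show ?thesis using that by blast
  qed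
  have p0: "0 < p" using assms(2) prime_gt_0_nat by blast
  have "has_q_expansion (hecke ?N p f) (\<lambda>n. c * of_int (a n))"
    unfolding has_q_expansion_def
  proof
    fix z assume z: "z \<in> upper_half_plane"
    then have "(\<lambda>n. c * (of_int (a n) * exp (2 * of_real pi * \<i> * z) ^ n)) sums (c * f z)"
      using q unfolding has_q_expansion_def by (intro sums_mult) blast
    then show "(\<lambda>n. c * of_int (a n) * exp (2 * of_real pi * \<i> * z) ^ n) sums hecke ?N p f z"
      using c[OF z] by (simp add: mult.assoc)
  qed
  from q_expansion_unique[OF hecke_q_expansion[OF q p0] this]
  have eigen: "of_int (a (p * n)) + (if \<not> p dvd n then 0 else of_nat p * of_int (a (n div p)))
      = c * of_int (a n)" for n
    using assms(3) by simp
  \<comment> \<open>This is the coefficient of index 1, where \<open>a(1) = 1\<close> and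
    \<open>p\<close> does not divide the index.\<close>
  have "c = of_int (a p)"
    using eigen[of 1] \<open>a 1 = 1\<close> assms(2) by (simp add: prime_nat_iff)
  then have rec: "a (p ^ Suc (Suc m)) = a p * a (p ^ Suc m) - int p * a (p ^ m)" for m
  proof -
    assume c: "c = of_int (a p)"
    have "complex_of_int (a (p ^ Suc (Suc m)) + int p * a (p ^ m)) = complex_of_int (a p * a (p ^ Suc m))"
      using eigen[of "p ^ Suc m"] p0 c by simp
    then have "a (p ^ Suc (Suc m)) + int p * a (p ^ m) = a p * a (p ^ Suc m)"
      unfolding of_int_eq_iff .
    then show ?thesis by simp
  qed
  show ?thesis
  proof (induction n rule: induct_nat_012)
    case (ge2 n)
    then show ?case unfolding rec by simp
  qed (use \<open>a 1 = 1\<close> in simp_all)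
qed

section \<open>Weierstrass models\<close>

subsection \<open>Changes of variables\<close>

text \<open>The equations of \<open>ec_isomorphic\<close> with the substitution as explicit
  parameters and over any commutative ring, so that they also serve for integral equations modulo a
  prime.\<close>

definition ec_change :: "'a::comm_ring_1 \<Rightarrow> 'a \<Rightarrow> 'a \<Rightarrow> 'a \<Rightarrow> 'a weierstrass \<Rightarrow> 'a weierstrass \<Rightarrow> bool" where
  "ec_change u r s t E E' \<longleftrightarrow>
     u * a\<^sub>1 E' = a\<^sub>1 E + 2 * s \<and>
     u^2 * a\<^sub>2 E' = a\<^sub>2 E - s * a\<^sub>1 E + 3 * r - s^2 \<and>
     u^3 * a\<^sub>3 E' = a\<^sub>3 E + r * a\<^sub>1 E + 2 * t \<and>
     u^4 * a\<^sub>4 E' = a\<^sub>4 E - s * a\<^sub>3 E + 2 * r * a\<^sub>2 E - (t + r * s) * a\<^sub>1 E + 3 * r^2 - 2 * s * t \<and>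
     u^6 * a\<^sub>6 E' = a\<^sub>6 E + r * a\<^sub>4 E + r^2 * a\<^sub>2 E + r^3 - t * a\<^sub>3 E - t^2 - r * t * a\<^sub>1 E"

lemma ec_isomorphic_iff_change:
  "ec_isomorphic E E' \<longleftrightarrow> (\<exists>u r s t. u \<noteq> 0 \<and> ec_change u r s t E E')"
  by (simp add: ec_isomorphic_def ec_change_def)

lemma b_relation: "4 * b\<^sub>8 E = b\<^sub>2 E * b\<^sub>6 E - (b\<^sub>4 E)^2"
  by (simp add: b\<^sub>2_def b\<^sub>4_def b\<^sub>6_def b\<^sub>8_def algebra_simps power2_eq_square)

lemma discriminant_change:
  fixes E E' :: "'a::comm_ring_1 weierstrass"
  assumes "ec_change u r s t E E'"
  shows "u^12 * discriminant E' = discriminant E"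
proof -
  have ch: "u * a\<^sub>1 E' = a\<^sub>1 E + 2 * s"
    "u^2 * a\<^sub>2 E' = a\<^sub>2 E - s * a\<^sub>1 E + 3 * r - s^2"
    "u^3 * a\<^sub>3 E' = a\<^sub>3 E + r * a\<^sub>1 E + 2 * t"
    "u^4 * a\<^sub>4 E' = a\<^sub>4 E - s * a\<^sub>3 E + 2 * r * a\<^sub>2 E - (t + r * s) * a\<^sub>1 E + 3 * r^2 - 2 * s * t"
    "u^6 * a\<^sub>6 E' = a\<^sub>6 E + r * a\<^sub>4 E + r^2 * a\<^sub>2 E + r^3 - t * a\<^sub>3 E - t^2 - r * t * a\<^sub>1 E"
    using assms by (simp_all add: ec_change_def)
  have b2: "u^2 * b\<^sub>2 E' = b\<^sub>2 E + 12 * r"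
  proof -
    have "u^2 * b\<^sub>2 E' = (u * a\<^sub>1 E')^2 + 4 * (u^2 * a\<^sub>2 E')"
      by (simp add: b\<^sub>2_def algebra_simps power2_eq_square)
    then show ?thesis
      unfolding ch by (simp add: b\<^sub>2_def algebra_simps power2_eq_square)
  qed
  have b4: "u^4 * b\<^sub>4 E' = b\<^sub>4 E + r * b\<^sub>2 E + 6 * r^2"
  proof -
    have "u^4 * b\<^sub>4 E' = 2 * (u^4 * a\<^sub>4 E') + (u * a\<^sub>1 E') * (u^3 * a\<^sub>3 E')"
      by (simp add: b\<^sub>4_def algebra_simps power_numeral_reduce)
    then show ?thesis
      unfolding ch by (simp add: b\<^sub>4_def b\<^sub>2_def algebra_simps power2_eq_square)
  qed
  have b6: "u^6 * b\<^sub>6 E' = b\<^sub>6 E + 2 * r * b\<^sub>4 E + r^2 * b\<^sub>2 E + 4 * r^3"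
  proof -
    have "u^6 * b\<^sub>6 E' = (u^3 * a\<^sub>3 E')^2 + 4 * (u^6 * a\<^sub>6 E')"
      by (simp add: b\<^sub>6_def algebra_simps power_numeral_reduce)
    then show ?thesis
      unfolding ch by (simp add: b\<^sub>6_def b\<^sub>4_def b\<^sub>2_def algebra_simps power_numeral_reduce)
  qed
  have b8: "u^8 * b\<^sub>8 E' = b\<^sub>8 E + 3 * r * b\<^sub>6 E + 3 * r^2 * b\<^sub>4 E + r^3 * b\<^sub>2 E + 3 * r^4"
  proof -
    have "u^8 * b\<^sub>8 E' = (u * a\<^sub>1 E')^2 * (u^6 * a\<^sub>6 E') + 4 * (u^2 * a\<^sub>2 E') * (u^6 * a\<^sub>6 E')
        - (u * a\<^sub>1 E') * (u^3 * a\<^sub>3 E') * (u^4 * a\<^sub>4 E') + (u^2 * a\<^sub>2 E') * (u^3 * a\<^sub>3 E')^2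
        - (u^4 * a\<^sub>4 E')^2"
      by (simp add: b\<^sub>8_def algebra_simps power_numeral_reduce)
    then show ?thesis
      unfolding ch by (simp add: b\<^sub>8_def b\<^sub>6_def b\<^sub>4_def b\<^sub>2_def algebra_simps power_numeral_reduce)
  qed
  have "u^12 * discriminant E' = - ((u^2 * b\<^sub>2 E')^2 * (u^8 * b\<^sub>8 E')) - 8 * (u^4 * b\<^sub>4 E')^3
      - 27 * (u^6 * b\<^sub>6 E')^2 + 9 * (u^2 * b\<^sub>2 E') * (u^4 * b\<^sub>4 E') * (u^6 * b\<^sub>6 E')"
    by (simp add: discriminant_def algebra_simps power_numeral_reduce)
  \<comment> \<open>The expansion returns the discriminant only up to a multiple of
    \<open>b_relation\<close>, which then cancels.\<close>
  also have "\<dots> = discriminant E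
      + (6 * r * b\<^sub>2 E + 36 * r^2) * (b\<^sub>2 E * b\<^sub>6 E - (b\<^sub>4 E)^2 - 4 * b\<^sub>8 E)"
    unfolding b2 b4 b6 b8 discriminant_def by (simp add: algebra_simps power_numeral_reduce)
  finally show ?thesis
    by (simp add: b_relation)
qed

lemma weierstrass_poly_change:
  fixes E E' :: "'a::comm_ring_1 weierstrass"
  assumes "ec_change u r s t E E'"
  shows "weierstrass_poly E (u^2 * x + r) (u^3 * y + u^2 * s * x + t) = u^6 * weierstrass_poly E' x y"
proof -
  have ch: "u * a\<^sub>1 E' = a\<^sub>1 E + 2 * s"
    "u^2 * a\<^sub>2 E' = a\<^sub>2 E - s * a\<^sub>1 E + 3 * r - s^2"
    "u^3 * a\<^sub>3 E' = a\<^sub>3 E + r * a\<^sub>1 E + 2 * t"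
    "u^4 * a\<^sub>4 E' = a\<^sub>4 E - s * a\<^sub>3 E + 2 * r * a\<^sub>2 E - (t + r * s) * a\<^sub>1 E + 3 * r^2 - 2 * s * t"
    "u^6 * a\<^sub>6 E' = a\<^sub>6 E + r * a\<^sub>4 E + r^2 * a\<^sub>2 E + r^3 - t * a\<^sub>3 E - t^2 - r * t * a\<^sub>1 E"
    using assms by (simp_all add: ec_change_def)
  have "u^6 * weierstrass_poly E' x y =
      (u^3 * y)^2 + (u * a\<^sub>1 E') * (u^2 * x) * (u^3 * y) + (u^3 * a\<^sub>3 E') * (u^3 * y)
      - ((u^2 * x)^3 + (u^2 * a\<^sub>2 E') * (u^2 * x)^2 + (u^4 * a\<^sub>4 E') * (u^2 * x) + u^6 * a\<^sub>6 E')"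
    by (simp add: weierstrass_poly_def algebra_simps power_numeral_reduce)
  also have "\<dots> = weierstrass_poly E (u^2 * x + r) (u^3 * y + u^2 * s * x + t)"
    unfolding ch weierstrass_poly_def
    by (simp add: algebra_simps power2_eq_square power3_eq_cube)
  finally show ?thesis ..
qed

lemma discriminant_of_int:
  "discriminant (map_weierstrass of_int W) = (of_int (discriminant W) :: 'a::comm_ring_1)"
  by (simp add: discriminant_def b\<^sub>2_def b\<^sub>4_def b\<^sub>6_def b\<^sub>8_def weierstrass.map_sel)

subsection \<open>The point map of a change of variables\<close>

text \<open>The map goes from points of \<open>E'\<close> to points of \<open>E\<close>, because the
  substitution expresses the old coordinates through the new ones.\<close>

fun change_point :: "'a::field \<Rightarrow> 'a \<Rightarrow> 'a \<Rightarrow> 'a \<Rightarrow> 'a ec_point \<Rightarrow> 'a ec_point" where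
  "change_point u r s t Infinity = Infinity"
| "change_point u r s t (Affine x y) = Affine (u^2 * x + r) (u^3 * y + u^2 * s * x + t)"

lemma change_point_mem_iff:
  assumes "ec_change u r s t E E'" "u \<noteq> 0"
  shows "change_point u r s t P \<in> ec_points E \<longleftrightarrow> P \<in> ec_points E'"
  using assms by (cases P) (simp_all add: ec_points_def weierstrass_poly_change)

lemma change_point_eq_iff:
  assumes "u \<noteq> 0"
  shows "change_point u r s t P = change_point u r s t Q \<longleftrightarrow> P = Q"
  using assms by (cases P; cases Q) auto

lemma change_point_surj:
  fixes u :: "'a::field"
  assumes "u \<noteq> 0"
  shows "\<exists>Q. change_point u r s t Q = P"
proof (cases P)
  case (Affine x y)
  define x' where "x' = (x - r) / u^2"
  define y' where "y' = (y - u^2 * s * x' - t) / u^3"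
  have "u^2 * x' + r = x" "u^3 * y' + u^2 * s * x' + t = y"
    using assms by (simp_all add: x'_def y'_def)
  then show ?thesis
    using Affine by (intro exI[of _ "Affine x' y'"]) simp
qed (auto intro: exI[of _ Infinity])

text \<open>The substitution is affine and preserves vertical lines, so lines go to lines: the slope
  \<open>l'\<close> becomes \<open>u * l' + s\<close>, and the formulas for the sum follow.\<close>

lemma change_point_add:
  fixes E E' :: "'a::field weierstrass"
  assumes ch: "ec_change u r s t E E'" and u: "u \<noteq> 0"
    and P: "P \<in> ec_points E'" and Q: "Q \<in> ec_points E'"
  shows "ec_add E (change_point u r s t P) (change_point u r s t Q)
    = change_point u r s t (ec_add E' P Q)"
proof (cases "P = Infinity \<or> Q = Infinity")
  case True
  then show ?thesis by (cases P; cases Q) auto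
next
  case False
  then obtain x1 y1 x2 y2 where PQ: "P = Affine x1 y1" "Q = Affine x2 y2"
    by (metis ec_point.exhaust)
  define X1 where "X1 = u^2 * x1 + r"
  define Y1 where "Y1 = u^3 * y1 + u^2 * s * x1 + t"
  define X2 where "X2 = u^2 * x2 + r"
  define Y2 where "Y2 = u^3 * y2 + u^2 * s * x2 + t"
  define A where "A = u * a\<^sub>1 E' - 2 * s"
  have A: "a\<^sub>1 E = A"
    using ch by (simp add: A_def ec_change_def)
  have a2: "a\<^sub>2 E = u^2 * a\<^sub>2 E' + s * A - 3 * r + s^2"
    using ch by (simp add: ec_change_def flip: A)
  have a3: "a\<^sub>3 E = u^3 * a\<^sub>3 E' - r * A - 2 * t"
    using ch by (simp add: ec_change_def flip: A)
  have a4: "a\<^sub>4 E = u^4 * a\<^sub>4 E' + s * a\<^sub>3 E - 2 * r * a\<^sub>2 E + (t + r * s) * A - 3 * r^2 + 2 * s * t"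
    using ch by (simp add: ec_change_def flip: A)
  have X: "X1 = X2 \<longleftrightarrow> x1 = x2"
    using u by (simp add: X1_def X2_def)
  have vert: "Y1 + Y2 + a\<^sub>1 E * X2 + a\<^sub>3 E = u^3 * (y1 + y2 + a\<^sub>1 E' * x2 + a\<^sub>3 E')"
    if "x1 = x2"
    unfolding X1_def X2_def Y1_def Y2_def A a3 A_def that
    by (simp add: algebra_simps power2_eq_square power3_eq_cube)
  show ?thesis
  proof (cases "x1 = x2 \<and> y1 + y2 + a\<^sub>1 E' * x2 + a\<^sub>3 E' = 0")
    case True
    then have "X1 = X2 \<and> Y1 + Y2 + a\<^sub>1 E * X2 + a\<^sub>3 E = 0"
      using vert X by auto
    then have "ec_add E (Affine X1 Y1) (Affine X2 Y2) = Infinity"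
      unfolding ec_add.simps by (rule if_P)
    moreover have "ec_add E' P Q = Infinity"
      using True unfolding PQ ec_add.simps by (rule if_P)
    ultimately show ?thesis
      by (simp add: PQ X1_def X2_def Y1_def Y2_def del: ec_add.simps(3))
  next
    case False
    define l' where "l' = (if x1 = x2
      then (3 * x1^2 + 2 * a\<^sub>2 E' * x1 + a\<^sub>4 E' - a\<^sub>1 E' * y1) / (2 * y1 + a\<^sub>1 E' * x1 + a\<^sub>3 E')
      else (y2 - y1) / (x2 - x1))"
    define l where "l = (if X1 = X2
      then (3 * X1^2 + 2 * a\<^sub>2 E * X1 + a\<^sub>4 E - a\<^sub>1 E * Y1) / (2 * Y1 + a\<^sub>1 E * X1 + a\<^sub>3 E)
      else (Y2 - Y1) / (X2 - X1))"
    have l: "l = u * l' + s"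
    proof (cases "x1 = x2")
      case True
      define n where "n = 3 * x1^2 + 2 * a\<^sub>2 E' * x1 + a\<^sub>4 E' - a\<^sub>1 E' * y1"
      define d where "d = 2 * y1 + a\<^sub>1 E' * x1 + a\<^sub>3 E'"
      \<comment> \<open>Points of the curve with the same abscissa are equal or opposite, and
        opposite ones are excluded here; this makes the denominator \<open>d\<close>
        nonzero.\<close>
      have "(y1 - y2) * (y1 + y2 + a\<^sub>1 E' * x2 + a\<^sub>3 E')
          = weierstrass_poly E' x2 y1 - weierstrass_poly E' x2 y2"
        by (simp add: weierstrass_poly_def algebra_simps power2_eq_square)
      also have "\<dots> = 0"
        using P Q True by (simp add: PQ ec_points_def)
      finally have "y1 = y2"
        using False True by auto
      then have d: "d \<noteq> 0"
        using False True by (simp add: d_def)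
      have "3 * X1^2 + 2 * a\<^sub>2 E * X1 + a\<^sub>4 E - a\<^sub>1 E * Y1 = u^4 * n + s * (u^3 * d)"
        unfolding X1_def Y1_def A a4 a2 a3 A_def n_def d_def
        by (simp add: algebra_simps power_numeral_reduce)
      moreover have "2 * Y1 + a\<^sub>1 E * X1 + a\<^sub>3 E = u^3 * d"
        unfolding X1_def Y1_def A a3 A_def d_def
        by (simp add: algebra_simps power_numeral_reduce)
      ultimately have "l = (u^4 * n + s * (u^3 * d)) / (u^3 * d)"
        using True X by (simp add: l_def)
      moreover have "n = l' * d"
      proof -
        have "l' = n / d"
          unfolding l'_def n_def d_def using True by (rule if_P)
        then show ?thesis using d by simp
      qed
      ultimately have "l = (u * l' + s) * (u^3 * d) / (u^3 * d)"
        by (simp add: algebra_simps power_numeral_reduce)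
      then show ?thesis
        using u d by simp
    next
      case False
      then have "x2 - x1 \<noteq> 0" by simp
      have "Y2 - Y1 = u^3 * (y2 - y1) + s * (u^2 * (x2 - x1))" "X2 - X1 = u^2 * (x2 - x1)"
        by (simp_all add: X1_def X2_def Y1_def Y2_def algebra_simps)
      then have "l = (u^3 * (y2 - y1) + s * (u^2 * (x2 - x1))) / (u^2 * (x2 - x1))"
        using False X by (simp add: l_def)
      also have "\<dots> = u * ((y2 - y1) / (x2 - x1)) + s"
        using u \<open>x2 - x1 \<noteq> 0\<close> by (simp add: add_divide_distrib power3_eq_cube power2_eq_square)
      finally show ?thesis
        using False by (simp add: l'_def)
    qed
    define x3 where "x3 = l'^2 + a\<^sub>1 E' * l' - a\<^sub>2 E' - x1 - x2"
    have X3: "l^2 + a\<^sub>1 E * l - a\<^sub>2 E - X1 - X2 = u^2 * x3 + r"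
      unfolding l A a2 A_def X1_def X2_def x3_def by (simp add: algebra_simps power2_eq_square)
    have Y3: "- (l + a\<^sub>1 E) * (u^2 * x3 + r) - (Y1 - l * X1) - a\<^sub>3 E
        = u^3 * (- (l' + a\<^sub>1 E') * x3 - (y1 - l' * x1) - a\<^sub>3 E') + u^2 * s * x3 + t"
      unfolding l A a3 A_def X1_def Y1_def by (simp add: algebra_simps power2_eq_square power3_eq_cube)
    have "ec_add E' P Q = Affine x3 (- (l' + a\<^sub>1 E') * x3 - (y1 - l' * x1) - a\<^sub>3 E')"
      using False unfolding PQ ec_add.simps l'_def[symmetric] x3_def[symmetric] Let_def by simp
    moreover have "ec_add E (Affine X1 Y1) (Affine X2 Y2)
        = Affine (u^2 * x3 + r) (- (l + a\<^sub>1 E) * (u^2 * x3 + r) - (Y1 - l * X1) - a\<^sub>3 E)"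
    proof -
      have "\<not> (X1 = X2 \<and> Y1 + Y2 + a\<^sub>1 E * X2 + a\<^sub>3 E = 0)"
        using False X vert u by auto
      then show ?thesis
        unfolding ec_add.simps l_def[symmetric] Let_def X3 by simp
    qed
    ultimately show ?thesis
      unfolding Y3 by (simp add: PQ X1_def X2_def Y1_def Y2_def)
  qed
qed

section \<open>Multiples and torsion points under a change of variables\<close>

lemma ec_group_pow: "P [^]\<^bsub>ec_group E\<^esub> (0::nat) = Infinity"
    "P [^]\<^bsub>ec_group E\<^esub> Suc n = ec_add E (P [^]\<^bsub>ec_group E\<^esub> n) P"
  by (simp_all add: ec_group_def nat_pow_def)

text \<open>Closure is kept as a property of its own because it is proved for short equations and
  carried to other models, while the group law is established for short equations only.\<close>

definition ec_add_closed :: "'a::field weierstrass \<Rightarrow> bool" where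
  "ec_add_closed E \<longleftrightarrow> (\<forall>P \<in> ec_points E. \<forall>Q \<in> ec_points E. ec_add E P Q \<in> ec_points E)"

lemma ec_pow_mem:
  "ec_add_closed E \<Longrightarrow> P \<in> ec_points E \<Longrightarrow> P [^]\<^bsub>ec_group E\<^esub> (n::nat) \<in> ec_points E"
proof (induction n)
  case 0
  then show ?case
    unfolding ec_group_pow by (simp add: ec_points_def)
next
  case (Suc n)
  then show ?case
    unfolding ec_group_pow ec_add_closed_def by blast
qed

lemma ec_add_closed_change:
  assumes "ec_change u r s t E E'" "u \<noteq> 0" "ec_add_closed E"
  shows "ec_add_closed E'"
  unfolding ec_add_closed_def
proof (intro ballI)
  fix P Q assume PQ: "P \<in> ec_points E'" "Q \<in> ec_points E'"
  then have "ec_add E (change_point u r s t P) (change_point u r s t Q) \<in> ec_points E"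
    using assms by (simp add: ec_add_closed_def change_point_mem_iff[OF assms(1,2)])
  then show "ec_add E' P Q \<in> ec_points E'"
    using change_point_add[OF assms(1,2) PQ] change_point_mem_iff[OF assms(1,2)] by simp
qed

lemma change_point_pow:
  assumes "ec_change u r s t E E'" "u \<noteq> 0" "ec_add_closed E'" "P \<in> ec_points E'"
  shows "change_point u r s t P [^]\<^bsub>ec_group E\<^esub> (n::nat)
    = change_point u r s t (P [^]\<^bsub>ec_group E'\<^esub> n)"
proof (induction n)
  case (Suc n)
  then show ?case
    unfolding ec_group_pow
    by (simp add: change_point_add[OF assms(1,2)] ec_pow_mem[OF assms(3)] assms(4))
qed (simp only: ec_group_pow change_point.simps)

lemma card_torsion_change:
  assumes ch: "ec_change u r s t E E'" and u: "u \<noteq> 0" and "ec_add_closed E'"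
  shows "card (ec_torsion E) = card (ec_torsion E')"
proof -
  let ?f = "change_point u r s t"
  have iff: "?f P \<in> ec_torsion E \<longleftrightarrow> P \<in> ec_torsion E'" for P
  proof (cases "P \<in> ec_points E'")
    case True
    have "?f P [^]\<^bsub>ec_group E\<^esub> (n::nat) = Infinity \<longleftrightarrow> P [^]\<^bsub>ec_group E'\<^esub> n = Infinity" for n
      unfolding change_point_pow[OF assms True]
      using change_point_eq_iff[OF u, of r s t _ Infinity] by simp
    then show ?thesis
      using True change_point_mem_iff[OF ch u, of P] by (simp add: ec_torsion_def ec_group_def)
  next
    case False
    then show ?thesis
      using change_point_mem_iff[OF ch u, of P] by (simp add: ec_torsion_def ec_group_def)
  qed
  have "ec_torsion E = ?f ` ec_torsion E'"
  proof (intro equalityI subsetI)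
    fix P assume "P \<in> ec_torsion E"
    moreover obtain Q where "?f Q = P" using change_point_surj[OF u] by blast
    ultimately show "P \<in> ?f ` ec_torsion E'" using iff by blast
  qed (use iff in blast)
  moreover have "inj_on ?f (ec_torsion E')"
    using change_point_eq_iff[OF u] by (intro inj_onI) blast
  ultimately show ?thesis
    by (simp add: card_image)
qed

subsection \<open>Minimal models and the conductor\<close>

lemma ex_integral_model: "\<exists>W. integral_model E W"
proof -
  define n d where "n = (\<lambda>x::rat. fst (quotient_of x))" and "d = (\<lambda>x::rat. snd (quotient_of x))"
  have nd: "d x > 0" "of_int (d x) * x = of_int (n x)" for x
  proof -
    show d: "d x > 0"
      unfolding d_def by (rule quotient_of_denom_pos')
    have "x = of_int (n x) / of_int (d x)"
      by (rule quotient_of_div) (simp add: n_def d_def)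
    then have "of_int (d x) * x = of_int (d x) * (of_int (n x) / of_int (d x))"
      by (rule arg_cong)
    then show "of_int (d x) * x = of_int (n x)"
      using d by simp
  qed
  \<comment> \<open>\<open>D\<close> is a common denominator of the coefficients; the substitution
    with \<open>u = 1 / D\<close> multiplies the coefficient of weight \<open>i\<close> by
    \<open>D^i\<close>.\<close>
  define D where "D = d (a\<^sub>1 E) * d (a\<^sub>2 E) * d (a\<^sub>3 E) * d (a\<^sub>4 E) * d (a\<^sub>6 E)"
  have D: "D > 0" using nd by (simp add: D_def)
  have int: "\<exists>m::int. of_int D ^ k * x = of_int m" if dvd: "d x dvd D" and k: "0 < k" for x k
  proof -
    obtain c where c: "D = d x * c" using dvd by (elim dvdE)
    have "of_int D * x = of_int (c * n x)"
      using nd(2)[of x] by (simp add: c mult.left_commute mult.commute)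
    then have "of_int D ^ k * x = of_int (D ^ (k - 1) * (c * n x))"
      using k by (cases k) (simp_all add: mult_ac)
    then show ?thesis by blast
  qed
  have "d (a\<^sub>1 E) dvd D" "d (a\<^sub>2 E) dvd D" "d (a\<^sub>3 E) dvd D" "d (a\<^sub>4 E) dvd D" "d (a\<^sub>6 E) dvd D"
    by (simp_all add: D_def)
  then obtain m\<^sub>1 m\<^sub>2 m\<^sub>3 m\<^sub>4 m\<^sub>6 :: int where m:
    "of_int D ^ 1 * a\<^sub>1 E = of_int m\<^sub>1" "of_int D ^ 2 * a\<^sub>2 E = of_int m\<^sub>2"
    "of_int D ^ 3 * a\<^sub>3 E = of_int m\<^sub>3" "of_int D ^ 4 * a\<^sub>4 E = of_int m\<^sub>4"
    "of_int D ^ 6 * a\<^sub>6 E = of_int m\<^sub>6"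
    using int[of "a\<^sub>1 E" 1] int[of "a\<^sub>2 E" 2] int[of "a\<^sub>3 E" 3] int[of "a\<^sub>4 E" 4] int[of "a\<^sub>6 E" 6]
    by auto
  have "ec_change (1 / of_int D) 0 0 0 E (map_weierstrass of_int (Weierstrass m\<^sub>1 m\<^sub>2 m\<^sub>3 m\<^sub>4 m\<^sub>6))"
    using D by (simp add: ec_change_def power_divide flip: m)
  then have "integral_model E (Weierstrass m\<^sub>1 m\<^sub>2 m\<^sub>3 m\<^sub>4 m\<^sub>6)"
    unfolding integral_model_def ec_isomorphic_iff_change using D
    by (intro exI[of _ "1 / of_int D"] exI conjI) simp_all
  then show ?thesis ..
qed

lemma minimal_model:
  shows integral_model_minimal_model: "integral_model E (minimal_model p E)"
    and minimal_model_le: "integral_model E W \<Longrightarrow>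
      multiplicity (int p) (discriminant (minimal_model p E)) \<le> multiplicity (int p) (discriminant W)"
proof -
  obtain W\<^sub>0 where "integral_model E W\<^sub>0" using ex_integral_model by blast
  from arg_min_nat_lemma[of "integral_model E", OF this, of "\<lambda>W. multiplicity (int p) (discriminant W)"]
  show "integral_model E (minimal_model p E)"
    "integral_model E W \<Longrightarrow>
      multiplicity (int p) (discriminant (minimal_model p E)) \<le> multiplicity (int p) (discriminant W)"
    unfolding minimal_model_def by simp_all
qed

lemma integral_model_discriminant_nonzero:
  assumes "elliptic_curve E" "integral_model E W"
  shows "discriminant W \<noteq> 0"
proof -
  obtain u r s t where "u \<noteq> 0" "ec_change u r s t E (map_weierstrass of_int W)"
    using assms(2) by (auto simp: integral_model_def ec_isomorphic_iff_change)
  then have "u ^ 12 * of_int (discriminant W) = discriminant E"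
    using discriminant_change discriminant_of_int by metis
  then show ?thesis
    using assms(1) by (auto simp: elliptic_curve_def)
qed

text \<open>A bad prime divides its minimal discriminant, hence the discriminant of any fixed
  integral model. Finiteness matters because a product over an infinite set is 1 by default, and the
  conductor would then say nothing about bad primes.\<close>

lemma finite_bad_primes:
  assumes "elliptic_curve E"
  shows "finite {p. prime p \<and> bad_reduction E p}"
proof -
  obtain W where W: "integral_model E W" using ex_integral_model by blast
  have "p dvd nat \<bar>discriminant W\<bar>" if p: "prime p" "bad_reduction E p" for p
  proof -
    have "multiplicity (int p) (discriminant (minimal_model p E)) \<noteq> 0"
      using p integral_model_discriminant_nonzero[OF assms integral_model_minimal_model[of E p]]
        prime_gt_1_nat[OF p(1)]
      by (subst multiplicity_eq_zero_iff) (simp_all add: bad_reduction_def)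
    then have "multiplicity (int p) (discriminant W) \<noteq> 0"
      using minimal_model_le[OF W, of p] by simp
    then have "int p dvd discriminant W"
      by (rule contrapos_np) (rule not_dvd_imp_multiplicity_0)
    then show ?thesis by simp
  qed
  then have "{p. prime p \<and> bad_reduction E p} \<subseteq> {p. p dvd nat \<bar>discriminant W\<bar>}"
    by blast
  moreover have "finite {p. p dvd nat \<bar>discriminant W\<bar>}"
    using integral_model_discriminant_nonzero[OF assms W] by (intro finite_divisors_nat) simp
  ultimately show ?thesis by (rule finite_subset)
qed

text \<open>The exponent of a bad prime in the conductor is 1 or at least 2, so the prime divides
  the conductor.\<close>

lemma good_reduction:
  assumes "elliptic_curve E" "prime p" "\<not> p dvd conductor E"
  shows "\<not> int p dvd discriminant (minimal_model p E)"
proof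
  assume "int p dvd discriminant (minimal_model p E)"
  then have bad: "bad_reduction E p" by (simp add: bad_reduction_def)
  then have "p dvd p ^ conductor_exponent E p"
    by (intro dvd_power) (simp add: conductor_exponent_def)
  also have "\<dots> dvd conductor E"
    unfolding conductor_def using finite_bad_primes[OF assms(1)] assms(2) bad
    by (intro dvd_prodI) auto
  finally show False using assms(3) by simp
qed

section \<open>The group law\<close>

locale short_curve =
  fixes A B C :: "'a::field_char_0"
  assumes nonsingular: "\<And>x. x^3 + A * x^2 + B * x + C = 0 \<Longrightarrow> 3 * x^2 + 2 * A * x + B \<noteq> 0"
begin

abbreviation curve :: "'a weierstrass" where
  "curve \<equiv> Weierstrass 0 A 0 B C"

abbreviation add :: "'a ec_point \<Rightarrow> 'a ec_point \<Rightarrow> 'a ec_point" (infixl "\<oplus>\<^sub>c" 65) where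
  "P \<oplus>\<^sub>c Q \<equiv> ec_add curve P Q"

fun neg :: "'a ec_point \<Rightarrow> 'a ec_point" where
  "neg Infinity = Infinity"
| "neg (Affine x y) = Affine x (- y)"

lemma affine_mem_iff:
  "Affine x y \<in> ec_points curve \<longleftrightarrow> y^2 = x^3 + A * x^2 + B * x + C"
  by (auto simp: ec_points_def weierstrass_poly_def)

lemma infinity_mem: "Infinity \<in> ec_points curve"
  by (simp add: ec_points_def)

lemma neg_mem: "P \<in> ec_points curve \<Longrightarrow> neg P \<in> ec_points curve"
  by (cases P) (simp_all add: infinity_mem affine_mem_iff)

lemma add_infinity [simp]: "P \<oplus>\<^sub>c Infinity = P"
  by (cases P) simp_all

text \<open>The line through two points, or the tangent: \<open>l\<close> is its slope, \<open>m\<close> its intercept, and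
  the last three equations are Vieta's formulas for its intersection with the curve.\<close>

lemma add_affine_line:
  assumes "Affine x y \<in> ec_points curve" "Affine x' y' \<in> ec_points curve"
    and "\<not> (x = x' \<and> y + y' = 0)"
  obtains l m x'' where
    "Affine x y \<oplus>\<^sub>c Affine x' y' = Affine x'' (- (l * x'' + m))"
    "y = l * x + m" "y' = l * x' + m"
    "x = x' \<Longrightarrow> y' = y \<and> y \<noteq> 0 \<and> 2 * y * l = 3 * x^2 + 2 * A * x + B"
    "x \<noteq> x' \<Longrightarrow> l = (y' - y) / (x' - x)"
    "x + x' + x'' = l^2 - A"
    "x * x' + x * x'' + x' * x'' = B - 2 * l * m"
    "x * x' * x'' = m^2 - C"
proof -
  have P: "y^2 = x^3 + A * x^2 + B * x + C" and Q: "y'^2 = x'^3 + A * x'^2 + B * x' + C"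
    using assms(1,2) by (simp_all add: affine_mem_iff)
  define l where "l = (if x = x' then (3 * x^2 + 2 * A * x + B) / (2 * y) else (y' - y) / (x' - x))"
  define m where "m = y - l * x"
  define x'' where "x'' = l^2 - A - x - x'"
  have y: "y = l * x + m" by (simp add: m_def)
  have eq: "y' = y \<and> y \<noteq> 0" if "x = x'"
  proof -
    have "(y' - y) * (y' + y) = 0"
      using P Q that by (simp add: algebra_simps power2_eq_square)
    moreover have "y' + y \<noteq> 0"
      using assms(3) that by (simp add: add.commute)
    ultimately show ?thesis by auto
  qed
  have tangent: "2 * y * l = 3 * x^2 + 2 * A * x + B" if "x = x'"
    using eq[OF that] that by (simp add: l_def)
  have chord: "l = (y' - y) / (x' - x)" if "x \<noteq> x'"
    using that by (simp add: l_def)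
  have y': "y' = l * x' + m"
  proof (cases "x = x'")
    case False
    then have "l * (x' - x) = y' - y" by (simp add: chord)
    then show ?thesis by (simp add: m_def algebra_simps)
  qed (use eq y in simp)
  \<comment> \<open>This is the divided difference at \<open>x\<close> and \<open>x'\<close> of the
    cubic minus the square of the line; for \<open>x = x'\<close> it is the derivative, which
    vanishes by tangency.\<close>
  have 1: "x^2 + x * x' + x'^2 + (A - l^2) * (x + x') + (B - 2 * l * m) = 0"
  proof (cases "x = x'")
    case True
    have "x^2 + x * x' + x'^2 + (A - l^2) * (x + x') + (B - 2 * l * m)
        = 3 * x^2 + 2 * A * x + B - 2 * l * (l * x + m)"
      unfolding True[symmetric] by (simp add: algebra_simps power2_eq_square)
    also have "\<dots> = 0"
      using tangent[OF True] y by (simp add: algebra_simps)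
    finally show ?thesis .
  next
    case False
    have "(x - x') * (x^2 + x * x' + x'^2 + (A - l^2) * (x + x') + (B - 2 * l * m))
        = (x^3 + A * x^2 + B * x + C - (l * x + m)^2)
          - (x'^3 + A * x'^2 + B * x' + C - (l * x' + m)^2)"
      by (simp add: algebra_simps power2_eq_square power3_eq_cube)
    also have "\<dots> = 0"
      using P Q y y' by simp
    finally show ?thesis using False by simp
  qed
  have e2: "x * x' + x * x'' + x' * x'' = B - 2 * l * m"
  proof -
    have "x * x' + x * x'' + x' * x'' - (B - 2 * l * m)
      = - (x^2 + x * x' + x'^2 + (A - l^2) * (x + x') + (B - 2 * l * m))"
      unfolding x''_def by (simp add: algebra_simps power2_eq_square)
    then show ?thesis using 1 by simp
  qed
  have e3: "x * x' * x'' = m^2 - C"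
  proof -
    have "x * x' * x'' - (m^2 - C) = (x^3 + A * x^2 + B * x + C - (l * x + m)^2)
       + x * (x * x' + x * x'' + x' * x'' - (B - 2 * l * m)) 
       - x^2 * (x + x' + x'' - (l^2 - A))"
      by (simp add: algebra_simps power2_eq_square power3_eq_cube)
    also have "\<dots> = 0"
      using P y e2 by (simp add: x''_def)
    finally show ?thesis by simp
  qed
  have "Affine x y \<oplus>\<^sub>c Affine x' y' = Affine x'' (- (l * x'' + m))"
  proof (cases "x = x'")
    case True
    then show ?thesis
      using assms(3) by (simp add: l_def m_def x''_def Let_def)
  next
    case False
    then show ?thesis
      by (simp add: l_def m_def x''_def Let_def)
  qed
  moreover have "x + x' + x'' = l^2 - A"
    by (simp add: x''_def)
  ultimately show ?thesis
    by (intro that[OF _ y y' _ chord _ e2 e3]) (use eq tangent in auto)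
qed

text \<open>The hypotheses are Vieta's formulas. The ring is arbitrary because the identity is used
  for elements of the field as well as for Laurent series.\<close>

lemma cubic_minus_line:
  fixes X :: "'b::comm_ring_1"
  assumes "x + x' + x'' = l^2 - a" "x * x' + x * x'' + x' * x'' = b - 2 * l * m"
    "x * x' * x'' = m^2 - c"
  shows "X^3 + a * X^2 + b * X + c - (l * X + m)^2 = (X - x) * (X - x') * (X - x'')"
proof -
  have a: "a = l^2 - (x + x' + x'')" and b: "b = x * x' + x * x'' + x' * x'' + 2 * l * m"
    and c: "c = m^2 - x * x' * x''"
    using assms by (simp_all add: algebra_simps)
  show ?thesis
    unfolding a b c by (simp add: algebra_simps power2_eq_square power3_eq_cube)
qed

lemma add_mem:
  assumes "P \<in> ec_points curve" "Q \<in> ec_points curve"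
  shows "P \<oplus>\<^sub>c Q \<in> ec_points curve"
proof (cases P)
  case P: (Affine x y)
  show ?thesis
  proof (cases Q)
    case Q: (Affine x' y')
    show ?thesis
    proof (cases "x = x' \<and> y + y' = 0")
      case True
      then show ?thesis using P Q by (simp add: infinity_mem)
    next
      case False
      obtain l m x'' where *: "P \<oplus>\<^sub>c Q = Affine x'' (- (l * x'' + m))"
        "x + x' + x'' = l^2 - A" "x * x' + x * x'' + x' * x'' = B - 2 * l * m"
        "x * x' * x'' = m^2 - C"
        using add_affine_line[of x y x' y'] assms P Q False by metis
      have "x''^3 + A * x''^2 + B * x'' + C = (l * x'' + m)^2"
        using cubic_minus_line[OF *(2-4), of x''] by simp
      then show ?thesis
        unfolding *(1) affine_mem_iff by (simp only: power2_minus)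
    qed
  qed (use assms in simp)
qed (use assms in simp)

subsection \<open>The coordinate ring inside the field of Laurent series\<close>

abbreviation const :: "'a \<Rightarrow> 'a fls" where
  "const \<equiv> fls_const"

text \<open>Functions are expanded at the point at infinity with a square root of
  \<open>1 / x\<close> as local parameter, so \<open>fls_subdegree\<close> is minus the order of the
  pole there.\<close>

definition X :: "'a fls" where
  "X = fls_X_inv ^ 2"

definition cubic :: "'a fls" where
  "cubic = X^3 + const A * X^2 + const B * X + const C"

lemma X_subdegree: "fls_subdegree X = -2"
  by (simp add: X_def)

lemma X_nonzero: "X \<noteq> 0"
  by (simp add: X_def)

text \<open>The cubic is \<open>X^3\<close> times a power series with constant term 1, and such a
  series has a square root in characteristic 0.\<close>

lemma ex_sqrt_cubic: "\<exists>Y. Y^2 = cubic"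
proof -
  define w :: "'a fps" where
    "w = 1 + fps_const A * fps_X^2 + fps_const B * fps_X^4 + fps_const C * fps_X^6"
  have w0: "w $ 0 = 1" by (simp add: w_def)
  have "fps_radical (\<lambda>_ _. 1) (Suc 1) w ^ Suc 1 = w"
    using power_radical[of w "\<lambda>_ _. 1" 1] w0 by simp
  then obtain s where s: "s ^ 2 = w" by (auto simp: numeral_2_eq_2)
  define Y where "Y = fls_X_inv ^ 3 * fps_to_fls s"
  have i: "fls_X_inv * fls_X = (1 :: 'a fls)" by (simp add: fls_X_inv_conv_shift_1 fls_shifted_times_simps)
  have p: "fls_X_inv ^ (k + n) * fls_X ^ n = (fls_X_inv ^ k :: 'a fls)" for k n
    by (simp add: power_add mult.assoc i flip: power_mult_distrib)
  have "fps_to_fls w = 1 + const A * fls_X^2 + const B * fls_X^4 + const C * fls_X^6"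
    unfolding w_def by (simp add: fls_times_fps_to_fls fps_to_fls_power)
  then have "Y^2 = fls_X_inv ^ 6 * (1 + const A * fls_X^2 + const B * fls_X^4 + const C * fls_X^6)"
    using s unfolding Y_def by (simp add: power_mult_distrib flip: power_mult fps_to_fls_power)
  also have "\<dots> = fls_X_inv ^ (6 + 0) * fls_X ^ 0 + const A * (fls_X_inv ^ (4 + 2) * fls_X ^ 2)
      + const B * (fls_X_inv ^ (2 + 4) * fls_X ^ 4) + const C * (fls_X_inv ^ (0 + 6) * fls_X ^ 6)"
    by (simp add: algebra_simps)
  also have "\<dots> = cubic"
    unfolding p cubic_def X_def by (simp flip: power_mult)
  finally show ?thesis ..
qed

definition Y :: "'a fls" where
  "Y = (SOME Y. Y^2 = cubic)"

lemma Y_square: "Y^2 = cubic"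
  unfolding Y_def by (rule someI_ex[OF ex_sqrt_cubic])

text \<open>Polynomials in \<open>X\<close> in Horner form: each step with a nonzero tail lowers the
  subdegree by exactly 2, so orders of poles follow by induction.\<close>

inductive_set poly_ring :: "'a fls set" where
  poly_const: "const c \<in> poly_ring"
| poly_step: "f \<in> poly_ring \<Longrightarrow> const c + X * f \<in> poly_ring"

lemma poly_ring_add:
  assumes "f \<in> poly_ring" "g \<in> poly_ring"
  shows "f + g \<in> poly_ring"
  using assms
proof (induction arbitrary: g)
  case (poly_const c)
  then show ?case
  proof cases
    case (poly_const d)
    then show ?thesis
      using poly_ring.poly_const[of "c + d"] by (simp add: fls_plus_const)
  next
    case (poly_step g d)
    then show ?thesis
      using poly_ring.poly_step[of g "c + d"] by (simp add: fls_plus_const add.assoc flip: fls_plus_const)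
  qed
next
  case (poly_step f c)
  from poly_step.prems show ?case
  proof cases
    case (poly_const d)
    then show ?thesis
      using poly_ring.poly_step[OF poly_step.hyps, of "c + d"]
      by (simp add: add_ac flip: fls_plus_const)
  next
    case (poly_step h d)
    then show ?thesis
      using poly_ring.poly_step[OF poly_step.IH, of h "c + d"]
      by (simp add: algebra_simps flip: fls_plus_const)
  qed
qed

lemma poly_ring_X_mult: "f \<in> poly_ring \<Longrightarrow> X * f \<in> poly_ring"
  using poly_step[of f 0] by simp

lemma poly_ring_const_mult: "f \<in> poly_ring \<Longrightarrow> const c * f \<in> poly_ring"
proof (induction rule: poly_ring.induct)
  case (poly_const d)
  then show ?case
    using poly_ring.poly_const[of "c * d"] by (simp add: fls_const_mult_const)
next
  case (poly_step f d)
  then show ?case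
    using poly_ring.poly_step[OF poly_step.IH, of "c * d"]
    by (simp add: fls_const_mult_const algebra_simps)
qed

lemma poly_ring_mult:
  assumes "f \<in> poly_ring" "g \<in> poly_ring"
  shows "f * g \<in> poly_ring"
  using assms
proof (induction)
  case (poly_step f c)
  then have "const c * g + X * (f * g) \<in> poly_ring"
    by (intro poly_ring_add poly_ring_const_mult poly_ring_X_mult)
  then show ?case by (simp add: algebra_simps)
qed (rule poly_ring_const_mult)

lemma poly_ring_X: "X \<in> poly_ring"
  using poly_step[OF poly_const, of 0 1] by simp

lemma poly_ring_cubic: "cubic \<in> poly_ring"
  unfolding cubic_def power3_eq_cube power2_eq_square
  by (intro poly_ring_add poly_ring_mult poly_const poly_ring_X)

lemma subdegree_step:
  assumes "f \<noteq> 0" "fls_subdegree f \<le> 0"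
  shows "fls_subdegree (const c + X * f) = fls_subdegree f - 2"
proof -
  have s: "fls_subdegree (X * f) = fls_subdegree f - 2"
    using assms(1) by (simp add: X_subdegree X_nonzero)
  show ?thesis
  proof (cases "c = 0")
    case False
    then have "fls_subdegree (const c + X * f) = fls_subdegree (X * f)"
      using s assms X_nonzero by (intro fls_subdegree_add_eq2) auto
    then show ?thesis using s by simp
  qed (simp add: s)
qed

lemma poly_ring_subdegree:
  assumes "f \<in> poly_ring"
  shows "even (fls_subdegree f)" "fls_subdegree f \<le> 0"
proof -
  have "even (fls_subdegree f) \<and> fls_subdegree f \<le> 0"
    using assms
  proof induction
    case (poly_step f c)
    then show ?case
      by (cases "f = 0") (simp_all add: subdegree_step)
  qed simp
  then show "even (fls_subdegree f)" "fls_subdegree f \<le> 0" by auto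
qed

lemma poly_ring_constant:
  assumes "f \<in> poly_ring" "fls_subdegree f = 0"
  shows "\<exists>c. f = const c"
  using assms
proof cases
  case (poly_step g c)
  then have "g = 0"
    using subdegree_step[of g c] poly_ring_subdegree(2)[of g] assms(2) by fastforce
  then show ?thesis using poly_step by auto
qed auto

lemma poly_ring_linear:
  assumes "f \<in> poly_ring" "-2 \<le> fls_subdegree f"
  shows "\<exists>a b. f = const a + const b * X"
  using assms
proof cases
  case (poly_const c)
  then show ?thesis by (intro exI[of _ c] exI[of _ 0]) simp
next
  case (poly_step g c)
  have "fls_subdegree g = 0"
  proof (cases "g = 0")
    case False
    then show ?thesis
      using subdegree_step[of g c] poly_ring_subdegree(2)[of g] assms(2) poly_step by simp
  qed simp
  then obtain d where "g = const d"
    using poly_ring_constant poly_step by blast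
  then show ?thesis
    using poly_step by (intro exI[of _ c] exI[of _ d]) (simp add: mult.commute)
qed

lemma Y_subdegree: "fls_subdegree Y = -3"
proof -
  have "cubic = const C + X * (const B + X * (const A + X * 1))"
    by (simp add: cubic_def algebra_simps power2_eq_square power3_eq_cube)
  moreover have 1: "fls_subdegree (const A + X * 1) = -2"
    by (subst subdegree_step) simp_all
  moreover from 1 have "const A + X * 1 \<noteq> 0" by auto
  with 1 have 2: "fls_subdegree (const B + X * (const A + X * 1)) = -4"
    by (subst subdegree_step) simp_all
  moreover from 2 have "const B + X * (const A + X * 1) \<noteq> 0" by auto
  with 2 have "fls_subdegree (const C + X * (const B + X * (const A + X * 1))) = -6"
    by (subst subdegree_step) simp_all
  ultimately have "fls_subdegree (Y^2) = -6"
    by (simp only: Y_square)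
  then show ?thesis by (simp add: fls_subdegree_pow)
qed

lemma Y_nonzero: "Y \<noteq> 0"
  using Y_subdegree by auto

definition coord_ring :: "'a fls set" where
  "coord_ring = {f + g * Y |f g. f \<in> poly_ring \<and> g \<in> poly_ring}"

lemma coord_ringI: "f \<in> poly_ring \<Longrightarrow> g \<in> poly_ring \<Longrightarrow> f + g * Y \<in> coord_ring"
  unfolding coord_ring_def by blast

lemma const_coord_ring: "const c \<in> coord_ring"
  using coord_ringI[OF poly_const poly_const, of c 0] by simp

lemma zero_coord_ring: "0 \<in> coord_ring" and one_coord_ring: "1 \<in> coord_ring"
  using const_coord_ring[of 0] const_coord_ring[of 1] by simp_all

lemma X_coord_ring: "X \<in> coord_ring"
  using coord_ringI[OF poly_ring_X poly_const, of 0] by simp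

lemma Y_coord_ring: "Y \<in> coord_ring"
  using coord_ringI[OF poly_const poly_const, of 0 1] by simp

lemma coord_ring_add:
  assumes "r \<in> coord_ring" "s \<in> coord_ring"
  shows "r + s \<in> coord_ring"
proof -
  obtain f g f' g' where "r = f + g * Y" "s = f' + g' * Y"
    "f \<in> poly_ring" "g \<in> poly_ring" "f' \<in> poly_ring" "g' \<in> poly_ring"
    using assms unfolding coord_ring_def by blast
  then show ?thesis
    using coord_ringI[OF poly_ring_add poly_ring_add, of f f' g g'] by (simp add: algebra_simps)
qed

lemma coord_ring_mult:
  assumes "r \<in> coord_ring" "s \<in> coord_ring"
  shows "r * s \<in> coord_ring"
proof -
  obtain f g f' g' where *: "r = f + g * Y" "s = f' + g' * Y"
    "f \<in> poly_ring" "g \<in> poly_ring" "f' \<in> poly_ring" "g' \<in> poly_ring"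
    using assms unfolding coord_ring_def by blast
  have "r * s = (f * f' + g * g' * cubic) + (f * g' + f' * g) * Y"
    unfolding * Y_square[symmetric] by (simp add: algebra_simps power2_eq_square)
  then show ?thesis
    using coord_ringI * by (simp add: poly_ring_add poly_ring_mult poly_ring_cubic)
qed

lemma coord_ring_minus: "r \<in> coord_ring \<Longrightarrow> - r \<in> coord_ring"
  using coord_ring_mult[OF const_coord_ring, of r "-1"] by simp

lemma coord_ring_diff: "r \<in> coord_ring \<Longrightarrow> s \<in> coord_ring \<Longrightarrow> r - s \<in> coord_ring"
  using coord_ring_add[OF _ coord_ring_minus, of r s] by simp

text \<open>\<open>f\<close> has a pole of even order and \<open>g * Y\<close> one of odd order, so
  they cannot cancel. A pole of order at most 2 leaves no room for \<open>g\<close>, since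
  \<open>Y\<close> alone has order 3.\<close>

lemma coord_ring_linear:
  assumes "r \<in> coord_ring" "-2 \<le> fls_subdegree r"
  shows "\<exists>a b. r = const a + const b * X"
proof -
  obtain f g where *: "r = f + g * Y" "f \<in> poly_ring" "g \<in> poly_ring"
    using assms unfolding coord_ring_def by blast
  have "g = 0"
  proof (rule ccontr)
    assume g: "g \<noteq> 0"
    have s: "fls_subdegree (g * Y) = fls_subdegree g - 3"
      using g by (simp add: Y_subdegree Y_nonzero)
    have gY: "fls_subdegree (g * Y) \<le> -3" "odd (fls_subdegree (g * Y))"
      using s poly_ring_subdegree[OF *(3)] by simp_all
    show False
    proof (cases "f = 0")
      case True
      then show ?thesis using * gY assms(2) by simp
    next
      case False
      have ne: "fls_subdegree f \<noteq> fls_subdegree (g * Y)"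
        using gY(2) poly_ring_subdegree(1)[OF *(2)] by metis
      have "fls_subdegree r \<le> fls_subdegree (g * Y)"
      proof (cases "fls_subdegree f < fls_subdegree (g * Y)")
        case True
        then show ?thesis
          using fls_subdegree_add_eq1[OF False, of "g * Y"] * by simp
      next
        case f: False
        then have "fls_subdegree r = fls_subdegree (g * Y)"
          unfolding *(1) using ne g Y_nonzero by (intro fls_subdegree_add_eq2) auto
        then show ?thesis by simp
      qed
      then show ?thesis using gY assms(2) by simp
    qed
  qed
  then show ?thesis
    using poly_ring_linear[OF *(2)] * assms(2) by simp
qed

lemma subdegree_X_minus: "fls_subdegree (X - const x) = -2"
  using subdegree_step[of 1 "- x"] by (simp add: algebra_simps)

lemma X_minus_nonzero: "X - const x \<noteq> 0"
  using subdegree_X_minus[of x] by auto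

text \<open>This expresses that the curve has positive genus: no function has a simple pole at
  infinity as its only pole. The uniqueness of the point in an ideal class rests on it.\<close>

lemma coord_ring_subdegree_ne:
  assumes "r \<in> coord_ring"
  shows "fls_subdegree r \<noteq> -1"
proof
  assume r: "fls_subdegree r = -1"
  then obtain a b where ab: "r = const a + const b * X"
    using coord_ring_linear[OF assms] by auto
  show False
  proof (cases "b = 0")
    case False
    then show ?thesis
      using subdegree_step[of "const b" a] r ab by (simp add: mult.commute)
  qed (use r ab in simp)
qed

lemma subdegree_line: "fls_subdegree (Y - const l * X - const m) = -3"
proof -
  have lin: "- 2 \<le> fls_subdegree (const (- m) + X * const (- l))"
  proof (cases "l = 0")
    case False
    then have "fls_subdegree (const (- m) + X * const (- l)) = - 2"
      by (subst subdegree_step) simp_all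
    then show ?thesis by simp
  qed simp
  have "fls_subdegree (Y + (const (- m) + X * const (- l))) = fls_subdegree Y"
    by (rule fls_subdegree_add_eq1) (use lin Y_subdegree Y_nonzero in simp_all)
  moreover have "Y + (const (- m) + X * const (- l)) = Y - const l * X - const m"
    by (simp add: algebra_simps)
  ultimately show ?thesis
    using Y_subdegree by argo
qed

lemma line_nonzero: "Y - const l * X - const m \<noteq> 0"
  using subdegree_line[of l m] by auto

lemma subdegree_Y_minus: "fls_subdegree (Y - const y) = -3"
  using subdegree_line[of 0 y] by simp

subsection \<open>Ideals attached to points\<close>

text \<open>\<open>S\<close> may contain arbitrary Laurent series, so these are fractional ideals;
  multipliers such as a line divided by a vertical line require this.\<close>

inductive_set gen :: "'a fls set \<Rightarrow> 'a fls set" for S where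
  gen_zero: "0 \<in> gen S"
| gen_step: "r \<in> coord_ring \<Longrightarrow> s \<in> S \<Longrightarrow> x \<in> gen S \<Longrightarrow> r * s + x \<in> gen S"

lemma gen_scale_base: "r \<in> coord_ring \<Longrightarrow> s \<in> S \<Longrightarrow> r * s \<in> gen S"
  using gen_step[OF _ _ gen_zero] by fastforce

lemma gen_base: "s \<in> S \<Longrightarrow> s \<in> gen S"
  using gen_scale_base[OF one_coord_ring] by simp

lemma gen_add: "x \<in> gen S \<Longrightarrow> y \<in> gen S \<Longrightarrow> x + y \<in> gen S"
  by (induction rule: gen.induct) (auto simp: add.assoc intro: gen_step)

lemma gen_mult: "x \<in> gen S \<Longrightarrow> r \<in> coord_ring \<Longrightarrow> r * x \<in> gen S"
proof (induction rule: gen.induct)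
  case (gen_step r' s x)
  then show ?case
    using gen.gen_step[OF coord_ring_mult[of r r']] by (simp add: distrib_left mult.assoc)
qed (simp add: gen_zero)

lemma gen_diff: "x \<in> gen S \<Longrightarrow> y \<in> gen S \<Longrightarrow> x - y \<in> gen S"
  using gen_add[of x S "- y"] gen_mult[of y S "-1"] coord_ring_minus[OF one_coord_ring] by simp

lemma gen_const_mult_cancel:
  assumes "const c * x \<in> gen S" "c \<noteq> 0"
  shows "x \<in> gen S"
proof -
  have "const (inverse c) * (const c * x) \<in> gen S"
    by (rule gen_mult[OF assms(1) const_coord_ring])
  then show ?thesis
    using assms(2) by (simp flip: mult.assoc)
qed

lemma gen_subset: "S \<subseteq> gen T \<Longrightarrow> gen S \<subseteq> gen T"
proof
  fix x assume S: "S \<subseteq> gen T" and "x \<in> gen S"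
  from this(2) show "x \<in> gen T"
    by induction (use S in \<open>auto intro: gen_zero gen_add gen_mult\<close>)
qed

lemma gen_eqI: "S \<subseteq> gen T \<Longrightarrow> T \<subseteq> gen S \<Longrightarrow> gen S = gen T"
  by (simp add: gen_subset subset_antisym)

lemma gen_times_subset:
  assumes "S \<subseteq> gen T"
  shows "S * U \<subseteq> gen (T * U)"
proof
  fix z assume "z \<in> S * U"
  then obtain s u where z: "z = s * u" "s \<in> S" "u \<in> U"
    by (auto simp: set_times_def)
  then have "s \<in> gen T" using assms by blast
  then show "z \<in> gen (T * U)"
    unfolding z(1)
  proof induction
    case (gen_step r t x)
    then show ?case
      using gen.gen_step[of r "t * u" "T * U" "x * u"] z(3)
      by (auto simp: distrib_right mult.assoc)
  qed (simp add: gen_zero)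
qed

lemma gen_times_cong:
  assumes "gen S = gen T"
  shows "gen (S * U) = gen (T * U)"
  using assms gen_base by (intro gen_eqI gen_times_subset) auto

lemma gen_subset_coord_ring:
  assumes "S \<subseteq> coord_ring"
  shows "gen S \<subseteq> coord_ring"
proof
  fix x assume "x \<in> gen S"
  then show "x \<in> coord_ring"
    by induction (use assms in \<open>auto intro: zero_coord_ring coord_ring_add coord_ring_mult\<close>)
qed

lemma gen_scaled: "x \<in> gen ({k} * S) \<Longrightarrow> \<exists>y \<in> gen S. x = k * y"
proof (induction rule: gen.induct)
  case (gen_step r s x)
  then obtain t y where "s = k * t" "t \<in> S" "x = k * y" "y \<in> gen S"
    by (auto simp: set_times_def)
  from gen.gen_step[OF gen_step.hyps(1) this(2,4)] this(1,3)
  have "r * t + y \<in> gen S" "r * s + x = k * (r * t + y)"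
    by (simp_all only: distrib_left mult.left_commute)
  then show ?case by blast
qed (use gen_zero in auto)

fun point_ideal :: "'a ec_point \<Rightarrow> 'a fls set" where
  "point_ideal Infinity = {1}"
| "point_ideal (Affine x y) = {X - const x, Y - const y}"

text \<open>The degree of the ideal of the point. The degree of \<open>{k} * point_ideal P\<close>
  is \<open>weight P - fls_subdegree k\<close>; it is recorded beside the ideal.\<close>

definition weight :: "'a ec_point \<Rightarrow> int" where
  "weight P = (if P = Infinity then 0 else 1)"

lemma point_ideal_coord_ring: "point_ideal P \<subseteq> coord_ring"
  by (cases P) (auto intro: one_coord_ring coord_ring_diff X_coord_ring Y_coord_ring const_coord_ring)

lemma pair_times:
  "{a, b} * {c, d} = {a * c, a * d, b * c, b * d :: 'b :: comm_semiring_0}"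
  by (auto simp: set_times_def)

lemma cubic_minus_value:
  "cubic - const (x^3 + A * x^2 + B * x + C) =
    (X - const x) * ((X + const (2 * x + A)) * (X - const x) + const (3 * x^2 + 2 * A * x + B))"
  unfolding cubic_def
  by (simp add: algebra_simps power2_eq_square power3_eq_cube flip: fls_plus_const fls_const_mult_const)

text \<open>The two mixed products of generators differ by \<open>2 y (X - x)\<close>, which settles
  \<open>y \<noteq> 0\<close>. For \<open>y = 0\<close> the product of the other two generators is
  \<open>X - x\<close> times a difference quotient of the cubic, whose value at \<open>x\<close> is
  the derivative, nonzero by nonsingularity.\<close>

lemma gen_point_neg:
  assumes P: "Affine x y \<in> ec_points curve"
  shows "gen (point_ideal (Affine x y) * point_ideal (Affine x (- y))) = gen {X - const x}"
proof (rule gen_eqI)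
  let ?v = "X - const x"
  let ?q = "(X + const (2 * x + A)) * ?v + const (3 * x^2 + 2 * A * x + B)"
  let ?S = "point_ideal (Affine x y) * point_ideal (Affine x (- y))"
  have S: "?S = {?v * ?v, ?v * (Y + const y), (Y - const y) * ?v, (Y - const y) * (Y + const y)}"
    by (simp add: pair_times)
  have h: "y^2 = x^3 + A * x^2 + B * x + C"
    using P by (simp add: affine_mem_iff)
  have yy: "(Y - const y) * (Y + const y) = ?v * ?q"
    unfolding cubic_minus_value[symmetric] h[symmetric] Y_square[symmetric]
    by (simp add: algebra_simps power2_eq_square)
  have v: "?v \<in> coord_ring"
    by (intro coord_ring_diff X_coord_ring const_coord_ring)
  have mem: "?v \<in> coord_ring" "Y + const y \<in> coord_ring" "Y - const y \<in> coord_ring"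
    "?q \<in> coord_ring" "X + const (2 * x + A) \<in> coord_ring"
    by (intro coord_ring_diff coord_ring_add coord_ring_mult X_coord_ring Y_coord_ring const_coord_ring)+
  show "?S \<subseteq> gen {?v}"
  proof -
    have "?v * r \<in> gen {?v}" "r * ?v \<in> gen {?v}" if "r \<in> coord_ring" for r
      using gen_scale_base[OF that singletonI[of ?v]] by (simp_all add: mult.commute)
    then show ?thesis
      unfolding S yy using mem by blast
  qed
  have "?v \<in> gen ?S"
  proof (cases "y = 0")
    case False
    have "?v * (Y + const y) - (Y - const y) * ?v \<in> gen ?S"
      unfolding S by (intro gen_diff gen_base) auto
    moreover have "?v * (Y + const y) - (Y - const y) * ?v = const (2 * y) * ?v"
      by (simp add: algebra_simps flip: fls_const_mult_const)
    ultimately show ?thesis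
      using gen_const_mult_cancel[of "2 * y" ?v ?S] False by simp
  next
    case True
    have "(Y - const y) * (Y + const y) - (X + const (2 * x + A)) * (?v * ?v) \<in> gen ?S"
      unfolding S by (intro gen_diff gen_mult gen_base mem) auto
    moreover have "(Y - const y) * (Y + const y) - (X + const (2 * x + A)) * (?v * ?v)
        = const (3 * x^2 + 2 * A * x + B) * ?v"
      unfolding yy by (simp only: algebra_simps)
    moreover have "3 * x^2 + 2 * A * x + B \<noteq> 0"
      using nonsingular[of x] h True by simp
    ultimately show ?thesis
      using gen_const_mult_cancel[of _ ?v ?S] by simp
  qed
  then show "{?v} \<subseteq> gen ?S" by simp
qed

text \<open>The multiplier is the line through the points divided by the vertical line through the
  third intersection: it vanishes at \<open>P\<close> and \<open>Q\<close> and has poles at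
  \<open>P + Q\<close> and at infinity. For opposite points it is \<open>X - x\<close>.\<close>

lemma gen_point_add:
  assumes "P \<in> ec_points curve" "Q \<in> ec_points curve"
  shows "\<exists>k. k \<noteq> 0 \<and> gen (point_ideal P * point_ideal Q) = gen ({k} * point_ideal (P \<oplus>\<^sub>c Q))
    \<and> fls_subdegree k = weight (P \<oplus>\<^sub>c Q) - weight P - weight Q"
proof (cases "P = Infinity \<or> Q = Infinity")
  case True
  have one: "{1 :: 'a fls} * S = S" "S * {1} = S" for S
    by (auto simp: set_times_def)
  show ?thesis
    using True by (intro exI[of _ 1]) (auto simp: one weight_def)
next
  case False
  then obtain x y x' y' where PQ: "P = Affine x y" "Q = Affine x' y'"
    by (metis ec_point.exhaust)
  show ?thesis
  proof (cases "x = x' \<and> y + y' = 0")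
    case True
    then have "y' = - y" by (simp add: add_eq_0_iff2)
    with True show ?thesis
      using gen_point_neg[of x y] assms X_minus_nonzero[of x] subdegree_X_minus[of x] PQ
      by (intro exI[of _ "X - const x"]) (simp add: weight_def set_times_def)
  next
    case False
    obtain l m x'' where sum: "P \<oplus>\<^sub>c Q = Affine x'' (- (l * x'' + m))"
      and y: "y = l * x + m" and y': "y' = l * x' + m"
      and tan: "x = x' \<Longrightarrow> y' = y \<and> y \<noteq> 0"
      and e1: "x + x' + x'' = l^2 - A"
      and e2: "x * x' + x * x'' + x' * x'' = B - 2 * l * m"
      and e3: "x * x' * x'' = m^2 - C"
      using add_affine_line[of x y x' y'] assms False unfolding PQ by metis
    define L where "L = Y - const l * X - const m"
    define L' where "L' = Y + const l * X + const m"
    define v where "v = X - const x"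
    define v' where "v' = X - const x'"
    define v'' where "v'' = X - const x''"
    have LL': "L * L' = v * v' * v''"
    proof -
      have "L * L' = cubic - (const l * X + const m)^2"
        unfolding L_def L'_def Y_square[symmetric] by (simp add: algebra_simps power2_eq_square)
      also have "\<dots> = v * v' * v''"
        unfolding cubic_def v_def v'_def v''_def
        using e1[THEN arg_cong[of _ _ const]] e2[THEN arg_cong[of _ _ const]]
          e3[THEN arg_cong[of _ _ const]]
        by (intro cubic_minus_line)
          (simp_all flip: fls_plus_const fls_minus_const fls_const_mult_const add: fls_const_power)
      finally show ?thesis .
    qed
    have Yy: "Y - const y = L + const l * v" and Yy': "Y - const y' = L + const l * v'"
      by (simp_all add: L_def v_def v'_def y y' algebra_simps flip: fls_plus_const fls_const_mult_const)
    have Y'': "Y - const (- (l * x'' + m)) = L' - const l * v''"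
      by (simp add: L'_def v''_def algebra_simps
          flip: fls_plus_const fls_minus_const fls_const_mult_const)
    define S where "S = point_ideal P * point_ideal Q"
    have S: "S = {v * v', v * (Y - const y'), (Y - const y) * v', (Y - const y) * (Y - const y')}"
      unfolding S_def PQ v_def v'_def by (simp add: pair_times)
    have mem: "v \<in> coord_ring" "v' \<in> coord_ring" "v'' \<in> coord_ring" "L \<in> coord_ring"
      unfolding v_def v'_def v''_def L_def
      by (intro coord_ring_diff coord_ring_mult X_coord_ring Y_coord_ring const_coord_ring)+
    \<comment> \<open>Every product of generators is a combination of \<open>L\<close> and
      \<open>v * v'\<close>. The nontrivial part is that \<open>L\<close> itself lies in the
      ideal.\<close>
    have 1: "gen S = gen {L, v * v'}"
    proof (rule gen_eqI)
      have "v * (Y - const y') = v * L + const l * (v * v')"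
        "(Y - const y) * v' = v' * L + const l * (v * v')"
        "(Y - const y) * (Y - const y') =
          (L + const l * v + const l * v') * L + (const l * const l) * (v * v')"
        unfolding Yy Yy' by (simp_all add: algebra_simps)
      moreover have "r * L + s * (v * v') \<in> gen {L, v * v'}" "v * v' \<in> gen {L, v * v'}"
        if "r \<in> coord_ring" "s \<in> coord_ring" for r s
        using that by (auto intro: gen_add gen_scale_base gen_base)
      moreover have "L + const l * v + const l * v' \<in> coord_ring" "const l * const l \<in> coord_ring"
        by (intro coord_ring_add coord_ring_mult const_coord_ring mem)+
      ultimately show "S \<subseteq> gen {L, v * v'}"
        unfolding S using mem const_coord_ring[of l] by (auto simp del: fls_const_mult_const)
      have vv: "v * v' \<in> gen S" unfolding S by (intro gen_base) simp
      have "v * (Y - const y') - const l * (v * v') \<in> gen S"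
        by (intro gen_diff gen_mult[OF vv] const_coord_ring) (simp add: S gen_base)
      then have vL: "v * L \<in> gen S"
        unfolding Yy' by (simp add: algebra_simps)
      have "(Y - const y) * v' - const l * (v * v') \<in> gen S"
        by (intro gen_diff gen_mult[OF vv] const_coord_ring) (simp add: S gen_base)
      then have v'L: "v' * L \<in> gen S"
        unfolding Yy by (simp add: algebra_simps)
      have "L \<in> gen S"
      proof (cases "x = x'")
        case False
        have "v' * L - v * L \<in> gen S"
          by (intro gen_diff vL v'L)
        moreover have "v' * L - v * L = const (x - x') * L"
          unfolding v_def v'_def by (simp add: algebra_simps flip: fls_minus_const)
        ultimately show ?thesis
          using gen_const_mult_cancel[of "x - x'" L S] False by simp
      next
        case True
        then have "v' = v" by (simp add: v_def v'_def)
        have "(Y - const y) * (Y - const y') - const l * (v * L) - const l * (v' * L)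
            - (const l * const l) * (v * v') \<in> gen S"
          by (intro gen_diff gen_mult[OF vL] gen_mult[OF v'L] gen_mult[OF vv] coord_ring_mult
              const_coord_ring) (simp add: S gen_base)
        then have L2: "L * L \<in> gen S"
          unfolding Yy Yy' by (simp add: algebra_simps)
        \<comment> \<open>Tangent case: \<open>L * L' = v * v' * v''\<close> with
          \<open>L' = L + 2 l v + 2 y\<close>, so \<open>2 y L\<close> is a combination of elements
          already found in the ideal.\<close>
        have "v'' * (v * v') - 2 * (const l * (v * L)) - L * L \<in> gen S"
          unfolding mult_2
          by (intro gen_diff gen_add gen_mult[OF vL] gen_mult[OF vv] const_coord_ring mem L2)
        moreover have "v'' * (v * v') - 2 * (const l * (v * L)) - L * L = const (2 * y) * L"
        proof -
          have "L' = L + 2 * const l * v + const (2 * y)"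
            unfolding L'_def L_def v_def y
            by (simp add: algebra_simps flip: fls_plus_const fls_const_mult_const)
          then show ?thesis
            using LL' by (simp add: algebra_simps)
        qed
        ultimately show ?thesis
          using gen_const_mult_cancel[of "2 * y" L S] tan[OF True] by simp
      qed
      with vv show "{L, v * v'} \<subseteq> gen S" by simp
    qed
    define k where "k = L / v''"
    have v''0: "v'' \<noteq> 0" and L0: "L \<noteq> 0"
      unfolding v''_def L_def by (rule X_minus_nonzero line_nonzero)+
    have "k * v'' = L" "k * L' = v * v'"
      using v''0 LL' by (simp_all add: k_def divide_simps)
    then have "k * (L' - const l * v'') = v * v' - const l * L"
      by (simp add: right_diff_distrib mult.left_commute)
    moreover have "{k} * {v'', L' - const l * v''} = {k * v'', k * (L' - const l * v'')}"
      by (auto simp: set_times_def)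
    ultimately have K: "{k} * point_ideal (P \<oplus>\<^sub>c Q) = {L, v * v' - const l * L}"
      using \<open>k * v'' = L\<close> unfolding sum point_ideal.simps Y'' v''_def[symmetric] by simp
    have 2: "gen {L, v * v' - const l * L} = gen {L, v * v'}"
    proof (rule gen_eqI)
      have "v * v' - const l * L \<in> gen {L, v * v'}"
        by (intro gen_diff gen_mult gen_base const_coord_ring) auto
      then show "{L, v * v' - const l * L} \<subseteq> gen {L, v * v'}"
        by (auto intro: gen_base)
      have "(v * v' - const l * L) + const l * L \<in> gen {L, v * v' - const l * L}"
        by (intro gen_add gen_mult gen_base const_coord_ring) auto
      then show "{L, v * v'} \<subseteq> gen {L, v * v' - const l * L}"
        by (auto intro: gen_base)
    qed
    have "fls_subdegree k = -1"
    proof -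
      have "fls_subdegree (k * v'') = fls_subdegree k + fls_subdegree v''"
        using v''0 L0 by (intro fls_subdegree_mult) (auto simp: k_def)
      then show ?thesis
        using \<open>k * v'' = L\<close> subdegree_line[of l m] subdegree_X_minus[of x'']
        by (simp add: L_def v''_def)
    qed
    moreover have "k \<noteq> 0"
      using L0 v''0 by (simp add: k_def)
    moreover have "gen (point_ideal P * point_ideal Q) = gen ({k} * point_ideal (P \<oplus>\<^sub>c Q))"
      unfolding K 2 using 1 by (simp only: S_def)
    moreover have "weight (P \<oplus>\<^sub>c Q) - weight P - weight Q = -1"
    proof -
      have "P \<oplus>\<^sub>c Q \<noteq> Infinity"
        unfolding sum by (rule ec_point.distinct)
      moreover have "P \<noteq> Infinity" "Q \<noteq> Infinity"
        unfolding PQ by (rule ec_point.distinct)+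
      ultimately show ?thesis
        by (simp only: weight_def if_False)
    qed
    ultimately show ?thesis by metis
  qed
qed

text \<open>The quotient would have a simple pole at infinity, as \<open>Y - y\<close> has a pole of
  order 3 and \<open>X - x\<close> one of order 2.\<close>

lemma not_divisible: 
  assumes "r \<in> coord_ring"
  shows "r * (X - const x) \<noteq> Y - const y"
proof
  assume *: "r * (X - const x) = Y - const y"
  have "r \<noteq> 0"
    using * subdegree_Y_minus[of y] by auto
  then have "fls_subdegree r = -1"
    using arg_cong[OF *, of fls_subdegree] subdegree_Y_minus[of y] subdegree_X_minus[of x]
      X_minus_nonzero[of x] by simp
  then show False
    using coord_ring_subdegree_ne[OF assms] by simp
qed

text \<open>The ideal of a point is proper: otherwise \<open>gen_point_neg\<close> would put the
  ideal of the opposite point into the multiples of \<open>X - x\<close>, so that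
  \<open>X - x\<close> would divide \<open>Y + y\<close>.\<close>

lemma const_mem_point_ideal:
  assumes P: "Affine x y \<in> ec_points curve" and c: "const c \<in> gen (point_ideal (Affine x y))"
  shows "c = 0"
proof (rule ccontr)
  assume "c \<noteq> 0"
  then have "1 \<in> gen (point_ideal (Affine x y))"
    using gen_const_mult_cancel[of c 1] c by simp
  then have "{1} * point_ideal (Affine x (- y))
      \<subseteq> gen (point_ideal (Affine x y) * point_ideal (Affine x (- y)))"
    by (intro gen_times_subset) simp
  then have "Y - const (- y) \<in> gen {X - const x}"
    unfolding gen_point_neg[OF P] by (auto simp: set_times_def)
  then have "Y - const (- y) \<in> gen ({X - const x} * {1})"
    by (simp add: set_times_def)
  then obtain r where "r \<in> gen {1}" "Y - const (- y) = (X - const x) * r"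
    using gen_scaled by blast
  then show False
    using not_divisible[of r x "- y"] gen_subset_coord_ring[of "{1}"] one_coord_ring
    by (auto simp: mult.commute)
qed

lemma point_ideal_inject_aux:
  assumes "k \<noteq> 0" "k' \<noteq> 0" "gen {k} = gen ({k'} * point_ideal (Affine x y))"
    "fls_subdegree k = fls_subdegree k' - 1"
  shows False
proof -
  have "k \<in> gen ({k'} * point_ideal (Affine x y))"
    using assms(3) gen_base by blast
  then obtain r where r: "r \<in> gen (point_ideal (Affine x y))" "k = k' * r"
    using gen_scaled by blast
  then have "r \<in> coord_ring"
    using gen_subset_coord_ring point_ideal_coord_ring by blast
  moreover have "fls_subdegree r = -1"
    using assms r(2) by auto
  ultimately show False
    using coord_ring_subdegree_ne by blast
qed

text \<open>For affine points, multiplication by \<open>k / k'\<close> sends \<open>X - x\<close> to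
  an element with a pole of order 2 in the ideal of \<open>Q\<close>, hence to a multiple
  \<open>b (X - x')\<close>. Applied to \<open>Y - y\<close> this gives
  \<open>b (Y - y) (X - x') = s (X - x)\<close>, and distinct abscissas would make
  \<open>Y - y\<close> divisible by \<open>X - x\<close>.\<close>

lemma point_ideal_inject:
  assumes P: "P \<in> ec_points curve" and Q: "Q \<in> ec_points curve"
    and k: "k \<noteq> 0" "k' \<noteq> 0"
    and eq: "gen ({k} * point_ideal P) = gen ({k'} * point_ideal Q)"
    and deg: "fls_subdegree k - weight P = fls_subdegree k' - weight Q"
  shows "P = Q"
proof (cases P; cases Q)
  fix x y assume PQ: "P = Infinity" "Q = Affine x y"
  show ?thesis
    using point_ideal_inject_aux[OF k, of x y] eq deg PQ by (simp add: set_times_def weight_def)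
next
  fix x y assume PQ: "P = Affine x y" "Q = Infinity"
  show ?thesis
    using point_ideal_inject_aux[OF k(2,1), of x y] eq deg PQ by (simp add: set_times_def weight_def)
next
  fix x y x' y' assume PQ: "P = Affine x y" "Q = Affine x' y'"
  have deg': "fls_subdegree k = fls_subdegree k'"
    using deg PQ by (simp add: weight_def)
  let ?M = "gen (point_ideal (Affine x' y'))"
  have *: "\<exists>r \<in> ?M. k * a = k' * r" if "a \<in> point_ideal P" for a
  proof -
    have "k * a \<in> gen ({k} * point_ideal P)"
      using that by (intro gen_base) auto
    then show ?thesis
      using gen_scaled eq PQ by metis
  qed
  have M: "r \<in> coord_ring" if "r \<in> ?M" for r
    using that gen_subset_coord_ring[OF point_ideal_coord_ring] by blast
  obtain r where r: "r \<in> ?M" "k * (X - const x) = k' * r"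
    using *[of "X - const x"] PQ by auto
  have r0: "r \<noteq> 0"
    using r(2) k X_minus_nonzero[of x] by auto
  have rdeg: "fls_subdegree r = -2"
    using arg_cong[OF r(2), of fls_subdegree] k r0 X_minus_nonzero[of x] subdegree_X_minus[of x] deg'
    by simp
  then obtain a b where ab: "r = const a + const b * X"
    using coord_ring_linear[OF M[OF r(1)]] by auto
  have "r - const b * (X - const x') \<in> ?M"
    by (intro gen_diff gen_mult r(1) const_coord_ring gen_base) simp
  moreover have "r - const b * (X - const x') = const (a + b * x')"
    unfolding ab by (simp add: algebra_simps flip: fls_plus_const fls_const_mult_const)
  ultimately have "a + b * x' = 0"
    using const_mem_point_ideal[of x' y'] Q PQ by simp
  with \<open>r - const b * (X - const x') = const (a + b * x')\<close>
  have rb: "r = const b * (X - const x')" by simp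
  then have b: "b \<noteq> 0" using r0 by auto
  obtain s where s: "s \<in> ?M" "k * (Y - const y) = k' * s"
    using *[of "Y - const y"] PQ by auto
  have "k' * (const b * (Y - const y) * (X - const x')) = k * (X - const x) * (Y - const y)"
    using r(2) rb by (simp add: mult_ac)
  also have "\<dots> = k' * (s * (X - const x))"
    using s(2) by (simp add: mult_ac)
  finally have c: "const b * (Y - const y) * (X - const x') = s * (X - const x)"
    using k by simp
  have x: "x = x'"
  proof (rule ccontr)
    assume ne: "x \<noteq> x'"
    define c' where "c' = b * (x - x')"
    have c': "const (inverse c') * const c' = 1"
      using b ne by (simp add: c'_def del: inverse_mult_distrib)
    have "const c' * (Y - const y) = (s - const b * (Y - const y)) * (X - const x)"
      using c by (simp add: c'_def algebra_simps flip: fls_minus_const fls_const_mult_const)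
    then have "const (inverse c') * (const c' * (Y - const y)) =
        const (inverse c') * ((s - const b * (Y - const y)) * (X - const x))"
      by (rule arg_cong)
    then have "Y - const y = const (inverse c') * (s - const b * (Y - const y)) * (X - const x)"
      using c' by (metis mult.assoc mult_1)
    moreover have "const (inverse c') * (s - const b * (Y - const y)) \<in> coord_ring"
      by (intro coord_ring_mult coord_ring_diff const_coord_ring Y_coord_ring M s)
    ultimately show False
      using not_divisible by metis
  qed
  then have "s = const b * (Y - const y)"
    using c X_minus_nonzero[of x] by simp
  then have "Y - const y \<in> ?M"
    using gen_const_mult_cancel s(1) b by blast
  moreover have "Y - const y' \<in> ?M"
    by (rule gen_base) simp
  ultimately have "(Y - const y) - (Y - const y') \<in> ?M"
    by (rule gen_diff)
  then have "const (y' - y) \<in> ?M"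
    by (simp flip: fls_minus_const)
  then have "y' - y = 0"
    using const_mem_point_ideal[of x' y'] Q PQ by blast
  then show ?thesis using x PQ by simp
qed simp

subsection \<open>The group\<close>

text \<open>Multiplication of ideals is commutative, and a point is determined by its ideal up to a
  multiplier of the right degree.\<close>

lemma add_commute:
  assumes "P \<in> ec_points curve" "Q \<in> ec_points curve"
  shows "P \<oplus>\<^sub>c Q = Q \<oplus>\<^sub>c P"
proof -
  obtain k where k: "k \<noteq> 0" "gen (point_ideal P * point_ideal Q) = gen ({k} * point_ideal (P \<oplus>\<^sub>c Q))"
    "fls_subdegree k = weight (P \<oplus>\<^sub>c Q) - weight P - weight Q"
    using gen_point_add[OF assms] by blast
  obtain k' where k': "k' \<noteq> 0"
    "gen (point_ideal Q * point_ideal P) = gen ({k'} * point_ideal (Q \<oplus>\<^sub>c P))"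
    "fls_subdegree k' = weight (Q \<oplus>\<^sub>c P) - weight Q - weight P"
    using gen_point_add[OF assms(2,1)] by blast
  show ?thesis
    by (rule point_ideal_inject[OF _ _ k(1) k'(1)])
      (use k k' assms in \<open>auto simp: add_mem mult.commute\<close>)
qed

lemma gen_point_add3:
  assumes "P \<in> ec_points curve" "Q \<in> ec_points curve" "R \<in> ec_points curve"
  shows "\<exists>k. k \<noteq> 0 \<and>
    gen (point_ideal P * point_ideal Q * point_ideal R) = gen ({k} * point_ideal (P \<oplus>\<^sub>c Q \<oplus>\<^sub>c R))
    \<and> fls_subdegree k = weight (P \<oplus>\<^sub>c Q \<oplus>\<^sub>c R) - weight P - weight Q - weight R"
proof -
  obtain k where k: "k \<noteq> 0" "gen (point_ideal P * point_ideal Q) = gen ({k} * point_ideal (P \<oplus>\<^sub>c Q))"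
    "fls_subdegree k = weight (P \<oplus>\<^sub>c Q) - weight P - weight Q"
    using gen_point_add[OF assms(1,2)] by blast
  obtain k' where k': "k' \<noteq> 0"
    "gen (point_ideal (P \<oplus>\<^sub>c Q) * point_ideal R) = gen ({k'} * point_ideal (P \<oplus>\<^sub>c Q \<oplus>\<^sub>c R))"
    "fls_subdegree k' = weight (P \<oplus>\<^sub>c Q \<oplus>\<^sub>c R) - weight (P \<oplus>\<^sub>c Q) - weight R"
    using gen_point_add[OF add_mem[OF assms(1,2)] assms(3)] by blast
  have "gen (point_ideal P * point_ideal Q * point_ideal R)
      = gen ((point_ideal (P \<oplus>\<^sub>c Q) * point_ideal R) * {k})"
    using gen_times_cong[OF k(2), of "point_ideal R"] by (simp add: mult_ac)
  also have "\<dots> = gen ({k} * {k'} * point_ideal (P \<oplus>\<^sub>c Q \<oplus>\<^sub>c R))"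
    using gen_times_cong[OF k'(2), of "{k}"] by (simp add: mult_ac)
  also have "{k} * {k'} = {k * k'}"
    by (simp add: set_times_def)
  finally show ?thesis
    using k k' by (intro exI[of _ "k * k'"]) simp
qed

lemma add_assoc:
  assumes "P \<in> ec_points curve" "Q \<in> ec_points curve" "R \<in> ec_points curve"
  shows "P \<oplus>\<^sub>c Q \<oplus>\<^sub>c R = P \<oplus>\<^sub>c (Q \<oplus>\<^sub>c R)"
proof -
  obtain k where k: "k \<noteq> 0"
    "gen (point_ideal P * point_ideal Q * point_ideal R) = gen ({k} * point_ideal (P \<oplus>\<^sub>c Q \<oplus>\<^sub>c R))"
    "fls_subdegree k = weight (P \<oplus>\<^sub>c Q \<oplus>\<^sub>c R) - weight P - weight Q - weight R"
    using gen_point_add3[OF assms] by blast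
  obtain k' where k': "k' \<noteq> 0"
    "gen (point_ideal Q * point_ideal R * point_ideal P) = gen ({k'} * point_ideal (Q \<oplus>\<^sub>c R \<oplus>\<^sub>c P))"
    "fls_subdegree k' = weight (Q \<oplus>\<^sub>c R \<oplus>\<^sub>c P) - weight Q - weight R - weight P"
    using gen_point_add3[OF assms(2,3,1)] by blast
  \<comment> \<open>Comparing with the cyclic rotation of the product involves only sums bracketed
    to the left; commutativity then gives associativity.\<close>
  have "P \<oplus>\<^sub>c Q \<oplus>\<^sub>c R = Q \<oplus>\<^sub>c R \<oplus>\<^sub>c P"
    by (rule point_ideal_inject[OF _ _ k(1) k'(1)])
      (use k k' assms in \<open>auto simp: add_mem mult_ac\<close>)
  then show ?thesis
    using add_commute assms add_mem by metis
qed

lemma group: "group (ec_group curve)"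
proof (rule groupI)
  fix P assume "P \<in> carrier (ec_group curve)"
  then have P: "P \<in> ec_points curve" by (simp add: ec_group_def)
  have "neg P \<oplus>\<^sub>c P = Infinity"
    by (cases P) simp_all
  then show "\<exists>Q \<in> carrier (ec_group curve). Q \<otimes>\<^bsub>ec_group curve\<^esub> P = \<one>\<^bsub>ec_group curve\<^esub>"
    using neg_mem[OF P] by (auto simp: ec_group_def)
qed (auto simp: ec_group_def add_mem infinity_mem add_assoc)

lemma comm_group: "comm_group (ec_group curve)"
  by (rule group.group_comm_groupI[OF group]) (simp add: ec_group_def add_commute)

end

section \<open>Torsion points\<close>

subsection \<open>The p-adic valuation\<close>

definition pval :: "nat \<Rightarrow> rat \<Rightarrow> int" where
  "pval p x = int (multiplicity (int p) (fst (quotient_of x)))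
            - int (multiplicity (int p) (snd (quotient_of x)))"

locale padic =
  fixes p :: nat
  assumes prime: "prime p"
begin

lemma pval_fract:
  assumes "a \<noteq> 0" "b \<noteq> 0"
  shows "pval p (of_int a / of_int b) = int (multiplicity (int p) a) - int (multiplicity (int p) b)"
proof -
  obtain n d where nd: "quotient_of (of_int a / of_int b) = (n, d)"
    by (metis surj_pair)
  have d: "d > 0" and eq: "of_int a / of_int b = (of_int n / of_int d :: rat)"
    using quotient_of_denom_pos[OF nd] quotient_of_div[OF nd] by simp_all
  then have "(of_int (a * d) :: rat) = of_int (n * b)"
    using assms by (simp add: field_simps)
  then have e: "a * d = n * b"
    unfolding of_int_eq_iff .
  then have "n \<noteq> 0" using assms d by auto
  have p: "prime_elem (int p)" using prime by simp
  have "multiplicity (int p) a + multiplicity (int p) d = multiplicity (int p) n + multiplicity (int p) b"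
    using arg_cong[OF e, of "multiplicity (int p)"] assms d \<open>n \<noteq> 0\<close>
    by (simp add: prime_elem_multiplicity_mult_distrib[OF p])
  then show ?thesis
    unfolding pval_def nd by simp
qed

lemma rat_fract:
  fixes x :: rat
  obtains a b :: int where "x = of_int a / of_int b" "b > 0"
  using quotient_of_div[of x] quotient_of_denom_pos[of x] by (metis surj_pair)

lemma pval_of_int: "n \<noteq> 0 \<Longrightarrow> pval p (of_int n) = int (multiplicity (int p) n)"
  using pval_fract[of n 1] by simp

lemma pval_mult:
  assumes "x \<noteq> 0" "y \<noteq> 0"
  shows "pval p (x * y) = pval p x + pval p y"
proof -
  obtain a b where x: "x = of_int a / of_int b" "b > 0" by (rule rat_fract)
  obtain c d where y: "y = of_int c / of_int d" "d > 0" by (rule rat_fract)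
  have n0: "a \<noteq> 0" "c \<noteq> 0" using assms x y by auto
  have "x * y = of_int (a * c) / of_int (b * d)" using x y by simp
  then show ?thesis
    using pval_fract[of a b] pval_fract[of c d] pval_fract[of "a * c" "b * d"] x y n0 prime
    by (simp add: prime_elem_multiplicity_mult_distrib)
qed

lemma pval_add_ge:
  assumes "x \<noteq> 0" "y \<noteq> 0" "x + y \<noteq> 0" "k \<le> pval p x" "k \<le> pval p y"
  shows "k \<le> pval p (x + y)"
proof -
  obtain a b where x: "x = of_int a / of_int b" "b > 0" by (rule rat_fract)
  obtain c d where y: "y = of_int c / of_int d" "d > 0" by (rule rat_fract)
  have n0: "a \<noteq> 0" "c \<noteq> 0" "b \<noteq> 0" "d \<noteq> 0" using assms x y by auto
  have x': "x = of_int (a * d) / of_int (b * d)" and y': "y = of_int (b * c) / of_int (b * d)"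
    using x y by simp_all
  have xy: "x + y = of_int (a * d + b * c) / of_int (b * d)"
    using x y by (simp add: field_simps)
  have s0: "a * d + b * c \<noteq> 0"
  proof
    assume "a * d + b * c = 0"
    then show False using assms(3) xy by (simp only: of_int_0 div_0)
  qed
  let ?m = "multiplicity (int p)"
  \<comment> \<open>\<open>nat\<close> replaces a negative bound by 0, which is harmless since
    multiplicities are nonnegative.\<close>
  define j where "j = nat (k + int (?m (b * d)))"
  have "j \<le> ?m (a * d)" "j \<le> ?m (b * c)"
    using assms(4,5) pval_fract[of "a * d" "b * d"] pval_fract[of "b * c" "b * d"] n0
    unfolding x' y' by (simp_all add: j_def)
  then have "int p ^ j dvd a * d + b * c"
    by (intro dvd_add multiplicity_dvd')
  then have "j \<le> ?m (a * d + b * c)"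
    using s0 prime by (intro multiplicity_geI) (auto simp: prime_elem_not_unit)
  then show ?thesis
    unfolding xy using pval_fract[OF s0, of "b * d"] n0 by (simp add: j_def)
qed

lemma pval_one [simp]: "pval p 1 = 0"
  using pval_of_int[of 1] by simp

lemma pval_minus [simp]: "pval p (- x) = pval p x"
proof (cases "x = 0")
  case False
  have "pval p (-1) + pval p (-1) = 0"
    using pval_mult[of "-1" "-1"] by simp
  then show ?thesis
    using pval_mult[of "-1" x] False by simp
qed simp

lemma pval_power: "x \<noteq> 0 \<Longrightarrow> pval p (x ^ n) = int n * pval p x"
  by (induction n) (simp_all add: pval_mult algebra_simps)

lemma pval_inverse: "x \<noteq> 0 \<Longrightarrow> pval p (inverse x) = - pval p x"
  using pval_mult[of x "inverse x"] by simp

lemma pval_divide: "x \<noteq> 0 \<Longrightarrow> y \<noteq> 0 \<Longrightarrow> pval p (x / y) = pval p x - pval p y"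
  by (simp add: divide_inverse pval_mult pval_inverse)

definition vge :: "int \<Rightarrow> rat \<Rightarrow> bool" where
  "vge k x \<longleftrightarrow> x = 0 \<or> k \<le> pval p x"

lemma vge_zero [simp]: "vge k 0"
  by (simp add: vge_def)

lemma vge_mono: "vge k x \<Longrightarrow> l \<le> k \<Longrightarrow> vge l x"
  by (auto simp: vge_def)

lemma vge_add: "vge k x \<Longrightarrow> vge k y \<Longrightarrow> vge k (x + y)"
  using pval_add_ge[of x y k] by (cases "x = 0"; cases "y = 0"; cases "x + y = 0") (auto simp: vge_def)

lemma vge_minus_iff [simp]: "vge k (- x) \<longleftrightarrow> vge k x"
  by (simp add: vge_def)

lemma vge_diff: "vge k x \<Longrightarrow> vge k y \<Longrightarrow> vge k (x - y)"
  using vge_add[of k x "- y"] by simp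

lemma vge_mult: "vge k x \<Longrightarrow> vge l y \<Longrightarrow> vge (k + l) (x * y)"
  by (cases "x = 0"; cases "y = 0") (auto simp: vge_def pval_mult)

lemma vge_mult_left: "vge 0 x \<Longrightarrow> vge k y \<Longrightarrow> vge k (x * y)"
  using vge_mult[of 0 x k y] by simp

lemma vge_mult_right: "vge k x \<Longrightarrow> vge 0 y \<Longrightarrow> vge k (x * y)"
  using vge_mult[of k x 0 y] by simp

lemma vge_power: "vge k x \<Longrightarrow> vge (int n * k) (x ^ n)"
  using pval_power[of x n] by (cases n) (auto simp: vge_def intro: mult_left_mono)

lemma vge_power_0: "vge 0 x \<Longrightarrow> vge 0 (x ^ n)"
  using vge_power[of 0 x n] by simp

lemma vge_of_int: "vge 0 (of_int n)"
  by (cases "n = 0") (auto simp: vge_def pval_of_int)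

lemma vge_numeral: "vge 0 (numeral n)"
  using vge_of_int[of "numeral n"] by simp

lemma vge_one: "vge 0 1"
  using vge_of_int[of 1] by simp

lemma vge_1_of_int_iff: "vge 1 (of_int n) \<longleftrightarrow> int p dvd n"
proof (cases "n = 0")
  case False
  then have "1 \<le> multiplicity (int p) n \<longleftrightarrow> int p dvd n"
    using prime by (subst power_dvd_iff_le_multiplicity[symmetric]) (auto simp: prime_elem_not_unit)
  then show ?thesis
    using pval_of_int[OF False] False by (simp add: vge_def)
qed simp

lemma vge_unit: "x \<noteq> 0 \<Longrightarrow> pval p x = 0 \<Longrightarrow> vge k (x * y) \<longleftrightarrow> vge k y"
  by (cases "y = 0") (auto simp: vge_def pval_mult)

lemma vge_divide_unit: "y \<noteq> 0 \<Longrightarrow> pval p y = 0 \<Longrightarrow> vge k x \<Longrightarrow> vge k (x / y)"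
  by (cases "x = 0") (auto simp: vge_def pval_divide)

lemma pval_add_dominant:
  assumes "x \<noteq> 0" "vge (pval p x + 1) z"
  shows "x + z \<noteq> 0" "pval p (x + z) = pval p x"
proof -
  have nx: "\<not> vge (pval p x + 1) x" using assms(1) by (simp add: vge_def)
  have n: "\<not> vge (pval p x + 1) (x + z)"
    using vge_diff[OF _ assms(2), of "x + z"] nx by auto
  then show "x + z \<noteq> 0" by auto
  have "vge (pval p x) (x + z)"
    using assms(1) by (intro vge_add vge_mono[OF assms(2)]) (simp_all add: vge_def)
  then show "pval p (x + z) = pval p x"
    using n \<open>x + z \<noteq> 0\<close> by (auto simp: vge_def)
qed

lemma unit_iff: "x \<noteq> 0 \<and> pval p x = 0 \<longleftrightarrow> vge 0 x \<and> \<not> vge 1 x"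
  by (auto simp: vge_def)

lemma vge_0_of_power:
  assumes "vge 0 (x ^ n)" "0 < n"
  shows "vge 0 x"
  using assms by (cases "x = 0") (auto simp: vge_def pval_power zero_le_mult_iff)

text \<open>The reduced denominator \<open>b\<close> is prime to \<open>p\<close>; with
  \<open>b c = 1\<close> modulo \<open>p\<close> the integer \<open>a c\<close> represents the
  residue.\<close>

lemma ex_int_approx:
  assumes "vge 0 x"
  shows "\<exists>i. vge 1 (x - of_int i)"
proof -
  define a b where "a = fst (quotient_of x)" and "b = snd (quotient_of x)"
  have x: "x = of_int a / of_int b"
    by (rule quotient_of_div) (simp add: a_def b_def)
  have b: "b > 0" unfolding b_def by (rule quotient_of_denom_pos')
  have cop: "coprime a b"
    using quotient_of_coprime[of x a b] by (simp add: a_def b_def)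
  have "\<not> int p dvd b"
  proof
    assume pb: "int p dvd b"
    then have "\<not> int p dvd a"
      using cop prime by (metis coprime_common_divisor not_prime_unit prime_nat_int_transfer)
    then have "a \<noteq> 0" "multiplicity (int p) a = 0"
      by (auto simp: not_dvd_imp_multiplicity_0)
    moreover have "multiplicity (int p) b \<noteq> 0"
      using pb b prime by (subst multiplicity_eq_zero_iff) (auto simp: prime_elem_not_unit)
    ultimately show False
      using assms pval_fract[of a b] b unfolding x by (auto simp: vge_def)
  qed
  then have "coprime b (int p)"
    using prime prime_imp_coprime[of "int p" b] by (simp add: coprime_commute)
  then obtain c where c: "[b * c = 1] (mod int p)"
    using cong_solve_coprime_int by blast
  have "x - of_int (a * c) = of_int (a * (1 - b * c)) / of_int b"
    using b by (simp add: x field_simps)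
  moreover have "vge 1 (of_int (a * (1 - b * c)))"
    unfolding vge_1_of_int_iff using c by (simp add: cong_iff_dvd_diff dvd_diff_commute)
  moreover have "(of_int b :: rat) \<noteq> 0 \<and> pval p (of_int b) = 0"
    unfolding unit_iff vge_1_of_int_iff using \<open>\<not> int p dvd b\<close> vge_of_int by simp
  ultimately have "vge 1 (x - of_int (a * c))"
    using vge_divide_unit by metis
  then show ?thesis ..
qed

end

section \<open>Short integral equations with good reduction at an odd prime\<close>

definition cubic_disc :: "'a::comm_ring_1 \<Rightarrow> 'a \<Rightarrow> 'a \<Rightarrow> 'a" where
  "cubic_disc A B C = A^2 * B^2 - 4 * B^3 - 4 * A^3 * C - 27 * C^2 + 18 * A * B * C"

text \<open>The coefficients on the left are those of the cubic expanded around \<open>x\<close>.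
  Hence the discriminant lies in the ideal generated by the value and the derivative at
  \<open>x\<close>.\<close>

lemma cubic_disc_shift:
  "cubic_disc (A + 3 * x) (3 * x^2 + 2 * A * x + B) (x^3 + A * x^2 + B * x + C) = cubic_disc A B C"
  unfolding cubic_disc_def by (simp add: algebra_simps power_numeral_reduce)

locale integral_curve = padic +
  fixes A\<^sub>0 B\<^sub>0 C\<^sub>0 :: int
  assumes odd: "p \<noteq> 2" and good: "\<not> int p dvd cubic_disc A\<^sub>0 B\<^sub>0 C\<^sub>0"
begin

definition A :: rat where "A = of_int A\<^sub>0"
definition B :: rat where "B = of_int B\<^sub>0"
definition C :: rat where "C = of_int C\<^sub>0"

lemma disc_of_int: "cubic_disc A B C = of_int (cubic_disc A\<^sub>0 B\<^sub>0 C\<^sub>0)"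
  by (simp add: cubic_disc_def A_def B_def C_def)

sublocale short_curve A B C
proof
  fix x assume h: "x^3 + A * x^2 + B * x + C = 0"
  show "3 * x^2 + 2 * A * x + B \<noteq> 0"
  proof
    assume "3 * x^2 + 2 * A * x + B = 0"
    then have "cubic_disc A B C = 0"
      using cubic_disc_shift[of A x B C] h by (simp add: cubic_disc_def)
    then have "cubic_disc A\<^sub>0 B\<^sub>0 C\<^sub>0 = 0"
      by (simp add: disc_of_int)
    then show False using good by simp
  qed
qed

notation add (infixl "\<oplus>\<^sub>c" 65)

lemma vge_coeffs: "vge 0 A" "vge 0 B" "vge 0 C"
  by (simp_all add: A_def B_def C_def vge_of_int)

text \<open>The counterpart of \<open>nonsingular\<close> modulo \<open>p\<close>: a common zero of
  the cubic and its derivative would make the discriminant divisible by \<open>p\<close>.\<close>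

lemma deriv_unit:
  assumes "vge 0 x" "vge 1 (x^3 + A * x^2 + B * x + C)"
  shows "\<not> vge 1 (3 * x^2 + 2 * A * x + B)"
proof
  assume d: "vge 1 (3 * x^2 + 2 * A * x + B)"
  have *: "vge 1 (cubic_disc a b c)" if "vge 0 a" "vge 1 b" "vge 1 c" for a b c
  proof -
    have "vge 0 b" "vge 0 c" using that by (auto intro: vge_mono)
    moreover have "cubic_disc a b c = (a^2 * b - 4 * b^2 + 18 * a * c) * b + (- (4 * a^3) - 27 * c) * c"
      by (simp add: cubic_disc_def algebra_simps power_numeral_reduce)
    ultimately show ?thesis
      using that by (auto intro!: vge_add vge_diff vge_mult_left vge_power_0 vge_numeral)
  qed
  have "vge 1 (cubic_disc A B C)"
    unfolding cubic_disc_shift[of A x B C, symmetric]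
    by (intro * d assms vge_add vge_mult_left vge_numeral vge_coeffs)
  then show False
    using good by (simp add: disc_of_int vge_1_of_int_iff)
qed

lemma two_unit: "(2::rat) \<noteq> 0 \<and> pval p 2 = 0"
proof -
  have "\<not> int p dvd 2"
    using odd prime prime_ge_2_nat[OF prime] zdvd_imp_le[of "int p" 2] by auto
  then show ?thesis
    unfolding unit_iff using vge_1_of_int_iff[of 2] vge_numeral by simp
qed

subsection \<open>The kernel of reduction\<close>

fun tpar :: "rat ec_point \<Rightarrow> rat" where
  "tpar Infinity = 0"
| "tpar (Affine x y) = x / y"

text \<open>Level \<open>k\<close> of the filtration on the kernel of reduction. The condition
  \<open>y \<noteq> 0\<close> is there because \<open>x / 0 = 0\<close> would admit the points of
  order 2.\<close>

fun kernel :: "int \<Rightarrow> rat ec_point \<Rightarrow> bool" where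
  "kernel k Infinity \<longleftrightarrow> True"
| "kernel k (Affine x y) \<longleftrightarrow> y \<noteq> 0 \<and> vge k (x / y) \<and> vge (3 * k) (1 / y)"

text \<open>The term \<open>x^3\<close> dominates the cubic, so twice the valuation of
  \<open>y\<close> is three times that of \<open>x\<close>; the two valuations are therefore
  \<open>- 3 k\<close> and \<open>- 2 k\<close>.\<close>

lemma nonintegral_point:
  assumes P: "Affine x y \<in> ec_points curve" and x: "\<not> vge 0 x"
  obtains k where "1 \<le> k" "kernel k (Affine x y)" "x / y \<noteq> 0" "pval p (x / y) = k"
proof -
  define n where "n = - pval p x"
  have x0: "x \<noteq> 0" and n: "1 \<le> n" using x by (auto simp: vge_def n_def)
  have vx: "vge (-n) x" using x0 by (simp add: vge_def n_def)
  have h: "y^2 = x^3 + (A * x^2 + B * x + C)"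
    using P by (simp add: affine_mem_iff)
  have "pval p (x^3) = - 3 * n"
    using pval_power[OF x0, of 3] by (simp add: n_def)
  moreover have "vge (- 3 * n + 1) (A * x^2 + B * x + C)"
  proof (intro vge_add vge_mult_left vge_coeffs)
    show "vge (- 3 * n + 1) (x^2)"
      using vge_power[OF vx, of 2] by (rule vge_mono) (use n in simp)
    show "vge (- 3 * n + 1) x"
      using vx by (rule vge_mono) (use n in simp)
    show "vge (- 3 * n + 1) C"
      using vge_coeffs(3) by (rule vge_mono) (use n in simp)
  qed
  ultimately have "y^2 \<noteq> 0 \<and> pval p (y^2) = - 3 * n"
    unfolding h using pval_add_dominant[of "x^3" "A * x^2 + B * x + C"] x0 by simp
  then have y: "y \<noteq> 0" "2 * pval p y = - 3 * n"
    using pval_power[of y 2] by auto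
  define j where "j = - pval p y - n"
  have j: "n = 2 * j"
    using y(2) by (simp add: j_def)
  then have "pval p y = - 3 * j" using y(2) by simp
  then have "pval p (x / y) = j" "pval p (1 / y) = 3 * j"
    using pval_divide[OF x0 y(1)] pval_divide[of 1 y] y(1) j by (simp_all add: n_def)
  then show ?thesis
    using that[of j] j n x0 y(1) by (simp add: vge_def)
qed

lemma kernel_nonintegral:
  assumes "Affine x y \<in> ec_points curve" "kernel k (Affine x y)" "1 \<le> k"
  shows "\<not> vge 0 x"
proof
  assume x: "vge 0 x"
  have "y^2 = x^3 + A * x^2 + B * x + C"
    using assms(1) by (simp add: affine_mem_iff)
  then have "vge 0 (y^2)"
    using x by (auto intro!: vge_add vge_mult_left vge_power_0 vge_coeffs)
  then have "vge 0 y" by (rule vge_0_of_power) simp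
  moreover have "y \<noteq> 0" "3 * k \<le> pval p (1 / y)"
    using assms(2) by (auto simp: vge_def)
  ultimately show False
    using pval_divide[of 1 y] assms(3) by (simp add: vge_def)
qed

lemma equation_in_parameters:
  assumes "Affine x y \<in> ec_points curve" "y \<noteq> 0"
  defines "t \<equiv> x / y" and "s \<equiv> 1 / y"
  shows "s = t^3 + A * t^2 * s + B * t * s^2 + C * s^3"
proof -
  have h: "y^2 = x^3 + A * x^2 + B * x + C"
    using assms(1) by (simp add: affine_mem_iff)
  have "s = y^2 / y^3"
    using assms(2) by (simp add: s_def power_numeral_reduce)
  also have "\<dots> = t^3 + A * t^2 * s + B * t * s^2 + C * s^3"
    unfolding h t_def s_def using assms(2) by (simp add: field_simps power_numeral_reduce)
  finally show ?thesis .
qed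

text \<open>In the coordinates \<open>t = x / y\<close> and \<open>s = 1 / y\<close> the line through the two points is
  \<open>s = \<alpha> t + \<beta>\<close>, where \<open>\<alpha> = N / U\<close> has valuation at least \<open>2 k\<close> because \<open>U\<close> is a unit; the sum
  of the three values of \<open>t\<close> on the line is read off the resulting cubic equation for \<open>t\<close>.\<close>

lemma kernel_add:
  assumes k: "1 \<le> k" and P: "P \<in> ec_points curve" "kernel k P" and Q: "Q \<in> ec_points curve" "kernel k Q"
  shows "kernel k (P \<oplus>\<^sub>c Q) \<and> vge (3 * k) (tpar (P \<oplus>\<^sub>c Q) - tpar P - tpar Q)"
proof (cases "P = Infinity \<or> Q = Infinity")
  case True
  then show ?thesis using P Q by auto
next
  case False
  then obtain x1 y1 x2 y2 where PQ: "P = Affine x1 y1" "Q = Affine x2 y2"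
    by (metis ec_point.exhaust)
  show ?thesis
  proof (cases "x1 = x2 \<and> y1 + y2 = 0")
    case True
    then have "y2 = - y1" by simp
    with True show ?thesis by (simp add: PQ)
  next
    case False
    note P' = P[unfolded PQ] and Q' = Q[unfolded PQ]
    obtain l m x3 where sum: "P \<oplus>\<^sub>c Q = Affine x3 (- (l * x3 + m))"
      and y1: "y1 = l * x1 + m" and y2: "y2 = l * x2 + m"
      and tan: "x1 = x2 \<Longrightarrow> y2 = y1 \<and> y1 \<noteq> 0 \<and> 2 * y1 * l = 3 * x1^2 + 2 * A * x1 + B"
      and e1: "x1 + x2 + x3 = l^2 - A"
      and e2: "x1 * x2 + x1 * x3 + x2 * x3 = B - 2 * l * m"
      and e3: "x1 * x2 * x3 = m^2 - C"
      using add_affine_line[of x1 y1 x2 y2] P' Q' False unfolding PQ by metis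
    have y0: "y1 \<noteq> 0" "y2 \<noteq> 0" using P' Q' by simp_all
    define t1 where "t1 = x1 / y1"
    define s1 where "s1 = 1 / y1"
    define t2 where "t2 = x2 / y2"
    define s2 where "s2 = 1 / y2"
    note ts = t1_def s1_def t2_def s2_def
    have v: "vge k t1" "vge k t2" "vge (3 * k) s1" "vge (3 * k) s2"
      using P' Q' by (simp_all add: ts)
    \<comment> \<open>Subtracting the curve equations of the two points in \<open>t\<close> and
      \<open>s\<close> gives \<open>(s2 - s1) * U = (t2 - t1) * N\<close>; \<open>U\<close> collects
      the terms with the factor \<open>s2 - s1\<close>.\<close>
    define N where "N = t1^2 + t1 * t2 + t2^2 + A * (t1 + t2) * s2 + B * s2^2"
    define V where "V = A * t1^2 + B * t1 * (s1 + s2) + C * (s1^2 + s1 * s2 + s2^2)"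
    define U where "U = 1 - V"
    have t2: "vge (2 * k) (t1^2)" "vge (2 * k) (t2^2)" "vge (2 * k) (t1 * t2)"
      using vge_power[OF v(1), of 2] vge_power[OF v(2), of 2] vge_mult[OF v(1,2)] by simp_all
    have ts2: "vge (2 * k) (a * s1)" "vge (2 * k) (a * s2)" if "vge k a" for a
      using vge_mult[OF that v(3)] vge_mult[OF that v(4)] k by (auto elim: vge_mono)
    have s1k: "vge k s1" "vge k s2" 
      using v(3,4) k by (auto elim: vge_mono)
    have N: "vge (2 * k) N"
      unfolding N_def power2_eq_square[of s2] mult.assoc
      using ts2(2)[OF vge_add[OF v(1,2)]] ts2(2)[OF s1k(2)]
      by (intro vge_add t2 vge_mult_left[OF vge_coeffs(1)] vge_mult_left[OF vge_coeffs(2)])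
    have V: "vge (2 * k) V"
      unfolding V_def power2_eq_square[of s1] power2_eq_square[of s2] mult.assoc distrib_left
      by (intro vge_add t2 vge_mult_left[OF vge_coeffs(1)] vge_mult_left[OF vge_coeffs(2)]
          vge_mult_left[OF vge_coeffs(3)] ts2 v s1k)
    have U: "U \<noteq> 0 \<and> pval p U = 0"
      using pval_add_dominant[of 1 "- V"] vge_mono[OF V, of 1] k by (simp add: U_def)
    have Ueq: "(s2 - s1) * U = (t2 - t1) * N"
    proof -
      have "s1 = t1^3 + A * t1^2 * s1 + B * t1 * s1^2 + C * s1^3"
        "s2 = t2^3 + A * t2^2 * s2 + B * t2 * s2^2 + C * s2^3"
        unfolding ts
        by (rule equation_in_parameters[OF P'(1) y0(1)], rule equation_in_parameters[OF Q'(1) y0(2)])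
      moreover have "(s2 - s1) * U - (t2 - t1) * N =
          (s2 - (t2^3 + A * t2^2 * s2 + B * t2 * s2^2 + C * s2^3))
          - (s1 - (t1^3 + A * t1^2 * s1 + B * t1 * s1^2 + C * s1^3))"
        unfolding U_def V_def N_def by (simp add: algebra_simps power_numeral_reduce)
      ultimately show ?thesis by simp
    qed
    \<comment> \<open>In these coordinates \<open>y = l x + m\<close> reads
      \<open>s = - (l / m) t + 1 / m\<close>, so the slope is \<open>N / U\<close>. For equal
      abscissas the subtraction says nothing and the tangent is computed directly.\<close>
    have slope: "m \<noteq> 0 \<and> l * U = - N * m"
    proof (cases "x1 = x2")
      case True
      with tan have y: "y2 = y1" "2 * y1 * l = 3 * x1^2 + 2 * A * x1 + B" by auto
      have h: "y1^2 = x1^3 + A * x1^2 + B * x1 + C"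
        using P' by (simp add: affine_mem_iff)
      have "N * y1^2 = 3 * x1^2 + 2 * A * x1 + B"
        unfolding N_def ts True[symmetric] y(1) using y0
        by (simp add: field_simps power2_eq_square)
      then have Ny: "N * y1^2 = 2 * y1 * l" using y by simp
      then have Ny': "N * y1 = 2 * l"
        using y0 by (simp add: power2_eq_square)
      have "U * y1^2 = y1^2 - A * x1^2 - 2 * B * x1 - 3 * C"
        unfolding U_def V_def ts True[symmetric] y(1) using y0
        by (simp add: field_simps power2_eq_square)
      also have "\<dots> = (3 * x1^2 + 2 * A * x1 + B) * x1 - 2 * y1^2"
        unfolding h by (simp add: algebra_simps power_numeral_reduce)
      also have "\<dots> = - 2 * y1 * m"
        unfolding y(2)[symmetric] y1 by (simp add: algebra_simps power2_eq_square)
      finally have "(U * y1) * y1 = (- 2 * m) * y1"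
        by (simp add: power2_eq_square mult_ac)
      then have Uy: "U * y1 = - 2 * m"
        using y0(1) by (simp only: mult_cancel_right) simp
      then have "m \<noteq> 0" using U y0 by auto
      moreover have "l * U = - N * m"
      proof -
        have "(2 * y1) * (l * U) = 2 * l * (U * y1)" by simp
        also have "\<dots> = N * y1 * (- 2 * m)" unfolding Ny' Uy ..
        also have "\<dots> = (2 * y1) * (- N * m)" by simp
        finally show ?thesis
          using y0(1) by (simp only: mult_cancel_left) simp
      qed
      ultimately show ?thesis by simp
    next
      case False
      have t: "(t2 - t1) * (y1 * y2) = m * (x2 - x1)"
      proof -
        have "(t2 - t1) * (y1 * y2) = x2 * y1 - x1 * y2"
          using y0 by (simp add: ts field_simps)
        then show ?thesis unfolding y1 y2 by (simp add: algebra_simps)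
      qed
      have s: "(s2 - s1) * (y1 * y2) = - (l * (x2 - x1))"
      proof -
        have "(s2 - s1) * (y1 * y2) = y1 - y2"
          using y0 by (simp add: ts field_simps)
        then show ?thesis unfolding y1 y2 by (simp add: algebra_simps)
      qed
      have "(s2 - s1) * (y1 * y2) * U = (t2 - t1) * (y1 * y2) * N"
        using Ueq by (simp add: mult_ac)
      then have "(x2 - x1) * (l * U) = (x2 - x1) * (- N * m)"
        unfolding s t by (simp add: algebra_simps)
      then have lU: "l * U = - N * m"
        using False by (simp only: mult_cancel_left) simp
      moreover have "m \<noteq> 0"
      proof
        assume "m = 0"
        then have "l = 0" using lU U by simp
        then show False using y1 y0 \<open>m = 0\<close> by simp
      qed
      ultimately show ?thesis by simp
    qed
    define \<alpha> where "\<alpha> = N / U"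
    define \<beta> where "\<beta> = 1 / m"
    have l: "l = - \<alpha> * m"
      using slope U by (simp add: \<alpha>_def field_simps)
    have \<alpha>: "vge (2 * k) \<alpha>"
      unfolding \<alpha>_def using U N by (intro vge_divide_unit) auto
    have line: "1 / y = \<alpha> * (x / y) + \<beta>" if "y = l * x + m" "y \<noteq> 0" for x y
    proof -
      have "\<beta> * y = 1 - \<alpha> * x"
        using slope that unfolding \<beta>_def l by (simp add: field_simps)
      then show ?thesis using that(2) by (simp add: field_simps)
    qed
    have "\<beta> = s1 - \<alpha> * t1"
      using line[OF y1 y0(1)] by (simp add: ts)
    moreover have \<alpha>t: "vge (3 * k) (\<alpha> * t)" if "vge k t" for t
      using vge_mult[OF \<alpha> that] by simp
    ultimately have \<beta>: "vge (3 * k) \<beta>"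
      using v by (simp add: vge_diff)
    have \<alpha>0: "vge 0 \<alpha>" using \<alpha> k by (auto elim: vge_mono)
    \<comment> \<open>\<open>W\<close> is the coefficient of \<open>t^3\<close> after the line is
      inserted into the curve equation; as it is a unit, the sum of the roots has no larger
      denominator than \<open>\<beta>\<close>.\<close>
    define W where "W = 1 + (A * \<alpha> + B * \<alpha>^2 + C * \<alpha>^3)"
    have "vge (2 * k) (A * \<alpha> + B * \<alpha>^2 + C * \<alpha>^3)"
    proof -
      have "A * \<alpha> + B * \<alpha>^2 + C * \<alpha>^3 = (A + B * \<alpha> + C * \<alpha>^2) * \<alpha>"
        by (simp add: algebra_simps power_numeral_reduce)
      then show ?thesis
        using \<alpha> \<alpha>0 by (simp add: vge_mult_left vge_add vge_coeffs vge_power_0)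
    qed
    then have W: "W \<noteq> 0 \<and> pval p W = 0"
      using pval_add_dominant[of 1 "A * \<alpha> + B * \<alpha>^2 + C * \<alpha>^3"] k
      by (simp add: W_def vge_mono)
    define y3 where "y3 = l * x3 + m"
    have prod: "y1 * y2 * y3 = m^3 * W"
    proof -
      have "y1 * y2 * y3 = l^3 * (x1 * x2 * x3) + l^2 * m * (x1 * x2 + x1 * x3 + x2 * x3)
          + l * m^2 * (x1 + x2 + x3) + m^3"
        unfolding y1 y2 y3_def by (simp add: algebra_simps power_numeral_reduce)
      also have "\<dots> = m^3 * W"
        unfolding e1 e2 e3 W_def l by (simp add: algebra_simps power_numeral_reduce)
      finally show ?thesis .
    qed
    then have y3: "y3 \<noteq> 0" using W slope y0 by auto
    define t3 where "t3 = x3 / y3"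
    have tsum: "t1 + t2 + t3 = - ((A + 2 * B * \<alpha> + 3 * C * \<alpha>^2) * \<beta>) / W"
    proof -
      have "(t1 + t2 + t3) * (y1 * y2 * y3) = x1 * y2 * y3 + x2 * y1 * y3 + x3 * y1 * y2"
        using y0 y3 by (simp add: ts t3_def field_simps)
      also have "\<dots> = 3 * l^2 * (x1 * x2 * x3) + 2 * l * m * (x1 * x2 + x1 * x3 + x2 * x3)
          + m^2 * (x1 + x2 + x3)"
        unfolding y1 y2 y3_def by (simp add: algebra_simps power_numeral_reduce)
      also have "\<dots> = - (A + 2 * B * \<alpha> + 3 * C * \<alpha>^2) * m^2"
        unfolding e1 e2 e3 l by (simp add: algebra_simps power_numeral_reduce)
      finally have "(t1 + t2 + t3) * (m^3 * W) = - (A + 2 * B * \<alpha> + 3 * C * \<alpha>^2) * m^2"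
        unfolding prod .
      then have "m^2 * ((t1 + t2 + t3) * (m * W)) = m^2 * - (A + 2 * B * \<alpha> + 3 * C * \<alpha>^2)"
        by (simp add: power_numeral_reduce mult_ac)
      then have "(t1 + t2 + t3) * (m * W) = - (A + 2 * B * \<alpha> + 3 * C * \<alpha>^2)"
        using slope by (simp only: mult_cancel_left) simp
      then show ?thesis
        using slope W by (simp add: \<beta>_def field_simps)
    qed
    have vt: "vge (3 * k) (t1 + t2 + t3)"
      unfolding tsum using W \<beta> \<alpha>0
      by (intro vge_divide_unit) (auto intro!: vge_mult_left vge_add vge_coeffs vge_numeral vge_power_0)
    have "vge k (t1 + t2 + t3 - t1 - t2)"
      using vge_mono[OF vt, of k] k v by (intro vge_diff) auto
    then have t3: "vge k t3" by simp
    have s3: "vge (3 * k) (1 / y3)"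
      using line[OF y3_def y3] vge_add[OF \<alpha>t[OF t3] \<beta>] by (simp add: t3_def)
    have sum': "P \<oplus>\<^sub>c Q = Affine x3 (- y3)"
      unfolding sum y3_def ..
    have "kernel k (P \<oplus>\<^sub>c Q)"
      unfolding sum' using y3 t3 s3 by (simp add: t3_def)
    moreover have "tpar (P \<oplus>\<^sub>c Q) - tpar P - tpar Q = - (t1 + t2 + t3)"
      unfolding sum' by (simp add: PQ ts t3_def)
    then have "vge (3 * k) (tpar (P \<oplus>\<^sub>c Q) - tpar P - tpar Q)"
      using vt by (simp only: vge_minus_iff)
    ultimately show ?thesis ..
  qed
qed

section \<open>Multiples of points in the kernel of reduction\<close>

abbreviation pow :: "rat ec_point \<Rightarrow> nat \<Rightarrow> rat ec_point" where
  "pow P n \<equiv> P [^]\<^bsub>ec_group curve\<^esub> n"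

lemma closed: "ec_add_closed curve"
  by (simp add: ec_add_closed_def add_mem)

lemma kernel_pow:
  assumes "1 \<le> k" "P \<in> ec_points curve" "kernel k P"
  shows "kernel k (pow P n) \<and> vge (3 * k) (tpar (pow P n) - of_nat n * tpar P)"
proof (induction n)
  case 0
  then show ?case unfolding ec_group_pow by simp
next
  case (Suc n)
  have "kernel k (pow P n \<oplus>\<^sub>c P) \<and> vge (3 * k) (tpar (pow P n \<oplus>\<^sub>c P) - tpar (pow P n) - tpar P)"
    using Suc assms ec_pow_mem[OF closed assms(2)] by (intro kernel_add) auto
  then have "kernel k (pow P n \<oplus>\<^sub>c P)"
    "vge (3 * k) ((tpar (pow P n \<oplus>\<^sub>c P) - tpar (pow P n) - tpar P) + (tpar (pow P n) - of_nat n * tpar P))"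
    using Suc vge_add by blast+
  then show ?case
    unfolding ec_group_pow by (simp add: algebra_simps)
qed

text \<open>With \<open>k\<close> the exact valuation of the parameter \<open>t\<close>, the
  parameter of the \<open>q\<close>-fold point agrees with \<open>q t\<close> to order
  \<open>3 k\<close>, while \<open>q t\<close> has valuation at most \<open>k + 1 < 3 k\<close>.
  This covers \<open>q = p\<close> as well.\<close>

lemma pow_prime_nonintegral:
  assumes P: "Affine x y \<in> ec_points curve" "\<not> vge 0 x" and q: "prime q"
  shows "pow (Affine x y) q \<noteq> Infinity"
proof
  assume inf: "pow (Affine x y) q = Infinity"
  obtain k where k: "1 \<le> k" "kernel k (Affine x y)" "x / y \<noteq> 0" "pval p (x / y) = k"
    using nonintegral_point[OF P] by metis
  have "vge (3 * k) (of_nat q * (x / y))"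
    using kernel_pow[OF k(1) P(1) k(2), of q] inf by simp
  moreover have q0: "(of_nat q :: rat) \<noteq> 0"
    using q by auto
  ultimately have "3 * k \<le> pval p (of_nat q) + k"
    using pval_mult[OF q0 k(3)] k by (simp add: vge_def)
  moreover have "pval p (of_nat q) \<le> 1"
  proof -
    have "multiplicity (int p) (int q) \<le> 1"
      using prime q by (cases "p = q") (auto simp: prime_multiplicity_other)
    then show ?thesis
      using pval_of_int[of "int q"] q by (auto simp: prime_gt_0_nat)
  qed
  ultimately show False using k(1) by simp
qed

text \<open>A prime factor \<open>q\<close> of \<open>n\<close> is split off: the
  \<open>n / q\<close>-fold point is affine by induction and still in the kernel, hence nonintegral,
  and the prime case applies to it.\<close>

lemma pow_nonintegral:
  assumes "Affine x y \<in> ec_points curve" "\<not> vge 0 x" "0 < n"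
  shows "pow (Affine x y) n \<noteq> Infinity"
  using assms(3)
proof (induction n rule: less_induct)
  case (less n)
  interpret group "ec_group curve" by (rule group)
  have carrier: "carrier (ec_group curve) = ec_points curve" by (simp add: ec_group_def)
  show ?case
  proof (cases "n = 1")
    case True
    have "pow (Affine x y) 1 = Affine x y"
      unfolding One_nat_def ec_group_pow by simp
    then show ?thesis using True by simp
  next
    case False
    then obtain q m where q: "prime q" "n = m * q"
      using prime_factor_nat[of n] by (metis dvd_def mult.commute)
    then have m: "0 < m" "m < n"
      using less.prems prime_gt_1_nat[OF q(1)] by (auto intro: Nat.gr0I)
    then obtain x' y' where P': "pow (Affine x y) m = Affine x' y'"
      using less.IH by (metis ec_point.exhaust)
    obtain k where k: "1 \<le> k" "kernel k (Affine x y)"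
      using nonintegral_point[OF assms(1,2)] by metis
    have mem: "Affine x' y' \<in> ec_points curve"
      using ec_pow_mem[OF closed assms(1), of m] P' by simp
    then have "\<not> vge 0 x'"
      using kernel_nonintegral[of x' y' k] kernel_pow[OF k(1) assms(1) k(2), of m] P' k by simp
    moreover have "pow (Affine x y) n = pow (Affine x' y') q"
      using nat_pow_pow[of "Affine x y" m q] assms(1) P' q(2) carrier by simp
    ultimately show ?thesis
      using pow_prime_nonintegral[OF mem _ q(1)] by simp
  qed
qed

section \<open>Integrality of torsion points and injectivity of reduction\<close>

lemma torsion_integral:
  assumes "Affine x y \<in> ec_torsion curve"
  shows "vge 0 x" "vge 0 y"
proof -
  have mem: "Affine x y \<in> ec_points curve"
    using assms by (simp add: ec_torsion_def ec_group_def)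
  obtain n where "0 < n" "pow (Affine x y) n = Infinity"
    using assms by (auto simp: ec_torsion_def ec_group_def)
  then show x: "vge 0 x"
    using pow_nonintegral[OF mem] by blast
  have "y^2 = x^3 + A * x^2 + B * x + C"
    using mem by (simp add: affine_mem_iff)
  then have "vge 0 (y^2)"
    using x by (auto intro!: vge_add vge_mult_left vge_power_0 vge_coeffs)
  then show "vge 0 y" by (rule vge_0_of_power) simp
qed

lemma torsion_subgroup: "subgroup (ec_torsion curve) (ec_group curve)"
proof -
  interpret comm_group "ec_group curve" by (rule comm_group)
  show ?thesis
  proof
    show "ec_torsion curve \<subseteq> carrier (ec_group curve)"
      by (auto simp: ec_torsion_def)
    show "\<one>\<^bsub>ec_group curve\<^esub> \<in> ec_torsion curve"
      by (auto simp: ec_torsion_def intro: exI[of _ 1])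
  next
    fix P Q assume "P \<in> ec_torsion curve" "Q \<in> ec_torsion curve"
    then obtain m n :: nat where *: "P \<in> carrier (ec_group curve)" "Q \<in> carrier (ec_group curve)"
      "0 < m" "0 < n" "pow P m = \<one>\<^bsub>ec_group curve\<^esub>" "pow Q n = \<one>\<^bsub>ec_group curve\<^esub>"
      by (auto simp: ec_torsion_def)
    have "pow P (m * n) = \<one>\<^bsub>ec_group curve\<^esub>" "pow Q (m * n) = \<one>\<^bsub>ec_group curve\<^esub>"
    proof -
      have "pow P (m * n) = pow (pow P m) n" "pow Q (m * n) = pow (pow Q n) m"
        using nat_pow_pow[OF *(1), of m n] nat_pow_pow[OF *(2), of n m] by (simp_all add: mult.commute)
      then show "pow P (m * n) = \<one>\<^bsub>ec_group curve\<^esub>" "pow Q (m * n) = \<one>\<^bsub>ec_group curve\<^esub>"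
        unfolding *(5,6) by simp_all
    qed
    then have "pow (P \<otimes>\<^bsub>ec_group curve\<^esub> Q) (m * n) = \<one>\<^bsub>ec_group curve\<^esub>"
      using * by (simp add: pow_mult_distrib m_comm)
    then show "P \<otimes>\<^bsub>ec_group curve\<^esub> Q \<in> ec_torsion curve"
      using * unfolding ec_torsion_def by (auto intro!: exI[of _ "m * n"])
  next
    fix P assume "P \<in> ec_torsion curve"
    then show "inv\<^bsub>ec_group curve\<^esub> P \<in> ec_torsion curve"
      by (auto simp: ec_torsion_def nat_pow_inv)
  qed
qed

lemma neg_torsion:
  assumes "P \<in> ec_torsion curve"
  shows "neg P \<in> ec_torsion curve"
proof -
  interpret comm_group "ec_group curve" by (rule comm_group)
  have P: "P \<in> ec_points curve" using assms by (simp add: ec_torsion_def ec_group_def)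
  have "neg P \<oplus>\<^sub>c P = Infinity" by (cases P) simp_all
  then have "inv\<^bsub>ec_group curve\<^esub> P = neg P"
    using P neg_mem[OF P] by (intro inv_equality) (simp_all add: ec_group_def)
  then show ?thesis
    using subgroup.m_inv_closed[OF torsion_subgroup assms] by simp
qed

lemma add_torsion:
  "P \<in> ec_torsion curve \<Longrightarrow> Q \<in> ec_torsion curve \<Longrightarrow> P \<oplus>\<^sub>c Q \<in> ec_torsion curve"
  using subgroup.m_closed[OF torsion_subgroup, of P Q] by (simp add: ec_group_def)

text \<open>The difference of two distinct torsion points is torsion, hence integral, so the line
  through one and the negative of the other has integral slope. As these two are opposite modulo
  \<open>p\<close>, that forces \<open>y\<close> and the derivative of the cubic to vanish modulo
  \<open>p\<close>, against smoothness.\<close>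

lemma torsion_congruent_eq:
  assumes P: "Affine x y \<in> ec_torsion curve" and Q: "Affine x' y' \<in> ec_torsion curve"
    and "vge 1 (x - x')" "vge 1 (y - y')"
  shows "x = x' \<and> y = y'"
proof (rule ccontr)
  assume ne: "\<not> (x = x' \<and> y = y')"
  have memP: "Affine x y \<in> ec_points curve" and memQ: "Affine x' (- y') \<in> ec_points curve"
    using P neg_torsion[OF Q] by (simp_all add: ec_torsion_def ec_group_def)
  then have h: "y^2 = x^3 + A * x^2 + B * x + C" and h': "y'^2 = x'^3 + A * x'^2 + B * x' + C"
    by (simp_all add: affine_mem_iff)
  have int: "vge 0 x" "vge 0 y" "vge 0 x'" "vge 0 y'"
    using torsion_integral[OF P] torsion_integral[OF Q] by simp_all
  have ns: "\<not> (x = x' \<and> y + - y' = 0)" using ne by simp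
  obtain l m x'' where sum: "Affine x y \<oplus>\<^sub>c Affine x' (- y') = Affine x'' (- (l * x'' + m))"
    and tan: "x = x' \<Longrightarrow> - y' = y \<and> y \<noteq> 0 \<and> 2 * y * l = 3 * x^2 + 2 * A * x + B"
    and chord: "x \<noteq> x' \<Longrightarrow> l = (- y' - y) / (x' - x)"
    and e1: "x + x' + x'' = l^2 - A"
    using add_affine_line[OF memP memQ ns] by metis
  have "vge 0 x''"
    using torsion_integral(1) add_torsion[OF P neg_torsion[OF Q]] sum by simp
  moreover have "l^2 = x + x' + x'' + A" using e1 by simp
  ultimately have "vge 0 (l^2)"
    using int by (simp add: vge_add vge_coeffs)
  then have l: "vge 0 l" by (rule vge_0_of_power) simp
  have small: "vge 1 (y^2)" if "vge 1 y"
    using that int vge_mult_left[of y 1 y] by (simp add: power2_eq_square)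
  show False
  proof (cases "x = x'")
    case True
    from tan[OF True] have y': "y' = - y" and t: "2 * y * l = 3 * x^2 + 2 * A * x + B" by auto
    have "vge 1 (2 * y)" using assms(4) unfolding y' by simp
    then have "vge 1 y" using two_unit vge_unit[of 2 1 y] by simp
    then have "vge 1 (2 * y * l)"
      using l by (simp add: vge_mult_left vge_mult_right vge_numeral)
    then show False
      using deriv_unit[OF int(1)] small[OF \<open>vge 1 y\<close>] unfolding h t by blast
  next
    case False
    then have lx: "l * (x' - x) = - y' - y" using chord by simp
    have xd: "vge 1 (x' - x)" using assms(3) vge_minus_iff[of 1 "x - x'"] by simp
    have "vge 1 (- y' - y)" unfolding lx[symmetric] using l xd by (rule vge_mult_left)
    with assms(4) have "vge 1 ((y - y') - (- y' - y))"
      by (rule vge_diff)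
    then have "vge 1 (2 * y)" by simp
    then have y: "vge 1 y" using two_unit vge_unit[of 2 1 y] by simp
    \<comment> \<open>The divided difference of the cubic, congruent to its derivative at
      \<open>x\<close> because \<open>x\<close> and \<open>x'\<close> are congruent.\<close>
    let ?g = "x^2 + x * x' + x'^2 + A * (x + x') + B"
    have "(x' - x) * ?g = (y' - y) * (y' + y)"
      using h h' by (simp add: algebra_simps power_numeral_reduce)
    also have "y' + y = - (l * (x' - x))" using lx by simp
    finally have "(x' - x) * ?g = (x' - x) * (- (y' - y) * l)"
      by (simp only: mult_minus_left mult_minus_right mult_ac)
    then have g: "?g = - (y' - y) * l"
      using False by (simp only: mult_cancel_left) simp
    have "vge 1 ((y - y') * l)" using assms(4) l by (rule vge_mult_right)
    then have "vge 1 ?g" unfolding g by (simp add: algebra_simps)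
    moreover have "vge 1 ((2 * x + x' + A) * (x - x'))"
      using int by (intro vge_mult_left[OF _ assms(3)] vge_add vge_mult_left vge_numeral vge_coeffs)
    ultimately have "vge 1 (?g + (2 * x + x' + A) * (x - x'))"
      by (rule vge_add)
    moreover have "?g + (2 * x + x' + A) * (x - x') = 3 * x^2 + 2 * A * x + B"
      by (simp add: algebra_simps power2_eq_square)
    ultimately show False
      using deriv_unit[OF int(1)] small[OF y] unfolding h by simp
  qed
qed

text \<open>An infinite set has cardinality 0, which every number divides; so finiteness must be
  known before the divisibility hypothesis yields any point.\<close>

lemma finite_torsion: "finite (ec_torsion curve)"
proof -
  define red where "red x = (SOME i. i \<in> {0..<int p} \<and> vge 1 (x - of_int i))" for x
  have red: "red x \<in> {0..<int p} \<and> vge 1 (x - of_int (red x))" if x: "vge 0 x" for x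
    unfolding red_def
  proof (rule someI_ex)
    obtain i where i: "vge 1 (x - of_int i)" using ex_int_approx[OF x] by blast
    have "vge 1 (of_int (i - i mod int p))"
      unfolding vge_1_of_int_iff by simp
    from vge_add[OF i this] have "vge 1 (x - of_int (i mod int p))" by simp
    moreover have "i mod int p \<in> {0..<int p}"
      using prime prime_gt_0_nat by simp
    ultimately show "\<exists>i. i \<in> {0..<int p} \<and> vge 1 (x - of_int i)" by blast
  qed
  define f where "f P = (case P of Infinity \<Rightarrow> None | Affine x y \<Rightarrow> Some (red x, red y))" for P
  have "inj_on f (ec_torsion curve)"
  proof (rule inj_onI)
    fix P Q assume PQ: "P \<in> ec_torsion curve" "Q \<in> ec_torsion curve" "f P = f Q"
    show "P = Q"
    proof (cases P; cases Q)
      fix x y x' y' assume eq: "P = Affine x y" "Q = Affine x' y'"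
      have r: "red x = red x'" "red y = red y'" using PQ(3) eq by (simp_all add: f_def)
      have "vge 1 (z - z')" if "vge 0 z" "vge 0 z'" "red z = red z'" for z z'
        using vge_diff[OF conjunct2[OF red[OF that(1)]] conjunct2[OF red[OF that(2)]]] that(3) by simp
      then show "P = Q"
        using torsion_congruent_eq[of x y x' y'] torsion_integral PQ eq r by simp
    qed (use PQ(3) in \<open>auto simp: f_def\<close>)
  qed
  moreover have "f ` ec_torsion curve \<subseteq> insert None (Some ` ({0..<int p} \<times> {0..<int p}))"
  proof
    fix z assume "z \<in> f ` ec_torsion curve"
    then obtain P where P: "P \<in> ec_torsion curve" "z = f P" by blast
    show "z \<in> insert None (Some ` ({0..<int p} \<times> {0..<int p}))"
      using P torsion_integral red by (cases P) (auto simp: f_def)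
  qed
  then have "finite (f ` ec_torsion curve)"
    by (rule finite_subset) simp
  ultimately show ?thesis
    by (simp add: finite_image_iff)
qed

text \<open>Cauchy's theorem, obtained from Sylow's with exponent 1; the cofactor \<open>m\<close>
  may still be divisible by \<open>q\<close>.\<close>

lemma ex_point_of_prime_order:
  assumes "prime q" "q dvd card (ec_torsion curve)"
  obtains x y where "Affine x y \<in> ec_torsion curve" "pow (Affine x y) q = Infinity"
proof -
  let ?T = "ec_group curve\<lparr>carrier := ec_torsion curve\<rparr>"
  interpret G: group "ec_group curve" by (rule group)
  have T: "group ?T"
    by (rule G.subgroup_imp_group[OF torsion_subgroup])
  obtain m where "card (ec_torsion curve) = q ^ 1 * m"
    using assms(2) by auto
  then obtain H where H: "subgroup H ?T" "card H = q"
    using sylow_thm[OF assms(1) T, of 1 m] finite_torsion by (auto simp: order_def)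
  interpret T: group ?T by (rule T)
  have HG: "subgroup H (ec_group curve)"
    using G.incl_subgroup[OF torsion_subgroup H(1)] .
  interpret H: group "ec_group curve\<lparr>carrier := H\<rparr>"
    by (rule G.subgroup_imp_group[OF HG])
  have "H \<noteq> {Infinity}"
    using H(2) prime_gt_1_nat[OF assms(1)] by auto
  moreover have "Infinity \<in> H"
    using subgroup.one_closed[OF HG] by (simp add: ec_group_def)
  ultimately obtain P where P: "P \<in> H" "P \<noteq> Infinity" by blast
  have "P [^]\<^bsub>ec_group curve\<lparr>carrier := H\<rparr>\<^esub> q = \<one>\<^bsub>ec_group curve\<^esub>"
    using H.pow_order_eq_1[of P] P H(2) by (simp add: order_def)
  then have "pow P q = Infinity"
    by (simp add: nat_pow_def ec_group_def)
  moreover have "P \<in> ec_torsion curve"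
    using P subgroup.subset[OF H(1)] by auto
  ultimately show ?thesis
    using that P(2) by (cases P) auto
qed

end

section \<open>Points modulo a prime\<close>

subsection \<open>Free actions of cyclic groups of prime order\<close>

text \<open>Every orbit has exactly \<open>q\<close> elements: if two of the first \<open>q\<close>
  iterates agree, some point is fixed by an iterate whose exponent is prime to \<open>q\<close>,
  hence by \<open>f\<close>.\<close>

lemma prime_dvd_card_free:
  assumes "finite A" and q: "prime q" and "f ` A \<subseteq> A"
    and period: "\<And>a. a \<in> A \<Longrightarrow> (f ^^ q) a = a" and free: "\<And>a. a \<in> A \<Longrightarrow> f a \<noteq> a"
  shows "q dvd card A"
proof -
  have mem: "(f ^^ i) a \<in> A" if "a \<in> A" for i a
    using assms(3) that by (induction i) auto
  have mult: "(f ^^ (m * n)) a = a" if "(f ^^ m) a = a" for m n a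
    using that by (induction n) (simp_all add: funpow_add)
  have mod: "(f ^^ (i mod q)) a = (f ^^ i) a" if "a \<in> A" for i a
  proof -
    have "(f ^^ i) a = (f ^^ (i mod q + q * (i div q))) a" by simp
    also have "\<dots> = (f ^^ (i mod q)) a"
      unfolding funpow_add using mult[OF period[OF that]] by simp
    finally show ?thesis ..
  qed
  define orb where "orb a = (\<lambda>i. (f ^^ i) a) ` {..<q}" for a
  have q0: "0 < q" using q prime_gt_0_nat by blast
  have orb_all: "(f ^^ i) a \<in> orb a" if "a \<in> A" for i a
    unfolding orb_def using mod[OF that, of i] q0 by (metis imageI lessThan_iff mod_less_divisor)
  have inj: "inj_on (\<lambda>i. (f ^^ i) a) {..<q}" if a: "a \<in> A" for a
  proof (rule linorder_inj_onI)
    fix i j assume ij: "i < j" "i \<in> {..<q}" "j \<in> {..<q}"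
    show "(f ^^ i) a \<noteq> (f ^^ j) a"
    proof
      assume eq: "(f ^^ i) a = (f ^^ j) a"
      define b where "b = (f ^^ i) a"
      have b: "b \<in> A" unfolding b_def by (rule mem[OF a])
      have "(f ^^ (j - i + i)) a = b" using eq ij(1) by (simp add: b_def)
      then have 1: "(f ^^ (j - i)) b = b" unfolding funpow_add b_def by simp
      have "coprime (j - i) q"
        using ij q by (metis coprime_commute diff_less gcd_nat.not_eq_order_implies_strict
            lessThan_iff less_imp_diff_less linorder_not_less nat_dvd_not_less prime_imp_coprime zero_less_diff)
      then obtain x where "[(j - i) * x = Suc 0] (mod q)"
        using cong_solve_coprime_nat by blast
      then have "((j - i) * x) mod q = 1 mod q" by (simp add: cong_def)
      then have "((j - i) * x) mod q = 1" using prime_gt_1_nat[OF q] by simp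
      then have "(f ^^ 1) b = b"
        using mod[OF b, of "(j - i) * x"] mult[OF 1, of x] by simp
      then show False using free[OF b] by simp
    qed
  qed auto
  have sub: "orb b \<subseteq> orb a" if a: "a \<in> A" and b: "b \<in> orb a" for a b
  proof
    fix c assume "c \<in> orb b"
    then obtain i j where "c = (f ^^ i) b" "b = (f ^^ j) a" using b by (auto simp: orb_def)
    then have "c = (f ^^ (i + j)) a" by (simp add: funpow_add)
    then show "c \<in> orb a" using orb_all[OF a] by simp
  qed
  have sym: "a \<in> orb b" if a: "a \<in> A" and b: "b \<in> orb a" for a b
  proof -
    obtain j where j: "b = (f ^^ j) a" "j < q" using b by (auto simp: orb_def)
    then have "(f ^^ (q - j)) b = (f ^^ (q - j + j)) a"
      by (simp only: funpow_add o_apply)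
    then have "(f ^^ (q - j)) b = a" using j(2) period[OF a] by simp
    then show ?thesis using orb_all[of b "q - j"] mem[OF a, of j] j(1) by simp
  qed
  have "q * card (orb ` A) = card (\<Union>(orb ` A))"
  proof (rule card_partition)
    have UA: "\<Union>(orb ` A) \<subseteq> A" using mem by (auto simp: orb_def)
    then show "finite (\<Union>(orb ` A))" using assms(1) finite_subset by blast
    show "card c = q" if "c \<in> orb ` A" for c
      using that inj by (auto simp: orb_def card_image)
    show "c1 \<inter> c2 = {}" if c: "c1 \<in> orb ` A" "c2 \<in> orb ` A" "c1 \<noteq> c2" for c1 c2
    proof (rule ccontr)
      assume "c1 \<inter> c2 \<noteq> {}"
      then obtain a b x where *: "a \<in> A" "b \<in> A" "c1 = orb a" "c2 = orb b" "x \<in> orb a" "x \<in> orb b"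
        using c by auto
      then have "orb x = orb a" "orb x = orb b"
        using sub sym mem UA by (metis UN_I subset_antisym subsetD)+
      then show False using c * by simp
    qed
  qed (use assms(1) in simp)
  moreover have "\<Union>(orb ` A) = A"
  proof (intro equalityI subsetI)
    fix a assume "a \<in> A"
    then show "a \<in> \<Union>(orb ` A)" using orb_all[of a 0] by auto
  qed (use mem in \<open>auto simp: orb_def\<close>)
  ultimately show ?thesis by (metis dvd_triv_left)
qed

subsection \<open>Translation by a point of order three or five\<close>

locale prime_modulus =
  fixes p :: int
  assumes p: "prime p"
begin

lemma p_pos: "0 < p"
  using p prime_gt_0_int by blast

lemma dvd_mult_cancel: "p dvd a * b \<Longrightarrow> \<not> p dvd a \<Longrightarrow> p dvd b"
  using p prime_dvd_multD by blast

lemma residue_eq: "a \<in> {0..<p} \<Longrightarrow> b \<in> {0..<p} \<Longrightarrow> p dvd a - b \<Longrightarrow> a = b"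
  by (metis atLeastLessThan_iff mod_eq_dvd_iff mod_pos_pos_trivial)

lemma ex_quotient:
  assumes "\<not> p dvd v"
  shows "\<exists>w. w \<in> {0..<p} \<and> p dvd v * w - c"
proof -
  have "coprime v p" using assms p prime_imp_coprime coprime_commute by blast
  then obtain i where i: "[v * i = 1] (mod p)" using cong_solve_coprime_int by blast
  have "[v * ((i * c) mod p) = v * i * c] (mod p)"
    unfolding mult.assoc by (intro cong_mult cong_refl cong_mod_leftI)
  also have "[v * i * c = 1 * c] (mod p)"
    by (intro cong_mult cong_refl i)
  finally have "p dvd v * ((i * c) mod p) - c"
    by (simp add: cong_iff_dvd_diff)
  then show ?thesis using p_pos by (intro exI[of _ "(i * c) mod p"]) simp
qed

end

text \<open>On \<open>y\<^sup>2 + a\<^sub>1xy + a\<^sub>3y = x\<^sup>3 + a\<^sub>2x\<^sup>2\<close> the origin is a point with tangent \<open>y = 0\<close>. If \<open>u\<close>, \<open>v\<close>,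
  \<open>w\<close> are the slopes \<open>y / x\<close> of a point and of its translates by one and two times the origin, then
  \<open>(u + v + a\<^sub>1) (a\<^sub>2 + uv) = a\<^sub>3\<close>, \<open>v (u + v + w + a\<^sub>1) = - a\<^sub>2\<close> and \<open>x = u (u + v + a\<^sub>1)\<close>.
  So translation is the map \<open>(u, v) \<mapsto> (v, w)\<close>.\<close>

locale slope_pairs = prime_modulus +
  fixes \<alpha>\<^sub>1 \<alpha>\<^sub>2 \<alpha>\<^sub>3 :: int
  assumes a3: "\<not> p dvd \<alpha>\<^sub>3"
    and smooth: "\<And>u. p dvd 3 * u^2 + \<alpha>\<^sub>1 * u + \<alpha>\<^sub>2 \<Longrightarrow> p dvd (2 * u + \<alpha>\<^sub>1) * (\<alpha>\<^sub>2 + u^2) - \<alpha>\<^sub>3 \<Longrightarrow> False"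
begin

definition relation :: "int \<Rightarrow> int \<Rightarrow> int" where
  "relation u v = (u + v + \<alpha>\<^sub>1) * (\<alpha>\<^sub>2 + u * v) - \<alpha>\<^sub>3"

text \<open>When the origin has order 3 or 5, the points left out by requiring nonzero slopes are
  its multiples.\<close>

definition pairs :: "(int \<times> int) set" where
  "pairs = {(u, v). u \<in> {0..<p} \<and> v \<in> {0..<p} \<and> \<not> p dvd u \<and> \<not> p dvd v \<and> p dvd relation u v}"

definition next_slope :: "int \<Rightarrow> int \<Rightarrow> int" where
  "next_slope u v = (SOME w. w \<in> {0..<p} \<and> p dvd v * (u + v + w + \<alpha>\<^sub>1) + \<alpha>\<^sub>2)"

definition translate :: "int \<times> int \<Rightarrow> int \<times> int" where
  "translate = (\<lambda>(u, v). (v, next_slope u v))"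

lemma finite_pairs: "finite pairs"
  by (rule finite_subset[of _ "{0..<p} \<times> {0..<p}"]) (auto simp: pairs_def)

lemma next_slope:
  assumes "\<not> p dvd v"
  shows "next_slope u v \<in> {0..<p}" "p dvd v * (u + v + next_slope u v + \<alpha>\<^sub>1) + \<alpha>\<^sub>2"
proof -
  obtain w where "w \<in> {0..<p}" "p dvd v * w - (- \<alpha>\<^sub>2 - v * (u + v + \<alpha>\<^sub>1))"
    using ex_quotient[OF assms] by blast
  then have "w \<in> {0..<p} \<and> p dvd v * (u + v + w + \<alpha>\<^sub>1) + \<alpha>\<^sub>2"
    by (simp add: algebra_simps)
  then have "next_slope u v \<in> {0..<p} \<and> p dvd v * (u + v + next_slope u v + \<alpha>\<^sub>1) + \<alpha>\<^sub>2"
    unfolding next_slope_def by (rule someI)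
  then show "next_slope u v \<in> {0..<p}" "p dvd v * (u + v + next_slope u v + \<alpha>\<^sub>1) + \<alpha>\<^sub>2"
    by blast+
qed

lemma slopes_product:
  assumes "p dvd relation u v" "p dvd v * (u + v + w + \<alpha>\<^sub>1) + \<alpha>\<^sub>2"
  shows "p dvd u * v * w - (\<alpha>\<^sub>2 * v + \<alpha>\<^sub>1 * \<alpha>\<^sub>2 - \<alpha>\<^sub>3)"
proof -
  have "u * v * w - (\<alpha>\<^sub>2 * v + \<alpha>\<^sub>1 * \<alpha>\<^sub>2 - \<alpha>\<^sub>3) = u * (v * (u + v + w + \<alpha>\<^sub>1) + \<alpha>\<^sub>2) - relation u v"
    by (simp add: relation_def algebra_simps)
  then show ?thesis using assms by simp
qed

lemma relation_next:
  assumes "\<not> p dvd v" "p dvd relation u v" "p dvd v * (u + v + w + \<alpha>\<^sub>1) + \<alpha>\<^sub>2"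
  shows "p dvd relation v w"
proof -
  have "v * relation v w = (v * (u + v + w + \<alpha>\<^sub>1) + \<alpha>\<^sub>2) * (v * w - u * v) + v * relation u v"
    by (simp add: relation_def algebra_simps)
  then have "p dvd v * relation v w" using assms by simp
  then show ?thesis using dvd_mult_cancel assms(1) by blast
qed

lemma translate_mem:
  assumes uv: "(u, v) \<in> pairs" and w: "\<not> p dvd next_slope u v"
  shows "translate (u, v) \<in> pairs"
  using assms next_slope[of v u] relation_next[of v u "next_slope u v"]
  by (simp add: pairs_def translate_def)

text \<open>A fixed pair has three equal consecutive slopes, which \<open>smooth\<close> excludes;
  the point it describes would be singular.\<close>

lemma translate_ne:
  assumes "(u, v) \<in> pairs"
  shows "translate (u, v) \<noteq> (u, v)"
proof
  assume "translate (u, v) = (u, v)"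
  then have "v = u" "next_slope u u = u" by (auto simp: translate_def)
  then have "p dvd u * (u + u + u + \<alpha>\<^sub>1) + \<alpha>\<^sub>2" "p dvd relation u u"
    using next_slope(2)[of u u] assms by (simp_all add: pairs_def)
  then show False
    using smooth[of u] by (simp add: relation_def algebra_simps power2_eq_square)
qed

text \<open>If \<open>\<alpha>\<^sub>2\<close> vanishes modulo \<open>p\<close>, three consecutive
  slopes have the constant sum \<open>- \<alpha>\<^sub>1\<close>, so the fourth slope is the
  first.\<close>

lemma three_dvd_card_pairs:
  assumes a2: "p dvd \<alpha>\<^sub>2"
  shows "3 dvd card pairs"
proof (rule prime_dvd_card_free[OF finite_pairs])
  have w: "\<not> p dvd next_slope u v" if uv: "(u, v) \<in> pairs" for u v
  proof
    assume "p dvd next_slope u v"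
    moreover have "p dvd u * v * next_slope u v - (\<alpha>\<^sub>2 * v + \<alpha>\<^sub>1 * \<alpha>\<^sub>2 - \<alpha>\<^sub>3)"
      using uv next_slope(2)[of v u] by (intro slopes_product) (auto simp: pairs_def)
    ultimately have "p dvd \<alpha>\<^sub>2 * v + \<alpha>\<^sub>1 * \<alpha>\<^sub>2 - \<alpha>\<^sub>3"
      by (metis dvd_diff_commute dvd_diff_right_iff dvd_mult)
    from dvd_diff[OF dvd_mult2[OF a2, of "v + \<alpha>\<^sub>1"] this] have "p dvd \<alpha>\<^sub>3"
      by (simp add: algebra_simps)
    then show False using a3 by simp
  qed
  have sum: "p dvd u + v + next_slope u v + \<alpha>\<^sub>1" if "(u, v) \<in> pairs" for u v
  proof -
    have v: "\<not> p dvd v" using that by (simp add: pairs_def)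
    have "p dvd v * (u + v + next_slope u v + \<alpha>\<^sub>1)"
      using next_slope(2)[OF v] a2 by (metis dvd_add_left_iff)
    then show ?thesis using dvd_mult_cancel v by blast
  qed
  show mem: "translate ` pairs \<subseteq> pairs"
    using translate_mem w by auto
  show "translate a \<noteq> a" if "a \<in> pairs" for a
    using translate_ne that by (cases a) simp
  show "(translate ^^ 3) a = a" if "a \<in> pairs" for a
  proof -
    obtain u v where a: "a = (u, v)" by (cases a)
    define w where "w = next_slope u v"
    have uv: "(u, v) \<in> pairs" using that a by simp
    have vw: "(v, w) \<in> pairs" using translate_mem[OF uv w[OF uv]] by (simp add: translate_def w_def)
    have wu: "(w, next_slope v w) \<in> pairs"
      using translate_mem[OF vw w[OF vw]] by (simp add: translate_def)
    have "p dvd (v + w + next_slope v w + \<alpha>\<^sub>1) - (u + v + w + \<alpha>\<^sub>1)"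
      using sum[OF vw] sum[OF uv] unfolding w_def by (rule dvd_diff)
    then have 1: "next_slope v w = u"
      using wu uv by (intro residue_eq) (auto simp: pairs_def)
    have "(w, u) \<in> pairs" using wu 1 by simp
    then have "p dvd (w + u + next_slope w u + \<alpha>\<^sub>1) - (u + v + w + \<alpha>\<^sub>1)"
      using sum[of w u] sum[OF uv] unfolding w_def by (intro dvd_diff)
    moreover have "next_slope w u \<in> {0..<p}"
      using uv by (intro next_slope) (simp add: pairs_def)
    ultimately have "next_slope w u = v"
      using uv by (intro residue_eq) (auto simp: pairs_def algebra_simps)
    then show ?thesis
      by (simp add: a translate_def numeral_3_eq_3 1 flip: w_def)
  qed
qed simp

text \<open>The relation says that the origin has order 5. It makes the product of five consecutive
  slopes the constant \<open>- \<alpha>\<^sub>2 * \<kappa>\<close>, so the sixth slope is the first;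
  \<open>\<kappa>\<close> is the ordinate of twice the origin.\<close>

lemma five_dvd_card_pairs:
  assumes a2: "\<not> p dvd \<alpha>\<^sub>2" and rel: "p dvd \<alpha>\<^sub>3^2 - \<alpha>\<^sub>1 * \<alpha>\<^sub>2 * \<alpha>\<^sub>3 + \<alpha>\<^sub>2^3"
  shows "5 dvd card pairs"
proof (rule prime_dvd_card_free[OF finite_pairs])
  define \<kappa> where "\<kappa> = \<alpha>\<^sub>1 * \<alpha>\<^sub>2 - \<alpha>\<^sub>3"
  have k: "p dvd \<alpha>\<^sub>2^3 - \<kappa> * \<alpha>\<^sub>3"
    using rel by (simp add: \<kappa>_def algebra_simps power2_eq_square)
  have k0: "\<not> p dvd \<kappa>"
  proof
    assume "p dvd \<kappa>"
    then have "p dvd (\<alpha>\<^sub>2^3 - \<kappa> * \<alpha>\<^sub>3) + \<kappa> * \<alpha>\<^sub>3" using k by (intro dvd_add) auto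
    then show False using a2 p prime_dvd_power by auto
  qed
  have prod: "p dvd u * v * next_slope u v - (\<alpha>\<^sub>2 * v + \<kappa>)" if uv: "(u, v) \<in> pairs" for u v
    using slopes_product[of u v "next_slope u v"] uv next_slope(2)[of v u]
    by (simp add: pairs_def \<kappa>_def algebra_simps)
  have w: "\<not> p dvd next_slope u v" if uv: "(u, v) \<in> pairs" for u v
  proof
    assume w: "p dvd next_slope u v"
    then have 1: "p dvd \<alpha>\<^sub>2 * v + \<kappa>"
      using prod[OF uv] by (metis dvd_diff_commute dvd_diff_right_iff dvd_mult)
    have 2: "p dvd v * (u + v + next_slope u v + \<alpha>\<^sub>1) + \<alpha>\<^sub>2"
      using uv by (intro next_slope) (simp add: pairs_def)
    have "\<alpha>\<^sub>2^2 * (u * v) = \<alpha>\<^sub>2^2 * (v * (u + v + next_slope u v + \<alpha>\<^sub>1) + \<alpha>\<^sub>2)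
        - \<alpha>\<^sub>2^2 * v * next_slope u v
        - (\<alpha>\<^sub>2 * v + \<kappa>) * (\<alpha>\<^sub>2 * v - \<kappa> + \<alpha>\<^sub>1 * \<alpha>\<^sub>2) - (\<alpha>\<^sub>2^3 - \<kappa> * \<alpha>\<^sub>3)"
      by (simp add: \<kappa>_def algebra_simps power_numeral_reduce)
    also have "p dvd \<dots>"
      by (rule dvd_diff[OF dvd_diff[OF dvd_diff[OF dvd_mult[OF 2] dvd_mult[OF w]] dvd_mult2[OF 1]] k])
    finally have "p dvd \<alpha>\<^sub>2^2 * (u * v)" .
    then show False
      using uv a2 p by (auto simp: pairs_def prime_dvd_mult_iff prime_dvd_power_iff)
  qed
  have mem: "translate a \<in> pairs" if "a \<in> pairs" for a
    using translate_mem w that by (cases a) auto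
  then show "translate ` pairs \<subseteq> pairs" by auto
  show "translate a \<noteq> a" if "a \<in> pairs" for a
    using translate_ne that by (cases a) simp
  have quad: "p dvd (\<alpha>\<^sub>2 * u + \<kappa>) * (\<alpha>\<^sub>2 * w + \<kappa>) + \<alpha>\<^sub>2 * \<kappa> * v"
    if uv: "(u, v) \<in> pairs" and "w = next_slope u v" for u v w
  proof -
    have v: "\<not> p dvd v" using uv by (simp add: pairs_def)
    have s: "p dvd v * (u + v + w + \<alpha>\<^sub>1) + \<alpha>\<^sub>2" "p dvd u * v * w - (\<alpha>\<^sub>2 * v + \<kappa>)"
      using next_slope(2)[OF v] prod[OF uv] that(2) by simp_all
    have "v * ((\<alpha>\<^sub>2 * u + \<kappa>) * (\<alpha>\<^sub>2 * w + \<kappa>) + \<alpha>\<^sub>2 * \<kappa> * v)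
        = \<alpha>\<^sub>2^2 * (u * v * w - (\<alpha>\<^sub>2 * v + \<kappa>)) + \<alpha>\<^sub>2 * \<kappa> * (v * (u + v + w + \<alpha>\<^sub>1) + \<alpha>\<^sub>2)
          + v * (\<alpha>\<^sub>2^3 - \<kappa> * \<alpha>\<^sub>3)"
      by (simp add: \<kappa>_def algebra_simps power_numeral_reduce)
    also have "p dvd \<dots>"
      by (rule dvd_add[OF dvd_add[OF dvd_mult[OF s(2)] dvd_mult[OF s(1)]] dvd_mult[OF k]])
    finally show ?thesis using dvd_mult_cancel v by blast
  qed
  have five: "p dvd a * b * c * d * e + \<alpha>\<^sub>2 * \<kappa>"
    if ab: "(a, b) \<in> pairs" "c = next_slope a b" "d = next_slope b c" "e = next_slope c d" for a b c d e
  proof -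
    have bc: "(b, c) \<in> pairs" using mem[OF ab(1)] ab(2) by (simp add: translate_def)
    have cd: "(c, d) \<in> pairs" using mem[OF bc] ab(3) by (simp add: translate_def)
    have c: "\<not> p dvd c" using cd by (simp add: pairs_def)
    \<comment> \<open>After multiplication by the middle slope, the two outer triples are rewritten
      by \<open>prod\<close> and the middle triple by \<open>quad\<close>.\<close>
    have "c * (a * b * c * d * e + \<alpha>\<^sub>2 * \<kappa>) =
      (a * b * c - (\<alpha>\<^sub>2 * b + \<kappa>)) * (c * d * e) + (\<alpha>\<^sub>2 * b + \<kappa>) * (c * d * e - (\<alpha>\<^sub>2 * d + \<kappa>))
      + ((\<alpha>\<^sub>2 * b + \<kappa>) * (\<alpha>\<^sub>2 * d + \<kappa>) + \<alpha>\<^sub>2 * \<kappa> * c)"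
      by (simp add: algebra_simps)
    also have "p dvd \<dots>"
      using prod[OF ab(1), folded ab(2)] prod[OF cd, folded ab(4)] quad[OF bc ab(3)]
      by (rule dvd_add[OF dvd_add[OF dvd_mult2 dvd_mult]])
    finally show ?thesis using dvd_mult_cancel c by blast
  qed
  have sixth: "next_slope d e = a"
    if ab: "(a, b) \<in> pairs" "c = next_slope a b" "d = next_slope b c" "e = next_slope c d" for a b c d e
  proof -
    have bc: "(b, c) \<in> pairs" using mem[OF ab(1)] ab(2) by (simp add: translate_def)
    have cd: "(c, d) \<in> pairs" using mem[OF bc] ab(3) by (simp add: translate_def)
    have de: "(d, e) \<in> pairs" using mem[OF cd] ab(4) by (simp add: translate_def)
    let ?f = "next_slope d e"
    have "p dvd (b * c * d * e * ?f + \<alpha>\<^sub>2 * \<kappa>) - (a * b * c * d * e + \<alpha>\<^sub>2 * \<kappa>)"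
      using five[OF bc ab(3,4) refl] five[OF ab] by (rule dvd_diff)
    then have "p dvd (b * c * d * e) * (?f - a)" by (simp add: algebra_simps)
    moreover have "\<not> p dvd b * c * d * e"
      using bc cd de p by (simp add: pairs_def prime_dvd_mult_iff)
    ultimately have "p dvd ?f - a" using dvd_mult_cancel by blast
    then show ?thesis
      using next_slope(1)[of e d] de ab(1) by (intro residue_eq) (auto simp: pairs_def)
  qed
  show "(translate ^^ 5) z = z" if "z \<in> pairs" for z
  proof -
    obtain a b where z: "z = (a, b)" by (cases z)
    define c where "c = next_slope a b"
    define d where "d = next_slope b c"
    define e where "e = next_slope c d"
    have ab: "(a, b) \<in> pairs" using that z by simp
    have bc: "(b, c) \<in> pairs" using mem[OF ab] by (simp add: translate_def c_def)
    have 1: "next_slope d e = a" by (rule sixth[OF ab c_def d_def e_def])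
    have 2: "next_slope e a = b" by (rule sixth[OF bc d_def e_def 1[symmetric]])
    have "(translate ^^ 5) z = translate (translate (translate (translate (translate z))))"
      by (simp add: eval_nat_numeral)
    then show ?thesis
      by (simp add: z translate_def c_def[symmetric] d_def[symmetric] e_def[symmetric] 1 2)
  qed
qed simp

end

subsection \<open>Counting points modulo a prime\<close>

definition affine_points :: "int \<Rightarrow> int weierstrass \<Rightarrow> (int \<times> int) set" where
  "affine_points p W = {(x, y). x \<in> {0..<p} \<and> y \<in> {0..<p} \<and> [weierstrass_poly W x y = 0] (mod p)}"

lemma num_points_mod_eq: "num_points_mod E p = 1 + card (affine_points (int p) (minimal_model p E))"
  by (simp add: num_points_mod_def affine_points_def)

lemma finite_affine_points: "finite (affine_points p W)"
  by (rule finite_subset[of _ "{0..<p} \<times> {0..<p}"]) (auto simp: affine_points_def)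

lemma weierstrass_poly_cong:
  fixes W :: "int weierstrass"
  assumes "[x = x'] (mod p)" "[y = y'] (mod p)"
  shows "[weierstrass_poly W x y = weierstrass_poly W x' y'] (mod p)"
  unfolding weierstrass_poly_def by (intro cong_diff cong_add cong_mult cong_pow cong_refl assms)

text \<open>The substitution with \<open>u = 1\<close>: it moves the point \<open>(r, t)\<close> to
  the origin and the line of slope \<open>s\<close> through it to the axis
  \<open>y = 0\<close>.\<close>

definition shift :: "'a::comm_ring_1 \<Rightarrow> 'a \<Rightarrow> 'a \<Rightarrow> 'a weierstrass \<Rightarrow> 'a weierstrass" where
  "shift r s t W = Weierstrass (a\<^sub>1 W + 2 * s) (a\<^sub>2 W - s * a\<^sub>1 W + 3 * r - s^2)
     (a\<^sub>3 W + r * a\<^sub>1 W + 2 * t)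
     (a\<^sub>4 W - s * a\<^sub>3 W + 2 * r * a\<^sub>2 W - (t + r * s) * a\<^sub>1 W + 3 * r^2 - 2 * s * t)
     (a\<^sub>6 W + r * a\<^sub>4 W + r^2 * a\<^sub>2 W + r^3 - t * a\<^sub>3 W - t^2 - r * t * a\<^sub>1 W)"

lemma ec_change_shift: "ec_change 1 r s t W (shift r s t W)"
  by (simp add: ec_change_def shift_def)

lemma discriminant_shift: "discriminant (shift r s t W) = discriminant W"
  using discriminant_change[OF ec_change_shift, of r s t W] by simp

lemma dvd_discriminant:
  fixes W :: "'a::comm_ring_1 weierstrass"
  assumes "p dvd a\<^sub>3 W" "p dvd a\<^sub>4 W" "p dvd a\<^sub>6 W"
  shows "p dvd discriminant W"
proof -
  have "p dvd b\<^sub>4 W" "p dvd b\<^sub>6 W" "p dvd b\<^sub>8 W"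
    using assms by (auto simp: b\<^sub>4_def b\<^sub>6_def b\<^sub>8_def power2_eq_square intro!: dvd_add dvd_diff)
  then show ?thesis
    by (auto simp: discriminant_def power2_eq_square power3_eq_cube intro!: dvd_add dvd_diff)
qed

text \<open>Once the point is moved to the origin, the value and the partial derivatives of the
  equation become, up to sign, the coefficients \<open>a\<^sub>6\<close>, \<open>a\<^sub>3\<close>
  and \<open>a\<^sub>4\<close>.\<close>

lemma no_singular_point:
  fixes W :: "int weierstrass"
  assumes "\<not> p dvd discriminant W" "p dvd weierstrass_poly W x y"
    "p dvd 2 * y + a\<^sub>1 W * x + a\<^sub>3 W" "p dvd a\<^sub>1 W * y - 3 * x^2 - 2 * a\<^sub>2 W * x - a\<^sub>4 W"
  shows False
proof -
  let ?V = "shift x 0 y W"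
  have "a\<^sub>3 ?V = 2 * y + a\<^sub>1 W * x + a\<^sub>3 W" "a\<^sub>6 ?V = - weierstrass_poly W x y"
    "a\<^sub>4 ?V = - (a\<^sub>1 W * y - 3 * x^2 - 2 * a\<^sub>2 W * x - a\<^sub>4 W)"
    by (simp_all add: shift_def weierstrass_poly_def algebra_simps)
  then have "p dvd discriminant ?V"
    using assms by (intro dvd_discriminant) (simp_all only: dvd_minus_iff)
  then show False
    using assms(1) by (simp add: discriminant_shift)
qed

section \<open>Changes of variables and parity of point counts\<close>

context prime_modulus
begin

lemma affine_points_iff:
  "(x, y) \<in> affine_points p W \<longleftrightarrow>
    x \<in> {0..<p} \<and> y \<in> {0..<p} \<and> p dvd weierstrass_poly W x y"
  by (simp add: affine_points_def cong_0_iff)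

lemma mod_affine_points:
  assumes "p dvd weierstrass_poly W x y"
  shows "(x mod p, y mod p) \<in> affine_points p W"
proof -
  have "[weierstrass_poly W (x mod p) (y mod p) = weierstrass_poly W x y] (mod p)"
    by (intro weierstrass_poly_cong) (simp_all add: cong_def)
  then show ?thesis
    using assms p_pos by (simp add: affine_points_iff cong_dvd_iff)
qed

lemma card_affine_points_change:
  assumes ch: "ec_change u r s t E E'" and u: "\<not> p dvd u"
  shows "card (affine_points p E) = card (affine_points p E')"
proof -
  define f where "f = (\<lambda>(x, y). ((u^2 * x + r) mod p, (u^3 * y + u^2 * s * x + t) mod p))"
  have un: "\<not> p dvd u ^ n" for n
    using u p prime_dvd_power by blast
  have "inj_on f (affine_points p E')"
  proof (rule inj_onI, clarify)
    fix x y x' y'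
    assume *: "(x, y) \<in> affine_points p E'" "(x', y') \<in> affine_points p E'" "f (x, y) = f (x', y')"
    have "p dvd (u^2 * x + r) - (u^2 * x' + r)"
      using *(3) by (simp add: f_def mod_eq_dvd_iff)
    then have "p dvd u^2 * (x - x')" by (simp add: algebra_simps)
    then have "p dvd x - x'" by (rule dvd_mult_cancel[OF _ un])
    then have x: "x = x'"
      using * by (intro residue_eq) (auto simp: affine_points_iff)
    have "p dvd (u^3 * y + u^2 * s * x + t) - (u^3 * y' + u^2 * s * x' + t)"
      using *(3) by (simp add: f_def mod_eq_dvd_iff)
    then have "p dvd u^3 * (y - y')" by (simp add: x algebra_simps)
    then have "p dvd y - y'" by (rule dvd_mult_cancel[OF _ un])
    then have "y = y'"
      using * by (intro residue_eq) (auto simp: affine_points_iff)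
    with x show "x = x' \<and> y = y'" by simp
  qed
  moreover have "f ` affine_points p E' = affine_points p E"
  proof (intro equalityI subsetI)
    fix z assume "z \<in> f ` affine_points p E'"
    then obtain x y where xy: "(x, y) \<in> affine_points p E'" "z = f (x, y)" by auto
    have "p dvd weierstrass_poly E (u^2 * x + r) (u^3 * y + u^2 * s * x + t)"
      using xy(1) by (simp add: affine_points_iff weierstrass_poly_change[OF ch])
    then show "z \<in> affine_points p E"
      unfolding xy(2) f_def prod.case by (rule mod_affine_points)
  next
    fix z assume z: "z \<in> affine_points p E"
    obtain X Y where XY: "z = (X, Y)" by (cases z)
    obtain x where x: "x \<in> {0..<p}" "p dvd u^2 * x - (X - r)" using ex_quotient[OF un] by blast
    obtain y where y: "y \<in> {0..<p}" "p dvd u^3 * y - (Y - t - u^2 * s * x)"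
      using ex_quotient[OF un] by blast
    have X: "[u^2 * x + r = X] (mod p)" and Y: "[u^3 * y + u^2 * s * x + t = Y] (mod p)"
      using x(2) y(2) by (simp_all add: cong_iff_dvd_diff algebra_simps)
    have fz: "f (x, y) = z"
      using X Y z by (simp add: f_def XY affine_points_iff cong_def)
    have "[u^6 * weierstrass_poly E' x y = weierstrass_poly E X Y] (mod p)"
      unfolding weierstrass_poly_change[OF ch, symmetric] by (rule weierstrass_poly_cong[OF X Y])
    then have "p dvd u^6 * weierstrass_poly E' x y"
      using z by (simp add: XY affine_points_iff cong_dvd_iff)
    then have "p dvd weierstrass_poly E' x y" by (rule dvd_mult_cancel[OF _ un])
    then have "(x, y) \<in> affine_points p E'"
      using x y by (simp add: affine_points_iff)
    then show "z \<in> f ` affine_points p E'" using fz imageI by metis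
  qed
  ultimately show ?thesis
    by (metis card_image)
qed

text \<open>Points with \<open>y \<noteq> 0\<close> are paired by \<open>y \<mapsto> - y\<close>,
  those with \<open>y = 0\<close> and \<open>x \<noteq> 0\<close> by exchanging the other two roots
  of the cubic. The origin and the point at infinity remain.\<close>

lemma card_affine_points_two:
  assumes W: "a\<^sub>1 W = 0" "a\<^sub>3 W = 0" "p dvd a\<^sub>6 W" and disc: "\<not> p dvd discriminant W"
  shows "2 dvd 1 + card (affine_points p W)"
proof -
  define A where "A = {z \<in> affine_points p W. snd z \<noteq> 0}"
  define B where "B = {z \<in> affine_points p W. snd z = 0 \<and> fst z \<noteq> 0}"
  have poly: "weierstrass_poly W x y = y^2 - x * (x^2 + a\<^sub>2 W * x + a\<^sub>4 W) - a\<^sub>6 W" for x y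
    using W by (simp add: weierstrass_poly_def algebra_simps power2_eq_square power3_eq_cube)
  \<comment> \<open>With \<open>a\<^sub>1 = a\<^sub>3 = 0\<close> the discriminant is even, so
    \<open>p\<close> is odd; this makes the first pairing free of fixed points.\<close>
  have odd: "\<not> p dvd 2"
  proof
    assume "p dvd 2"
    then have "p dvd 2 * (- (8 * (a\<^sub>2 W)^2 * b\<^sub>8 W) - 4 * (b\<^sub>4 W)^3 - 27 * 8 * (a\<^sub>6 W)^2
        + 9 * 8 * a\<^sub>2 W * b\<^sub>4 W * a\<^sub>6 W)"
      by (rule dvd_mult2)
    also have "\<dots> = discriminant W"
      using W by (simp add: discriminant_def b\<^sub>2_def b\<^sub>6_def algebra_simps power2_eq_square)
    finally show False
      using disc by contradiction
  qed
  have A: "2 dvd card A"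
  proof (rule prime_dvd_card_free)
    let ?f = "\<lambda>(x, y). (x, p - y)"
    show "finite A" by (simp add: A_def finite_affine_points)
    show "?f ` A \<subseteq> A"
    proof (clarify)
      fix x y assume "(x, y) \<in> A"
      then have xy: "x \<in> {0..<p}" "y \<in> {0..<p}" "y \<noteq> 0" "p dvd weierstrass_poly W x y"
        by (auto simp: A_def affine_points_iff)
      have "weierstrass_poly W x (p - y) = weierstrass_poly W x y + p * (p - 2 * y)"
        by (simp add: poly algebra_simps power2_eq_square)
      then have "p dvd weierstrass_poly W x (p - y)" using xy(4) by simp
      then show "(x, p - y) \<in> A"
        using xy by (simp add: A_def affine_points_iff)
    qed
    show "(?f ^^ 2) z = z" for z
      by (cases z) (simp add: numeral_2_eq_2)
    show "?f z \<noteq> z" if "z \<in> A" for z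
    proof
      assume "?f z = z"
      then obtain x y where z: "z = (x, y)" "p = 2 * y" by (cases z) auto
      then have "p dvd 2 * y" by simp
      then have "p dvd y" by (rule dvd_mult_cancel[OF _ odd])
      then show False using that z by (auto simp: A_def affine_points_iff dest: zdvd_imp_le)
    qed
  qed simp
  have B: "2 dvd card B"
  proof (rule prime_dvd_card_free)
    let ?f = "\<lambda>(x, y :: int). ((- a\<^sub>2 W - x) mod p, y)"
    have root: "p dvd x^2 + a\<^sub>2 W * x + a\<^sub>4 W \<and> x \<in> {0..<p} \<and> y = 0 \<and> \<not> p dvd x"
      if "(x, y) \<in> B" for x y
    proof -
      have xy: "x \<in> {0..<p}" "x \<noteq> 0" "y = 0" "p dvd weierstrass_poly W x y"
        using that by (auto simp: B_def affine_points_iff)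
      have nx: "\<not> p dvd x" using xy by (auto dest: zdvd_imp_le)
      have "x * (x^2 + a\<^sub>2 W * x + a\<^sub>4 W) = - weierstrass_poly W x y - a\<^sub>6 W"
        using xy(3) by (simp add: poly)
      also have "p dvd \<dots>" using xy(4) W(3) by (intro dvd_diff) simp_all
      finally have "p dvd x^2 + a\<^sub>2 W * x + a\<^sub>4 W" by (rule dvd_mult_cancel[OF _ nx])
      then show ?thesis using nx xy by simp
    qed
    show "finite B" by (simp add: B_def finite_affine_points)
    show "?f ` B \<subseteq> B"
    proof (clarify)
      fix x y assume "(x, y) \<in> B"
      from root[OF this] have r: "p dvd x^2 + a\<^sub>2 W * x + a\<^sub>4 W" "x \<in> {0..<p}" "y = 0" "\<not> p dvd x"
        by auto
      let ?x = "- a\<^sub>2 W - x"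
      have "weierstrass_poly W ?x 0 = - (?x * (x^2 + a\<^sub>2 W * x + a\<^sub>4 W)) - a\<^sub>6 W"
        by (simp add: poly algebra_simps power2_eq_square)
      also have "p dvd \<dots>" using r(1) W(3) by (intro dvd_diff) simp_all
      finally have "(?x mod p, 0 mod p) \<in> affine_points p W" by (rule mod_affine_points)
      moreover have "?x mod p \<noteq> 0"
      proof
        assume "?x mod p = 0"
        then have "p dvd ?x" by (simp only: dvd_eq_mod_eq_0)
        then have "p dvd x^2 + a\<^sub>2 W * x + a\<^sub>4 W + ?x * x"
          by (rule dvd_add[OF r(1) dvd_mult2])
        then have "p dvd a\<^sub>4 W" by (simp add: algebra_simps power2_eq_square)
        then show False using dvd_discriminant[of p W] W disc by simp
      qed
      ultimately show "(?x mod p, y) \<in> B" using r(3) by (simp add: B_def)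
    qed
    show "(?f ^^ 2) z = z" if "z \<in> B" for z
    proof -
      obtain x y where z: "z = (x, y)" by (cases z)
      have "(- a\<^sub>2 W - (- a\<^sub>2 W - x) mod p) mod p = x mod p"
        by (simp add: mod_diff_right_eq)
      also have "\<dots> = x" using root[of x y] that z by simp
      finally show ?thesis by (simp add: z numeral_2_eq_2)
    qed
    show "?f z \<noteq> z" if "z \<in> B" for z
    proof
      assume fz: "?f z = z"
      obtain x y where z: "z = (x, y)" by (cases z)
      from fz have "(- a\<^sub>2 W - x) mod p = x" by (simp add: z)
      then have "p dvd (- a\<^sub>2 W - x) - x" by (metis dvd_minus_mod)
      then have 2: "p dvd 2 * x + a\<^sub>2 W"
        using dvd_minus_iff[of p "2 * x + a\<^sub>2 W"] by (simp add: algebra_simps)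
      have r: "p dvd x^2 + a\<^sub>2 W * x + a\<^sub>4 W" using root[of x y] that z by simp
      show False
      proof (rule no_singular_point[OF disc, of x 0])
        show "p dvd weierstrass_poly W x 0"
          using r W(3) by (simp add: poly)
        have "a\<^sub>1 W * 0 - 3 * x^2 - 2 * a\<^sub>2 W * x - a\<^sub>4 W
            = - (x^2 + a\<^sub>2 W * x + a\<^sub>4 W) - x * (2 * x + a\<^sub>2 W)"
          by (simp add: algebra_simps power2_eq_square)
        also have "p dvd \<dots>"
          by (rule dvd_diff[OF _ dvd_mult[OF 2]]) (simp only: dvd_minus_iff r)
        finally show "p dvd a\<^sub>1 W * 0 - 3 * x^2 - 2 * a\<^sub>2 W * x - a\<^sub>4 W" .
      qed (simp add: W)
    qed
  qed simp
  have "affine_points p W = insert (0, 0) (A \<union> B)"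
  proof -
    have "(0, 0) \<in> affine_points p W"
      using W(3) p_pos by (simp add: affine_points_iff poly)
    then show ?thesis
      by (auto simp: A_def B_def)
  qed
  moreover have "card (insert (0, 0) (A \<union> B)) = Suc (card A + card B)"
  proof -
    have "finite A" "finite B" "A \<inter> B = {}" "(0, 0) \<notin> A \<union> B"
      by (auto simp: A_def B_def finite_affine_points)
    then show ?thesis by (simp add: card_Un_disjoint)
  qed
  ultimately show ?thesis using A B by simp
qed

end

section \<open>Equations with a given point and tangent moved to the origin\<close>

locale normal_form = prime_modulus +
  fixes W :: "int weierstrass"
  assumes a4: "p dvd a\<^sub>4 W" and a6: "p dvd a\<^sub>6 W" and disc: "\<not> p dvd discriminant W"
begin

text \<open>At the point of slope \<open>u\<close> and abscissa
  \<open>u * (u + v + a\<^sub>1 W)\<close> the equation becomes a multiple of the relation between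
  slopes, up to terms that vanish modulo \<open>p\<close>.\<close>

lemma poly_slope:
  "weierstrass_poly W (u * (u + v + a\<^sub>1 W)) (u * (u * (u + v + a\<^sub>1 W))) =
    - (u * (u * (u + v + a\<^sub>1 W))) * ((u + v + a\<^sub>1 W) * (a\<^sub>2 W + u * v) - a\<^sub>3 W)
    - a\<^sub>4 W * (u * (u + v + a\<^sub>1 W)) - a\<^sub>6 W"
  by (simp add: weierstrass_poly_def algebra_simps power2_eq_square power3_eq_cube)

lemma a3: "\<not> p dvd a\<^sub>3 W"
  using dvd_discriminant[of p W] a4 a6 disc by blast

sublocale slope_pairs p "a\<^sub>1 W" "a\<^sub>2 W" "a\<^sub>3 W"
proof
  fix u
  assume 1: "p dvd 3 * u^2 + a\<^sub>1 W * u + a\<^sub>2 W"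
    and 2: "p dvd (2 * u + a\<^sub>1 W) * (a\<^sub>2 W + u^2) - a\<^sub>3 W"
  let ?x = "u * (u + u + a\<^sub>1 W)"
  show False
  proof (rule no_singular_point[OF disc, of ?x "u * ?x"])
    have "(2 * u + a\<^sub>1 W) * (a\<^sub>2 W + u^2) - a\<^sub>3 W = (u + u + a\<^sub>1 W) * (a\<^sub>2 W + u * u) - a\<^sub>3 W"
      by (simp add: algebra_simps power2_eq_square)
    with 2 have "p dvd (u + u + a\<^sub>1 W) * (a\<^sub>2 W + u * u) - a\<^sub>3 W"
      by (simp only:)
    then show "p dvd weierstrass_poly W ?x (u * ?x)"
      unfolding poly_slope by (rule dvd_diff[OF dvd_diff[OF dvd_mult dvd_mult2[OF a4]] a6])
    have "2 * (u * ?x) + a\<^sub>1 W * ?x + a\<^sub>3 W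
        = (2 * u + a\<^sub>1 W) * (3 * u^2 + a\<^sub>1 W * u + a\<^sub>2 W) - ((2 * u + a\<^sub>1 W) * (a\<^sub>2 W + u^2) - a\<^sub>3 W)"
      by (simp add: algebra_simps power2_eq_square)
    also have "p dvd \<dots>" by (rule dvd_diff[OF dvd_mult[OF 1] 2])
    finally show "p dvd 2 * (u * ?x) + a\<^sub>1 W * ?x + a\<^sub>3 W" .
    have "a\<^sub>1 W * (u * ?x) - 3 * ?x^2 - 2 * a\<^sub>2 W * ?x - a\<^sub>4 W
        = - (2 * ?x) * (3 * u^2 + a\<^sub>1 W * u + a\<^sub>2 W) - a\<^sub>4 W"
      by (simp add: algebra_simps power2_eq_square)
    also have "p dvd \<dots>" by (rule dvd_diff[OF dvd_mult[OF 1] a4])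
    finally show "p dvd a\<^sub>1 W * (u * ?x) - 3 * ?x^2 - 2 * a\<^sub>2 W * ?x - a\<^sub>4 W" .
  qed
qed (rule a3)

text \<open>A pair gives the point with \<open>x = u (u + v + a\<^sub>1)\<close> and
  \<open>y = u x\<close>; conversely \<open>u = y / x\<close>, and then \<open>v\<close> is solved
  for. The points left out lie over \<open>x = 0\<close> and \<open>x = - a\<^sub>2\<close> and are
  multiples of the origin.\<close>

lemma card_generic_points:
  assumes a2: "p dvd a\<^sub>2 W \<or>
    (\<not> p dvd a\<^sub>2 W \<and> p dvd (a\<^sub>3 W)^2 - a\<^sub>1 W * a\<^sub>2 W * a\<^sub>3 W + (a\<^sub>2 W)^3)"
  shows "card {z \<in> affine_points p W. \<not> p dvd fst z \<and> \<not> p dvd fst z + a\<^sub>2 W} = card pairs"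
proof -
  let ?R = "{z \<in> affine_points p W. \<not> p dvd fst z \<and> \<not> p dvd fst z + a\<^sub>2 W}"
  let ?a1 = "a\<^sub>1 W" and ?a2 = "a\<^sub>2 W" and ?a3 = "a\<^sub>3 W"
  define X where "X = (\<lambda>u v. u * (u + v + a\<^sub>1 W))"
  define f where "f = (\<lambda>(u, v). (X u v mod p, (u * X u v) mod p))"
  have X_unit: "\<not> p dvd X u v" if "(u, v) \<in> pairs" for u v
  proof
    assume "p dvd X u v"
    then have "p dvd u * (u + v + ?a1)" by (simp only: X_def)
    then have s: "p dvd u + v + ?a1"
      by (rule dvd_mult_cancel) (use that in \<open>simp add: pairs_def\<close>)
    have "p dvd relation u v" using that by (simp add: pairs_def)
    from dvd_diff[OF dvd_mult2[OF s, of "?a2 + u * v"] this]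
    have "p dvd (u + v + ?a1) * (?a2 + u * v) - relation u v" .
    then show False using a3 by (simp add: relation_def)
  qed
  have poly: "weierstrass_poly W (X u v) (u * X u v)
      = - (u * X u v) * relation u v - a\<^sub>4 W * X u v - a\<^sub>6 W" for u v
    unfolding X_def relation_def by (rule poly_slope)
  have X_ne: "\<not> p dvd X u v + ?a2" if uv: "(u, v) \<in> pairs" for u v
  proof
    assume e: "p dvd X u v + ?a2"
    have u: "\<not> p dvd u" and v: "\<not> p dvd v" and rel: "p dvd relation u v"
      using uv by (simp_all add: pairs_def)
    show False
    proof (cases "p dvd ?a2")
      case True
      then show ?thesis
        using e X_unit[OF uv] dvd_add_left_iff by blast
    next
      case False
      with a2 have rho: "p dvd ?a3^2 - ?a1 * ?a2 * ?a3 + ?a2^3" by blast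
      have "?a2^2 + ?a2 * (u * v) + ?a3 * u = (X u v + ?a2) * (?a2 + u * v) - u * relation u v"
        by (simp add: X_def relation_def algebra_simps power2_eq_square)
      also have "p dvd \<dots>"
        by (rule dvd_diff[OF dvd_mult2[OF e] dvd_mult[OF rel]])
      finally have 1: "p dvd ?a2^2 + ?a2 * (u * v) + ?a3 * u" .
      have "u * (?a2 * u + ?a1 * ?a2 - ?a3)
          = ?a2 * (X u v + ?a2) - (?a2^2 + ?a2 * (u * v) + ?a3 * u)"
        by (simp add: X_def algebra_simps power2_eq_square)
      also have "p dvd \<dots>"
        by (rule dvd_diff[OF dvd_mult[OF e] 1])
      finally have 2: "p dvd ?a2 * u + ?a1 * ?a2 - ?a3"
        by (rule dvd_mult_cancel[OF _ u])
      have "?a2 * (?a2 * (u * v)) = ?a2 * (?a2^2 + ?a2 * (u * v) + ?a3 * u)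
          - ?a3 * (?a2 * u + ?a1 * ?a2 - ?a3) - (?a3^2 - ?a1 * ?a2 * ?a3 + ?a2^3)"
        by (simp add: algebra_simps power_numeral_reduce)
      also have "p dvd \<dots>"
        by (rule dvd_diff[OF dvd_diff[OF dvd_mult[OF 1] dvd_mult[OF 2]] rho])
      finally have "p dvd u * v"
        by (rule dvd_mult_cancel[OF dvd_mult_cancel[OF _ False] False])
      then show False
        using dvd_mult_cancel[OF _ u] v by blast
    qed
  qed
  have "f ` pairs = ?R"
  proof (intro equalityI subsetI)
    fix z assume "z \<in> f ` pairs"
    then obtain u v where uv: "(u, v) \<in> pairs" and z: "z = (X u v mod p, (u * X u v) mod p)"
      by (auto simp: f_def)
    have "p dvd weierstrass_poly W (X u v) (u * X u v)"
      unfolding poly using uv a4 a6 by (intro dvd_diff) (auto simp: pairs_def)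
    then have "z \<in> affine_points p W"
      unfolding z by (rule mod_affine_points)
    moreover have "\<not> p dvd X u v mod p"
      using X_unit[OF uv] by (simp add: dvd_mod_iff)
    moreover have "\<not> p dvd X u v mod p + ?a2"
    proof -
      have "[X u v mod p + ?a2 = X u v + ?a2] (mod p)"
        by (simp add: cong_def mod_add_left_eq)
      then show ?thesis using X_ne[OF uv] by (simp add: cong_dvd_iff)
    qed
    ultimately show "z \<in> ?R" by (simp add: z)
  next
    fix z assume z: "z \<in> ?R"
    obtain x y where xy: "z = (x, y)" by (cases z)
    have x: "x \<in> {0..<p}" "y \<in> {0..<p}" "p dvd weierstrass_poly W x y" "\<not> p dvd x" "\<not> p dvd x + ?a2"
      using z by (auto simp: xy affine_points_iff)
    obtain u where u: "u \<in> {0..<p}" "p dvd x * u - y" using ex_quotient[OF x(4)] by blast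
    have nu: "\<not> p dvd u"
    proof
      assume "p dvd u"
      from dvd_diff[OF dvd_mult[OF this, of x] u(2)] have py: "p dvd y" by simp
      have "x * (x * (x + ?a2)) = y * (y + ?a1 * x + ?a3) - a\<^sub>4 W * x - a\<^sub>6 W - weierstrass_poly W x y"
        by (simp add: weierstrass_poly_def algebra_simps power2_eq_square power3_eq_cube)
      also have "p dvd \<dots>"
        by (rule dvd_diff[OF dvd_diff[OF dvd_diff[OF dvd_mult2[OF py] dvd_mult2[OF a4]] a6] x(3)])
      finally show False
        using dvd_mult_cancel[OF dvd_mult_cancel[OF _ x(4)] x(4)] x(5) by blast
    qed
    obtain v where v: "v \<in> {0..<p}" "p dvd u * v - (x - u^2 - ?a1 * u)"
      using ex_quotient[OF nu] by blast
    have X: "[X u v = x] (mod p)"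
      using v(2) by (simp add: cong_iff_dvd_diff X_def algebra_simps power2_eq_square)
    have "[u * X u v = u * x] (mod p)" by (intro cong_mult cong_refl X)
    also have "[u * x = y] (mod p)"
      using u(2) by (simp add: cong_iff_dvd_diff mult.commute)
    finally have Y: "[u * X u v = y] (mod p)" .
    have fz: "f (u, v) = z"
      using X Y x by (simp add: f_def xy cong_def)
    have nX: "\<not> p dvd X u v" using X x(4) by (simp add: cong_dvd_iff)
    have "p dvd weierstrass_poly W (X u v) (u * X u v)"
      using weierstrass_poly_cong[OF X Y, of W] x(3) by (simp add: cong_dvd_iff)
    moreover have "(u * X u v) * relation u v = - weierstrass_poly W (X u v) (u * X u v)
        - a\<^sub>4 W * X u v - a\<^sub>6 W"
      unfolding poly by simp
    ultimately have "p dvd (u * X u v) * relation u v"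
      using a4 a6 by (simp only:) (intro dvd_diff, simp_all)
    moreover have "\<not> p dvd u * X u v"
      using dvd_mult_cancel[OF _ nu] nX by blast
    ultimately have rel: "p dvd relation u v"
      by (rule dvd_mult_cancel)
    have "\<not> p dvd v"
    proof
      assume v0: "p dvd v"
      have "(u + ?a1) * ?a2 - ?a3 = relation u v - v * (?a2 + u * v) - (u + ?a1) * u * v"
        by (simp add: relation_def algebra_simps)
      also have "p dvd \<dots>"
        by (rule dvd_diff[OF dvd_diff[OF rel dvd_mult2[OF v0]] dvd_mult[OF v0]])
      finally have 1: "p dvd (u + ?a1) * ?a2 - ?a3" .
      show False
      proof (cases "p dvd ?a2")
        case True
        from dvd_diff[OF dvd_mult[OF True, of "u + ?a1"] 1] show ?thesis using a3 by simp
      next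
        case False
        with a2 have rho: "p dvd ?a3^2 - ?a1 * ?a2 * ?a3 + ?a2^3" by blast
        have "?a2 * (?a2 * (X u v + ?a2)) = ((u + ?a1) * ?a2 - ?a3) * (?a2 * u + ?a3)
            + (?a3^2 - ?a1 * ?a2 * ?a3 + ?a2^3) + v * (?a2^2 * u)"
          by (simp add: X_def algebra_simps power_numeral_reduce)
        also have "p dvd \<dots>"
          by (rule dvd_add[OF dvd_add[OF dvd_mult2[OF 1] rho] dvd_mult2[OF v0]])
        finally have "p dvd X u v + ?a2"
          by (rule dvd_mult_cancel[OF dvd_mult_cancel[OF _ False] False])
        moreover have "[X u v + ?a2 = x + ?a2] (mod p)" by (intro cong_add X cong_refl)
        ultimately show False using x(5) by (simp add: cong_dvd_iff)
      qed
    qed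
    then have "(u, v) \<in> pairs"
      using u v nu rel by (simp add: pairs_def)
    then show "z \<in> f ` pairs" using fz imageI by metis
  qed
  moreover have "inj_on f pairs"
  proof (rule inj_onI, clarify)
    fix u v u' v' assume uv: "(u, v) \<in> pairs" "(u', v') \<in> pairs" and eq: "f (u, v) = f (u', v')"
    have X: "[X u v = X u' v'] (mod p)" and Y: "[u * X u v = u' * X u' v'] (mod p)"
      using eq by (simp_all add: f_def cong_def)
    have r: "u \<in> {0..<p}" "v \<in> {0..<p}" "u' \<in> {0..<p}" "v' \<in> {0..<p}" "\<not> p dvd u"
      using uv by (simp_all add: pairs_def)
    have "[u * X u v = u' * X u v] (mod p)"
      using Y X by (metis cong_scalar_left cong_sym cong_trans)
    then have "p dvd X u v * (u - u')"
      by (simp add: cong_iff_dvd_diff algebra_simps)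
    then have "p dvd u - u'" by (rule dvd_mult_cancel[OF _ X_unit[OF uv(1)]])
    then have u: "u = u'" using r by (intro residue_eq)
    have "p dvd X u v - X u v'"
      using X u by (simp add: cong_iff_dvd_diff)
    then have "p dvd u * (v - v')"
      by (simp add: X_def algebra_simps)
    then have "p dvd v - v'" by (rule dvd_mult_cancel[OF _ r(5)])
    then have "v = v'" using r by (intro residue_eq)
    with u show "u = u' \<and> v = v'" by simp
  qed
  ultimately show ?thesis by (metis card_image)
qed

lemma card_pair: "p dvd a \<Longrightarrow> \<not> p dvd b \<Longrightarrow> card {(x, a mod p), (x, b mod p)} = 2"
  by (auto simp: dvd_eq_mod_eq_0)

lemma vertical_points:
  assumes c: "\<And>y. [weierstrass_poly W x y = y * (y - b)] (mod p)"
  shows "{z \<in> affine_points p W. p dvd fst z - x} = {(x mod p, 0 mod p), (x mod p, b mod p)}"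
proof (intro equalityI subsetI)
  fix z assume z: "z \<in> {z \<in> affine_points p W. p dvd fst z - x}"
  obtain x' y where xy: "z = (x', y)" by (cases z)
  have x': "[x' = x] (mod p)" "x' \<in> {0..<p}" "y \<in> {0..<p}" "p dvd weierstrass_poly W x' y"
    using z by (auto simp: xy affine_points_iff cong_iff_dvd_diff)
  have "p dvd y * (y - b)"
    using x'(4) weierstrass_poly_cong[OF x'(1) cong_refl, of W y] c[of y] by (metis cong_dvd_iff)
  then have "p dvd y \<or> p dvd y - b" using dvd_mult_cancel[of y "y - b"] by blast
  then have "y mod p = 0 mod p \<or> y mod p = b mod p"
    by (auto simp: mod_eq_dvd_iff)
  then have "y = 0 mod p \<or> y = b mod p"
    using x'(3) by simp
  moreover have "x' = x mod p" using x' by (simp add: cong_def)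
  ultimately show "z \<in> {(x mod p, 0 mod p), (x mod p, b mod p)}" by (auto simp: xy)
next
  fix z assume z: "z \<in> {(x mod p, 0 mod p), (x mod p, b mod p)}"
  have "p dvd weierstrass_poly W x 0" "p dvd weierstrass_poly W x b"
    using c[of 0] c[of b] by (simp_all add: cong_0_iff)
  then have "(x mod p, 0 mod p) \<in> affine_points p W" "(x mod p, b mod p) \<in> affine_points p W"
    by (intro mod_affine_points; simp)+
  moreover have "p dvd x mod p - x" by (metis cong_iff_dvd_diff cong_mod_left cong_refl)
  ultimately show "z \<in> {z \<in> affine_points p W. p dvd fst z - x}"
    using z by auto
qed

lemma points_above_zero: "card {z \<in> affine_points p W. p dvd fst z} = 2"
proof -
  have "[weierstrass_poly W 0 y = y * (y - (- a\<^sub>3 W))] (mod p)" for y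
    using a6 by (simp add: weierstrass_poly_def cong_iff_dvd_diff algebra_simps power2_eq_square)
  from vertical_points[OF this] show ?thesis
    using card_pair[of 0 "- a\<^sub>3 W" "0 mod p"] a3 by simp
qed

text \<open>Besides the generic points there are two over \<open>x = 0\<close>; with the point at
  infinity they are the three multiples of the origin.\<close>

lemma card_affine_points_three:
  assumes "p dvd a\<^sub>2 W"
  shows "3 dvd 1 + card (affine_points p W)"
proof -
  let ?R = "{z \<in> affine_points p W. \<not> p dvd fst z \<and> \<not> p dvd fst z + a\<^sub>2 W}"
  let ?Z = "{z \<in> affine_points p W. p dvd fst z}"
  have "p dvd fst z + a\<^sub>2 W \<longleftrightarrow> p dvd fst z" for z :: "int \<times> int"
    using assms by (rule dvd_add_left_iff)
  then have "affine_points p W = ?R \<union> ?Z" by auto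
  moreover have "card (?R \<union> ?Z) = card ?R + card ?Z"
    by (intro card_Un_disjoint) (auto simp: finite_affine_points)
  ultimately have "card (affine_points p W) = card pairs + 2"
    using card_generic_points assms points_above_zero by simp
  then show ?thesis
    using three_dvd_card_pairs[OF assms] by presburger
qed

text \<open>The two points over \<open>x = 0\<close>, the two over \<open>x = - a\<^sub>2\<close>
  and the point at infinity are the five multiples of the origin.\<close>

lemma card_affine_points_five:
  assumes rho: "p dvd (a\<^sub>3 W)^2 - a\<^sub>1 W * a\<^sub>2 W * a\<^sub>3 W + (a\<^sub>2 W)^3"
  shows "5 dvd 1 + card (affine_points p W)"
proof -
  let ?a1 = "a\<^sub>1 W" and ?a2 = "a\<^sub>2 W" and ?a3 = "a\<^sub>3 W"
  have a2: "\<not> p dvd ?a2"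
  proof
    assume a2: "p dvd ?a2"
    have "?a3^2 = (?a3^2 - ?a1 * ?a2 * ?a3 + ?a2^3) + ?a2 * (?a1 * ?a3 - ?a2^2)"
      by (simp add: algebra_simps power_numeral_reduce)
    also have "p dvd \<dots>" by (rule dvd_add[OF rho dvd_mult2[OF a2]])
    finally show False using a3 p prime_dvd_power by blast
  qed
  define \<kappa> where "\<kappa> = ?a1 * ?a2 - ?a3"
  have k: "\<not> p dvd \<kappa>"
  proof
    assume "p dvd \<kappa>"
    from dvd_add[OF rho dvd_mult2[OF this, of ?a3]] have "p dvd ?a2^3"
      by (simp add: \<kappa>_def algebra_simps power2_eq_square)
    then show False using a2 p prime_dvd_power by blast
  qed
  let ?R = "{z \<in> affine_points p W. \<not> p dvd fst z \<and> \<not> p dvd fst z + ?a2}"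
  let ?Z = "{z \<in> affine_points p W. p dvd fst z}"
  let ?Z' = "{z \<in> affine_points p W. p dvd fst z - (- ?a2)}"
  have "[weierstrass_poly W (- ?a2) y = y * (y - \<kappa>)] (mod p)" for y
  proof -
    have "weierstrass_poly W (- ?a2) y - y * (y - \<kappa>) = a\<^sub>4 W * ?a2 - a\<^sub>6 W"
      by (simp add: weierstrass_poly_def \<kappa>_def algebra_simps power2_eq_square power3_eq_cube)
    then show ?thesis using a4 a6 by (simp add: cong_iff_dvd_diff)
  qed
  from vertical_points[OF this] have Z': "card ?Z' = 2"
    using card_pair[of 0 \<kappa> "- ?a2 mod p"] k by simp
  have "affine_points p W = ?R \<union> ?Z \<union> ?Z'" by auto
  moreover have "card (?R \<union> ?Z \<union> ?Z') = card (?R \<union> ?Z) + card ?Z'"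
  proof (rule card_Un_disjoint)
    have "\<not> (p dvd x \<and> p dvd x - (- ?a2))" for x
      using a2 dvd_add_right_iff[of p x ?a2] by auto
    then show "(?R \<union> ?Z) \<inter> ?Z' = {}" by auto
  qed (auto simp: finite_affine_points)
  moreover have "card (?R \<union> ?Z) = card ?R + card ?Z"
    by (intro card_Un_disjoint) (auto simp: finite_affine_points)
  ultimately have "card (affine_points p W) = card pairs + 4"
    using card_generic_points a2 rho points_above_zero Z' by simp
  then show ?thesis
    using five_dvd_card_pairs[OF a2 rho] by presburger
qed

end

subsection \<open>Torsion points modulo a prime\<close>

context padic
begin

text \<open>Integrality of both sides is part of the relation, which makes it compatible with
  products.\<close>

definition padic_cong :: "rat \<Rightarrow> rat \<Rightarrow> bool" where
  "padic_cong x y \<longleftrightarrow> vge 0 x \<and> vge 0 y \<and> vge 1 (x - y)"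

lemma padic_cong_refl: "vge 0 x \<Longrightarrow> padic_cong x x"
  by (simp add: padic_cong_def)

lemma padic_cong_add:
  assumes "padic_cong x y" "padic_cong x' y'"
  shows "padic_cong (x + x') (y + y')"
proof -
  have "vge 1 ((x - y) + (x' - y'))"
    using assms by (intro vge_add) (auto simp: padic_cong_def)
  then show ?thesis
    using assms by (simp add: padic_cong_def vge_add algebra_simps)
qed

lemma padic_cong_diff:
  assumes "padic_cong x y" "padic_cong x' y'"
  shows "padic_cong (x - x') (y - y')"
proof -
  have "vge 1 ((x - y) - (x' - y'))"
    using assms unfolding padic_cong_def by (metis vge_diff)
  then show ?thesis
    using assms by (simp add: padic_cong_def vge_diff algebra_simps)
qed

lemma padic_cong_mult:
  assumes "padic_cong x y" "padic_cong x' y'"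
  shows "padic_cong (x * x') (y * y')"
proof -
  have "vge 1 ((x - y) * x')" "vge 1 (y * (x' - y'))"
    using assms by (auto simp: padic_cong_def intro: vge_mult_left vge_mult_right)
  then have "vge 1 ((x - y) * x' + y * (x' - y'))" by (rule vge_add)
  then have "vge 1 (x * x' - y * y')" by (simp add: algebra_simps)
  then show ?thesis
    using assms by (simp add: padic_cong_def vge_mult_left)
qed

lemma padic_cong_power: "padic_cong x y \<Longrightarrow> padic_cong (x ^ n) (y ^ n)"
  by (induction n) (simp_all add: padic_cong_mult padic_cong_refl vge_one)

lemma padic_cong_numeral: "padic_cong (numeral n) (numeral n)"
  by (intro padic_cong_refl vge_numeral)

lemmas padic_cong_intros = padic_cong_add padic_cong_diff padic_cong_mult padic_cong_power padic_cong_numeral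

lemma ex_padic_cong: "vge 0 x \<Longrightarrow> \<exists>i. padic_cong x (of_int i)"
  using ex_int_approx by (auto simp: padic_cong_def vge_of_int)

lemma padic_cong_zero_imp_dvd: "padic_cong 0 (of_int n) \<Longrightarrow> int p dvd n"
  by (simp add: padic_cong_def vge_1_of_int_iff)

end

lemma discriminant_short:
  "discriminant (Weierstrass 0 A 0 B C) = 16 * cubic_disc A B C"
  by (simp add: discriminant_def b\<^sub>2_def b\<^sub>4_def b\<^sub>6_def b\<^sub>8_def cubic_disc_def
      algebra_simps power_numeral_reduce)

context integral_curve
begin

definition model :: "int weierstrass" where
  "model = Weierstrass 0 A\<^sub>0 0 B\<^sub>0 C\<^sub>0"

lemma prime_int: "prime (int p)"
  using prime by simp

lemma model_discriminant: "\<not> int p dvd discriminant model"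
proof
  assume "int p dvd discriminant model"
  then have "int p dvd 2 ^ 4 * cubic_disc A\<^sub>0 B\<^sub>0 C\<^sub>0"
    by (simp add: model_def discriminant_short)
  then have "int p dvd 2"
    using good prime_int by (metis prime_dvd_mult_iff prime_dvd_power)
  then show False
    using two_unit vge_1_of_int_iff[of 2] unit_iff[of 2] by simp
qed

lemma card_shift:
  "card (affine_points (int p) model) = card (affine_points (int p) (shift r s t model))"
proof -
  interpret prime_modulus "int p" by standard (rule prime_int)
  show ?thesis
    by (rule card_affine_points_change[OF ec_change_shift])
      (use prime_int in \<open>auto simp: prime_elem_not_unit\<close>)
qed

lemma padic_cong_coeffs: "padic_cong A (of_int A\<^sub>0)" "padic_cong B (of_int B\<^sub>0)" "padic_cong C (of_int C\<^sub>0)"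
  by (simp_all add: A_def B_def C_def padic_cong_refl vge_of_int)

lemma torsion_mem: "P \<in> ec_torsion curve \<Longrightarrow> P \<in> ec_points curve"
  by (simp add: ec_torsion_def ec_group_def)

lemma pow_one_point: "P \<in> ec_points curve \<Longrightarrow> pow P 1 = P"
  and pow_two: "P \<in> ec_points curve \<Longrightarrow> pow P 2 = P \<oplus>\<^sub>c P"
  and pow_three: "P \<in> ec_points curve \<Longrightarrow> pow P 3 = (P \<oplus>\<^sub>c P) \<oplus>\<^sub>c P"
  unfolding numeral_2_eq_2 numeral_3_eq_3 One_nat_def ec_group_pow by simp_all

lemma pow_add:
  assumes "P \<in> ec_points curve"
  shows "pow P (m + n) = pow P m \<oplus>\<^sub>c pow P n"
proof -
  interpret group "ec_group curve" by (rule group)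
  show ?thesis
    using nat_pow_mult[of P m n] assms by (simp add: ec_group_def)
qed

lemma neg_neg: "neg (neg P) = P"
  by (cases P) simp_all

lemma eq_neg_of_add_eq_infinity:
  assumes "P \<in> ec_points curve" "Q \<in> ec_points curve" "P \<oplus>\<^sub>c Q = Infinity"
  shows "P = neg Q"
proof -
  interpret group "ec_group curve" by (rule group)
  have "neg Q \<oplus>\<^sub>c Q = Infinity" by (cases Q) simp_all
  then have eq: "P \<oplus>\<^sub>c Q = neg Q \<oplus>\<^sub>c Q" using assms(3) by simp
  have "(P \<oplus>\<^sub>c Q = neg Q \<oplus>\<^sub>c Q) = (P = neg Q)"
    using right_cancel[of Q P "neg Q"] assms(1,2) neg_mem[OF assms(2)] by (simp add: ec_group_def)
  then show ?thesis using eq by (rule iffD1)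
qed

lemma two_dvd_count:
  assumes "2 dvd card (ec_torsion curve)"
  shows "2 dvd 1 + card (affine_points (int p) model)"
proof -
  obtain x y where P: "Affine x y \<in> ec_torsion curve" "pow (Affine x y) 2 = Infinity"
    using ex_point_of_prime_order[of 2] assms by auto
  have mem: "Affine x y \<in> ec_points curve" using torsion_mem[OF P(1)] .
  have "Affine x y = neg (Affine x y)"
    using P(2) eq_neg_of_add_eq_infinity[OF mem mem] unfolding pow_two[OF mem] by blast
  then have "y = 0" by simp
  \<comment> \<open>The summands are ordered as in \<open>a\<^sub>6\<close> of \<open>shift\<close>,
    so that their reduction is literally that coefficient.\<close>
  then have h: "C + x * B + x^2 * A + x^3 = 0"
    using mem by (simp add: affine_mem_iff algebra_simps)
  obtain i where i: "padic_cong x (of_int i)"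
    using ex_padic_cong torsion_integral(1)[OF P(1)] by blast
  have "padic_cong (C + x * B + x^2 * A + x^3)
      (of_int C\<^sub>0 + of_int i * of_int B\<^sub>0 + (of_int i)^2 * of_int A\<^sub>0 + (of_int i)^3)"
    by (intro padic_cong_intros padic_cong_coeffs i)
  then have "padic_cong 0 (of_int (C\<^sub>0 + i * B\<^sub>0 + i^2 * A\<^sub>0 + i^3))"
    unfolding h by simp
  then have a6: "int p dvd a\<^sub>6 (shift i 0 0 model)"
    by (simp add: shift_def model_def padic_cong_zero_imp_dvd)
  interpret prime_modulus "int p" by standard (rule prime_int)
  show ?thesis
    unfolding card_shift[of i 0 0]
    by (rule card_affine_points_two[OF _ _ a6])
      (simp_all only: discriminant_shift model_discriminant, simp_all add: shift_def model_def)
qed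

text \<open>The tangent slope \<open>l\<close> at a torsion point is \<open>p\<close>-integral:
  twice the point is again torsion, so its abscissa is integral, and \<open>l^2\<close> is a sum of
  integral terms. Point and slope can thus be reduced together.\<close>

lemma tangent_normal_form:
  assumes P: "Affine x y \<in> ec_torsion curve" and y0: "y \<noteq> 0"
  obtains l m x'' i j k where
    "Affine x y \<oplus>\<^sub>c Affine x y = Affine x'' (- (l * x'' + m))" "y = l * x + m"
    "l^2 = A + 2 * x + x''"
    "padic_cong x (of_int i)" "padic_cong y (of_int j)" "padic_cong l (of_int k)"
    "normal_form (int p) (shift i k j model)"
proof -
  have mem: "Affine x y \<in> ec_points curve" using torsion_mem[OF P] .
  then have h: "y^2 = x^3 + A * x^2 + B * x + C" by (simp add: affine_mem_iff)
  have ns: "\<not> (x = x \<and> y + y = 0)" using y0 by simp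
  obtain l m x'' where sum: "Affine x y \<oplus>\<^sub>c Affine x y = Affine x'' (- (l * x'' + m))"
    and y: "y = l * x + m" and l: "2 * y * l = 3 * x^2 + 2 * A * x + B" and e1: "x + x + x'' = l^2 - A"
    using add_affine_line[OF mem mem ns] by metis
  have l2: "l^2 = A + 2 * x + x''" using e1 by simp
  have xy: "vge 0 x" "vge 0 y" using torsion_integral[OF P] by simp_all
  have "vge 0 x''"
    using add_torsion[OF P P] sum torsion_integral(1) by simp
  then have "vge 0 (l^2)"
    unfolding l2 by (intro vge_add vge_mult_left vge_numeral vge_coeffs xy)
  then have "vge 0 l" by (rule vge_0_of_power) simp
  then obtain i j k where ijk: "padic_cong x (of_int i)" "padic_cong y (of_int j)" "padic_cong l (of_int k)"
    using xy ex_padic_cong by metis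
  have "padic_cong (B + 2 * x * A + 3 * x^2 - 2 * l * y)
    (of_int B\<^sub>0 + 2 * of_int i * of_int A\<^sub>0 + 3 * (of_int i)^2 - 2 * of_int k * of_int j)"
    by (intro padic_cong_intros padic_cong_coeffs ijk)
  moreover have "B + 2 * x * A + 3 * x^2 - 2 * l * y = 0"
    using l by (simp add: algebra_simps)
  ultimately have "padic_cong 0 (of_int (B\<^sub>0 + 2 * i * A\<^sub>0 + 3 * i^2 - 2 * k * j))"
    by simp
  then have a4: "int p dvd a\<^sub>4 (shift i k j model)"
    by (simp add: shift_def model_def padic_cong_zero_imp_dvd)
  have "padic_cong (C + x * B + x^2 * A + x^3 - y^2)
    (of_int C\<^sub>0 + of_int i * of_int B\<^sub>0 + (of_int i)^2 * of_int A\<^sub>0 + (of_int i)^3 - (of_int j)^2)"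
    by (intro padic_cong_intros padic_cong_coeffs ijk)
  moreover have "C + x * B + x^2 * A + x^3 - y^2 = 0"
    using h by (simp add: algebra_simps)
  ultimately have "padic_cong 0 (of_int (C\<^sub>0 + i * B\<^sub>0 + i^2 * A\<^sub>0 + i^3 - j^2))"
    by simp
  then have a6: "int p dvd a\<^sub>6 (shift i k j model)"
    by (simp add: shift_def model_def padic_cong_zero_imp_dvd)
  have "normal_form (int p) (shift i k j model)"
    by standard (simp_all add: prime a4 a6 discriminant_shift model_discriminant)
  then show ?thesis
    using that[OF sum y l2 ijk] by blast
qed

text \<open>For a point of order 3, twice the point is its negative, so the tangent meets the curve
  nowhere else: \<open>x'' = x\<close> and \<open>l^2 = A + 3 x\<close>, which is the vanishing of
  \<open>a\<^sub>2\<close> after the shift.\<close>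

lemma three_dvd_count:
  assumes "3 dvd card (ec_torsion curve)"
  shows "3 dvd 1 + card (affine_points (int p) model)"
proof -
  obtain x y where P: "Affine x y \<in> ec_torsion curve" "pow (Affine x y) 3 = Infinity"
    using ex_point_of_prime_order[of 3] assms by auto
  have mem: "Affine x y \<in> ec_points curve" using torsion_mem[OF P(1)] .
  have PP: "Affine x y \<oplus>\<^sub>c Affine x y = neg (Affine x y)"
    using P(2) eq_neg_of_add_eq_infinity[OF add_mem[OF mem mem] mem] unfolding pow_three[OF mem] by blast
  have "y \<noteq> 0"
  proof
    assume "y = 0"
    then have "Affine x y \<oplus>\<^sub>c Affine x y = Infinity" by simp
    then show False using PP by simp
  qed
  then obtain l m x'' i j k where *:
    "Affine x y \<oplus>\<^sub>c Affine x y = Affine x'' (- (l * x'' + m))" "l^2 = A + 2 * x + x''"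
    "padic_cong x (of_int i)" "padic_cong y (of_int j)" "padic_cong l (of_int k)"
    "normal_form (int p) (shift i k j model)"
    using tangent_normal_form[OF P(1)] by metis
  have "x'' = x" using *(1) PP by simp
  then have "A + 3 * x - l^2 = 0" using *(2) by simp
  moreover have "padic_cong (A + 3 * x - l^2) (of_int A\<^sub>0 + 3 * of_int i - (of_int k)^2)"
    by (intro padic_cong_intros padic_cong_coeffs *)
  ultimately have "padic_cong 0 (of_int (A\<^sub>0 + 3 * i - k^2))"
    by simp
  then have "int p dvd a\<^sub>2 (shift i k j model)"
    by (simp add: shift_def model_def padic_cong_zero_imp_dvd)
  then show ?thesis
    unfolding card_shift[of i k j] by (rule normal_form.card_affine_points_three[OF *(6)])
qed

text \<open>For a point of order 5, its double and triple are opposite and share the abscissa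
  \<open>x''\<close>. Vieta's formula then gives the square of the slope of the chord through the
  point and its double, and eliminating this slope yields the relation for order 5.\<close>

lemma five_dvd_count:
  assumes "5 dvd card (ec_torsion curve)"
  shows "5 dvd 1 + card (affine_points (int p) model)"
proof -
  obtain x y where P: "Affine x y \<in> ec_torsion curve" "pow (Affine x y) 5 = Infinity"
    using ex_point_of_prime_order[of 5] assms by auto
  let ?P = "Affine x y"
  have mem: "?P \<in> ec_points curve" using torsion_mem[OF P(1)] .
  \<comment> \<open>The second equation writes six times the point in two ways; it rules out that
    three times the point is zero.\<close>
  have p5: "pow ?P 2 \<oplus>\<^sub>c pow ?P 3 = Infinity" "pow ?P 5 \<oplus>\<^sub>c pow ?P 1 = pow ?P 3 \<oplus>\<^sub>c pow ?P 3"
    "pow ?P 3 = pow ?P 2 \<oplus>\<^sub>c ?P"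
    using pow_add[OF mem, of 2 3] pow_add[OF mem, of 5 1] pow_add[OF mem, of 3 3] P(2)
      pow_two[OF mem] pow_three[OF mem] by simp_all
  have three: "pow ?P 3 \<noteq> Infinity"
  proof
    assume "pow ?P 3 = Infinity"
    then have "pow ?P 1 = Infinity" using p5(2) P(2) by simp
    then show False using pow_one_point[OF mem] by simp
  qed
  have "y \<noteq> 0"
  proof
    assume "y = 0"
    then have "pow ?P 2 = Infinity" unfolding pow_two[OF mem] by simp
    then show False using p5(1) three by simp
  qed
  then obtain l m x'' i j k where *:
    "?P \<oplus>\<^sub>c ?P = Affine x'' (- (l * x'' + m))" "y = l * x + m" "l^2 = A + 2 * x + x''"
    "padic_cong x (of_int i)" "padic_cong y (of_int j)" "padic_cong l (of_int k)"
    "normal_form (int p) (shift i k j model)"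
    using tangent_normal_form[OF P(1)] by metis
  define y'' where "y'' = - (l * x'' + m)"
  have Q: "pow ?P 2 = Affine x'' y''" using pow_two[OF mem] * by (simp add: y''_def)
  have memQ: "Affine x'' y'' \<in> ec_points curve"
    using ec_pow_mem[OF closed mem, of 2] Q by simp
  have mem3: "pow ?P 3 \<in> ec_points curve" by (rule ec_pow_mem[OF closed mem])
  have "Affine x'' y'' = neg (pow ?P 3)"
    using p5(1) unfolding Q by (rule eq_neg_of_add_eq_infinity[OF memQ mem3])
  then have "neg (Affine x'' y'') = pow ?P 3"
    by (simp only: neg_neg)
  moreover have "pow ?P 3 = Affine x'' y'' \<oplus>\<^sub>c ?P"
    using p5(3) unfolding Q .
  ultimately have R: "Affine x'' y'' \<oplus>\<^sub>c ?P = Affine x'' (- y'')"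
    by (simp only: neg.simps)
  have ns: "\<not> (x'' = x \<and> y'' + y = 0)"
  proof
    assume "x'' = x \<and> y'' + y = 0"
    then have "Affine x'' y'' \<oplus>\<^sub>c ?P = Infinity" by simp
    then show False using R by simp
  qed
  have x: "x'' \<noteq> x"
  proof
    assume "x'' = x"
    then have "y'' = - y" using * by (simp add: y''_def)
    then show False using ns \<open>x'' = x\<close> by simp
  qed
  obtain l' m' x3 where "Affine x'' y'' \<oplus>\<^sub>c ?P = Affine x3 (- (l' * x3 + m'))"
    "x'' \<noteq> x \<Longrightarrow> l' = (y - y'') / (x - x'')" "x'' + x + x3 = l'^2 - A"
    using add_affine_line[OF memQ mem ns] by metis
  then have l': "l' * (x - x'') = y - y''" and e: "l'^2 = A + x + 2 * x''"
    using R x by simp_all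
  have a2: "A + 3 * x - l^2 = x - x''" using *(3) by simp
  have s: "l' * (x - x'') = 2 * y - l * (x - x'')"
    unfolding l' y''_def using *(2) by (simp add: algebra_simps)
  \<comment> \<open>After the shift \<open>a\<^sub>1\<close>, \<open>a\<^sub>2\<close> and
    \<open>a\<^sub>3\<close> are the reductions of \<open>2 l\<close>, \<open>x - x''\<close> and
    \<open>2 y\<close>, so this is the relation for order 5; it vanishes by the two expressions for
    \<open>l'\<close>.\<close>
  have "(2 * y)^2 - 2 * l * (x - x'') * (2 * y) + (x - x'')^3
      = (2 * y - l * (x - x''))^2 - (x - x'')^2 * (l^2 - (x - x''))"
    by (simp add: algebra_simps power_numeral_reduce)
  also have "l^2 - (x - x'') = l'^2" unfolding *(3) e by simp
  also have "(2 * y - l * (x - x''))^2 = (x - x'')^2 * l'^2"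
    unfolding s[symmetric] by (simp add: power_mult_distrib)
  finally have rho: "(2 * y)^2 - 2 * l * (A + 3 * x - l^2) * (2 * y) + (A + 3 * x - l^2)^3 = 0"
    unfolding a2 by simp
  have "padic_cong ((2 * y)^2 - 2 * l * (A + 3 * x - l^2) * (2 * y) + (A + 3 * x - l^2)^3)
    ((2 * of_int j)^2 - 2 * of_int k * (of_int A\<^sub>0 + 3 * of_int i - (of_int k)^2) * (2 * of_int j)
      + (of_int A\<^sub>0 + 3 * of_int i - (of_int k)^2)^3)"
    by (intro padic_cong_intros padic_cong_coeffs *)
  then have "padic_cong 0 (of_int ((2 * j)^2 - 2 * k * (A\<^sub>0 + 3 * i - k^2) * (2 * j) + (A\<^sub>0 + 3 * i - k^2)^3))"
    unfolding rho by simp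
  then have "int p dvd (2 * j)^2 - 2 * k * (A\<^sub>0 + 3 * i - k^2) * (2 * j) + (A\<^sub>0 + 3 * i - k^2)^3"
    by (rule padic_cong_zero_imp_dvd)
  then have "int p dvd (a\<^sub>3 (shift i k j model))^2
      - a\<^sub>1 (shift i k j model) * a\<^sub>2 (shift i k j model) * a\<^sub>3 (shift i k j model)
      + (a\<^sub>2 (shift i k j model))^3"
    by (simp add: shift_def model_def)
  then show ?thesis
    unfolding card_shift[of i k j] by (rule normal_form.card_affine_points_five[OF *(7)])
qed

end

subsection \<open>The number of points and the torsion subgroup\<close>

text \<open>Completing the square, scaled by 2 so that the short equation stays integral.\<close>

lemma ec_change_short:
  "ec_change 2 0 (a\<^sub>1 W) (4 * a\<^sub>3 W) (Weierstrass 0 (b\<^sub>2 W) 0 (8 * b\<^sub>4 W) (16 * b\<^sub>6 W)) W"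
  by (simp add: ec_change_def b\<^sub>2_def b\<^sub>4_def b\<^sub>6_def algebra_simps power_numeral_reduce)

text \<open>The torsion over the rationals and the point count modulo \<open>p\<close> are both
  carried to the same short integral equation, where the divisibility by 2 and by \<open>r\<close>
  is available.\<close>

lemma torsion_dvd_num_points:
  assumes E: "elliptic_curve E" and p: "prime p" "\<not> p dvd conductor E" "p \<noteq> 2"
    and r: "r \<in> {3, 5}" "2 * r dvd card (ec_torsion E)"
  shows "2 * r dvd num_points_mod E p"
proof -
  define W where "W = minimal_model p E"
  define S :: "int weierstrass" where "S = Weierstrass 0 (b\<^sub>2 W) 0 (8 * b\<^sub>4 W) (16 * b\<^sub>6 W)"
  have disc: "\<not> int p dvd discriminant W"
    unfolding W_def by (rule good_reduction[OF E p(1,2)])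
  have p2: "\<not> int p dvd 2"
    using p(1,3) primes_dvd_imp_eq[of p 2] by (metis int_dvd_int_iff of_nat_numeral two_is_prime_nat)
  have SW: "ec_change 2 0 (a\<^sub>1 W) (4 * a\<^sub>3 W) S W"
    unfolding S_def by (rule ec_change_short)
  have "\<not> int p dvd cubic_disc (b\<^sub>2 W) (8 * b\<^sub>4 W) (16 * b\<^sub>6 W)"
  proof
    assume "int p dvd cubic_disc (b\<^sub>2 W) (8 * b\<^sub>4 W) (16 * b\<^sub>6 W)"
    then have "int p dvd discriminant S"
      by (simp add: S_def discriminant_short)
    \<comment> \<open>The short equation has \<open>2^12\<close> times the discriminant of
      \<open>W\<close>, so for odd \<open>p\<close> its reduction is good too.\<close>
    then have "int p dvd 2 ^ 12 * discriminant W"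
      by (simp only: discriminant_change[OF SW])
    then show False
      using disc p2 p(1) by (metis prime_dvd_mult_iff prime_dvd_power prime_nat_int_transfer)
  qed
  then interpret integral_curve p "b\<^sub>2 W" "8 * b\<^sub>4 W" "16 * b\<^sub>6 W"
    by unfold_locales (use p in auto)
  obtain u r' s t where ch: "u \<noteq> 0" "ec_change u r' s t E (map_weierstrass of_int W)"
    using integral_model_minimal_model[of E p]
    by (auto simp: integral_model_def ec_isomorphic_iff_change W_def)
  have "curve = Weierstrass 0 (b\<^sub>2 (map_weierstrass of_int W)) 0
      (8 * b\<^sub>4 (map_weierstrass of_int W)) (16 * b\<^sub>6 (map_weierstrass of_int W))"
    unfolding A_def B_def C_def by (simp add: b\<^sub>2_def b\<^sub>4_def b\<^sub>6_def weierstrass.map_sel)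
  then have ch': "ec_change 2 0 (a\<^sub>1 (map_weierstrass of_int W)) (4 * a\<^sub>3 (map_weierstrass of_int W))
      curve (map_weierstrass of_int W)"
    by (simp only: ec_change_short)
  have closedW: "ec_add_closed (map_weierstrass of_int W :: rat weierstrass)"
    by (rule ec_add_closed_change[OF ch' _ closed]) simp
  have card: "card (ec_torsion E) = card (ec_torsion curve)"
    using card_torsion_change[OF ch(2,1) closedW] card_torsion_change[OF ch' _ closedW] by simp
  have num: "num_points_mod E p = 1 + card (affine_points (int p) model)"
  proof -
    interpret prime_modulus "int p" by standard (rule prime_int)
    have "card (affine_points (int p) S) = card (affine_points (int p) W)"
      by (rule card_affine_points_change[OF SW p2])
    then show ?thesis
      by (simp add: num_points_mod_eq W_def[symmetric] S_def model_def)
  qed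
  have "2 dvd num_points_mod E p"
    unfolding num using r(2) card by (intro two_dvd_count) (metis dvd_mult_left)
  moreover have "r dvd num_points_mod E p"
    using r three_dvd_count five_dvd_count card unfolding num by (metis dvd_mult_right empty_iff insertE)
  moreover have "coprime 2 r" using r(1) by auto
  ultimately show ?thesis by (simp add: divides_mult)
qed

theorem theorem1p4:
  fixes E :: "rat weierstrass" and N :: nat
    and f :: "complex \<Rightarrow> complex" and a :: "nat \<Rightarrow> int"
    and r p d v :: nat
  assumes "elliptic_curve E"
    and "N = conductor E"
    and "corresponding_newform E f a"
    and "r \<in> {3, 5}"
    and "2 * r dvd card (ec_torsion E)"
    and "prime p"
    and "gcd p (2 * r * N) = 1"
    and "d \<ge> 1"
    and "v \<ge> 1"
    and "a (p ^ (d - 1)) = int r ^ v"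
  shows "d = r"
proof -
  have cop: "coprime p 2" "coprime p r" "coprime p N"
  proof -
    have "coprime p (2 * r * N)"
      using assms(7) by (simp only: coprime_iff_gcd_eq_1)
    then show "coprime p 2" "coprime p r" "coprime p N"
      by (simp_all add: coprime_mult_right_iff)
  qed
  have p: "p \<noteq> 2" "p \<noteq> r" "\<not> p dvd conductor E"
    using cop assms(2,6) by (auto simp: coprime_absorb_left)
  have "a p = int p + 1 - int (num_points_mod E p)"
    using assms(3,6) p(3) by (simp add: corresponding_newform_def)
  moreover have "int (2 * r) dvd int (num_points_mod E p)"
    using torsion_dvd_num_points[OF assms(1,6) p(3,1) assms(4,5)] by (simp only: int_dvd_int_iff)
  ultimately have "[a p = int p + 1] (mod int (2 * r))"
    by (simp add: cong_iff_dvd_diff)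
  moreover have "lucas (a p) (int p) d = int r ^ v"
    using newform_coeff_prime_power[OF assms(3,6) p(3), of "d - 1"] assms(8,10) by simp
  ultimately show ?thesis
    using lucas_prime_power_index assms(4,6,9) p by blast
qed

end
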